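(* Let $r\ge2$ and let $F$ be an $r$-critical graph. Then $c_2(F)=\hat\rho_F-(1-1/r)$ (interpreted as $\infty$ if $\hat\rho_F=\infty$). Furthermore, if $\hat\rho_F=\infty$, then for every $q=q(n)\ge1$ with $q/n^2\to0$ we have $h_F(n,q)=(1+o(1))\,q\,c(n,F)$.
   Context: A graph $F$ is $r$-critical if $\chi(F)=r+1$ and $F$ contains an edge $e$ with $\chi(F-e)=r$; let $f=|V(F)|$. $h_F(n,q)$ is the minimum number of copies (subgraphs isomorphic to) $F$ in a graph with $n$ vertices and $\mathrm{ex}(n,F)+q$ edges, and $\mathcal{H}_F(n,q)$ the set of such graphs attaining the minimum; $\#F(H)$ is the number of copies of $F$ in $H$. $c(n,F)$ is the minimum number of copies of $F$ in a graph obtained from the Turán graph $T_r(n)$ by adding one edge; there is $\alpha_F>0$ with $c(n,F)=\alpha_F n^{f-2}+O(n^{f-3})$. Define $c_2(F)=\sup\{c:\forall\epsilon>0\ \exists n_0\ \forall n\ge n_0\ \forall q\le cn\ (H\in\mathcal{H}_F(n,q)\Rightarrow \#F(H)/(q\,c(n,F))\ge1-\epsilon)\}$. A vertex $u$ of $F$ is critical if $\chi(F-u)=r$; $\mathrm{Aut}(F)$ is the number of automorphisms of $F$; $P_F(\boldsymbol{\xi})=\frac{1}{\mathrm{Aut}(F)}\sum_{u\text{ critical}}\sum_{\chi_u}\prod_{i=1}^r r^{-x_i}\xi_i^{y_i}$, the inner sum over proper colorings $\chi_u:V(F)\setminus\{u\}\to[r]$ of $F-u$, with $y_i$ (resp.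 $x_i$) the number of neighbors (resp. non-neighbors other than $u$) of $u$ colored $i$. Let $\mathcal{S}_\rho=\{\boldsymbol{\xi}\in[0,1/r]^r:\sum_i\xi_i=\rho\}$, $p(\rho)=\min_{\mathcal{S}_\rho}P_F$. If $P_F$ has total degree at least $r+1$, $\hat\rho_F=\inf\{\rho\in(\frac{r-1}r,1):p(\rho)<\alpha_F(\rho-\frac{r-1}r)\}$; if $P_F$ has total degree $r$, or $p(\rho)\ge\alpha_F(\rho-\frac{r-1}r)$ for all $\rho\in(\frac{r-1}r,1)$, then $\hat\rho_F=\infty$. *)

theory Defs
  imports Complex_Main "HOL-Library.FuncSet" "HOL-Library.Extended_Real"
begin

definition is_graph :: "nat set \<Rightarrow> nat set set \<Rightarrow> bool" where
  "is_graph V E \<longleftrightarrow> finite V \<and> E \<subseteq> {{u,v} | u v. u \<in> V \<and> v \<in> V \<and> u \<noteq> v}"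

definition pairs :: "nat \<Rightarrow> nat set set" where
  "pairs n = {{u,v} | u v. u < n \<and> v < n \<and> u \<noteq> v}"

definition copies :: "nat set \<Rightarrow> nat set set \<Rightarrow> nat set \<Rightarrow> nat set set \<Rightarrow> (nat set \<times> nat set set) set" where
  "copies VF EF V E = {(V', E'). V' \<subseteq> V \<and> E' \<subseteq> E \<and>
      (\<exists>\<phi>. bij_betw \<phi> VF V' \<and> E' = (\<lambda>e. \<phi> ` e) ` EF)}"

definition num_copies :: "nat set \<Rightarrow> nat set set \<Rightarrow> nat set \<Rightarrow> nat set set \<Rightarrow> nat" where
  "num_copies VF EF V E = card (copies VF EF V E)"

definition colorable :: "nat set \<Rightarrow> nat set set \<Rightarrow> nat \<Rightarrow> bool" where
  "colorable V E k \<longleftrightarrow> (\<exists>c::nat \<Rightarrow> nat. (\<forall>v\<in>V. c v < k) \<and>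
      (\<forall>u\<in>V. \<forall>v\<in>V. {u,v} \<in> E \<longrightarrow> c u \<noteq> c v))"

definition chi :: "nat set \<Rightarrow> nat set set \<Rightarrow> nat" where
  "chi V E = (LEAST k. colorable V E k)"

definition critical_graph :: "nat \<Rightarrow> nat set \<Rightarrow> nat set set \<Rightarrow> bool" where
  "critical_graph r VF EF \<longleftrightarrow> is_graph VF EF \<and> chi VF EF = r + 1 \<and>
      (\<exists>e\<in>EF. chi VF (EF - {e}) = r)"

definition critical_vertex :: "nat \<Rightarrow> nat set \<Rightarrow> nat set set \<Rightarrow> nat \<Rightarrow> bool" where
  "critical_vertex r VF EF u \<longleftrightarrow> u \<in> VF \<and> chi (VF - {u}) {e \<in> EF. u \<notin> e} = r"

definition ex_num :: "nat set \<Rightarrow> nat set set \<Rightarrow> nat \<Rightarrow> nat" where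
  "ex_num VF EF n = Max {card E | E. E \<subseteq> pairs n \<and> num_copies VF EF {0..<n} E = 0}"

definition h_num :: "nat set \<Rightarrow> nat set set \<Rightarrow> nat \<Rightarrow> nat \<Rightarrow> nat" where
  "h_num VF EF n q = Inf {num_copies VF EF {0..<n} E | E.
      E \<subseteq> pairs n \<and> card E = ex_num VF EF n + q}"

definition H_set :: "nat set \<Rightarrow> nat set set \<Rightarrow> nat \<Rightarrow> nat \<Rightarrow> nat set set set" where
  "H_set VF EF n q = {E. E \<subseteq> pairs n \<and> card E = ex_num VF EF n + q \<and>
      num_copies VF EF {0..<n} E = h_num VF EF n q}"

(* Turan graph T_r(n) on [n]: parts are the residue classes mod r (sizes differ by at most 1) *)
definition turan_edges :: "nat \<Rightarrow> nat \<Rightarrow> nat set set" where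
  "turan_edges r n = {{u,v} | u v. u < n \<and> v < n \<and> u mod r \<noteq> v mod r}"

definition c_num :: "nat \<Rightarrow> nat set \<Rightarrow> nat set set \<Rightarrow> nat \<Rightarrow> nat" where
  "c_num r VF EF n = Inf {num_copies VF EF {0..<n} (insert e (turan_edges r n)) | e.
      e \<in> pairs n - turan_edges r n}"

(* alpha_F: the constant with c(n,F) = alpha_F n^(f-2) + O(n^(f-3)) *)
definition alpha :: "nat \<Rightarrow> nat set \<Rightarrow> nat set set \<Rightarrow> real" where
  "alpha r VF EF = lim (\<lambda>n. real (c_num r VF EF n) / real n ^ (card VF - 2))"

definition aut :: "nat set \<Rightarrow> nat set set \<Rightarrow> nat" where
  "aut VF EF = card {\<phi> \<in> VF \<rightarrow>\<^sub>E VF. bij_betw \<phi> VF VF \<and>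
      (\<forall>u\<in>VF. \<forall>v\<in>VF. {u,v} \<in> EF \<longleftrightarrow> {\<phi> u, \<phi> v} \<in> EF)}"

(* proper colorings of F - u with colours {0..<r} (colour i here = colour i+1 of the paper) *)
definition proper_colorings :: "nat \<Rightarrow> nat set \<Rightarrow> nat set set \<Rightarrow> nat \<Rightarrow> (nat \<Rightarrow> nat) set" where
  "proper_colorings r VF EF u = {c \<in> (VF - {u}) \<rightarrow>\<^sub>E {0..<r}.
      \<forall>v\<in>VF - {u}. \<forall>w\<in>VF - {u}. {v,w} \<in> EF \<longrightarrow> c v \<noteq> c w}"

definition xcnt :: "nat set \<Rightarrow> nat set set \<Rightarrow> nat \<Rightarrow> (nat \<Rightarrow> nat) \<Rightarrow> nat \<Rightarrow> nat" where
  "xcnt VF EF u c i = card {v \<in> VF - {u}. {u,v} \<notin> EF \<and> c v = i}"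

definition ycnt :: "nat set \<Rightarrow> nat set set \<Rightarrow> nat \<Rightarrow> (nat \<Rightarrow> nat) \<Rightarrow> nat \<Rightarrow> nat" where
  "ycnt VF EF u c i = card {v \<in> VF - {u}. {u,v} \<in> EF \<and> c v = i}"

definition PF :: "nat \<Rightarrow> nat set \<Rightarrow> nat set set \<Rightarrow> (nat \<Rightarrow> real) \<Rightarrow> real" where
  "PF r VF EF \<xi> = (1 / real (aut VF EF)) *
     (\<Sum>u \<in> {u \<in> VF. critical_vertex r VF EF u}. \<Sum>c \<in> proper_colorings r VF EF u.
        \<Prod>i<r. (1 / real r) ^ xcnt VF EF u c i * \<xi> i ^ ycnt VF EF u c i)"

(* total degree of P_F: maximal degree of a monomial in the defining sum
   (all coefficients are positive, so there is no cancellation) *)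
definition total_degree :: "nat \<Rightarrow> nat set \<Rightarrow> nat set set \<Rightarrow> nat" where
  "total_degree r VF EF = Max {\<Sum>i<r. ycnt VF EF u c i | u c.
      critical_vertex r VF EF u \<and> c \<in> proper_colorings r VF EF u}"

definition simplex :: "nat \<Rightarrow> real \<Rightarrow> (nat \<Rightarrow> real) set" where
  "simplex r \<rho> = {\<xi>. (\<forall>i<r. 0 \<le> \<xi> i \<and> \<xi> i \<le> 1 / real r) \<and> (\<forall>i\<ge>r. \<xi> i = 0) \<and>
      (\<Sum>i<r. \<xi> i) = \<rho>}"

definition p_min :: "nat \<Rightarrow> nat set \<Rightarrow> nat set set \<Rightarrow> real \<Rightarrow> real" where
  "p_min r VF EF \<rho> = Inf (PF r VF EF ` simplex r \<rho>)"

(* hat rho_F; Inf of the empty set is \<infinity> *)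
definition rho_hat :: "nat \<Rightarrow> nat set \<Rightarrow> nat set set \<Rightarrow> ereal" where
  "rho_hat r VF EF = (if total_degree r VF EF \<ge> r + 1 then
      Inf (ereal ` {\<rho>. (real r - 1) / real r < \<rho> \<and> \<rho> < 1 \<and>
         p_min r VF EF \<rho> < alpha r VF EF * (\<rho> - (real r - 1) / real r)})
    else \<infinity>)"

definition c2 :: "nat \<Rightarrow> nat set \<Rightarrow> nat set set \<Rightarrow> ereal" where
  "c2 r VF EF = Sup (ereal ` {c::real. \<forall>\<epsilon>>0. \<exists>n0. \<forall>n\<ge>n0. \<forall>q::nat.
      1 \<le> q \<and> real q \<le> c * real n \<longrightarrow>
      (\<forall>E \<in> H_set VF EF n q.
         real (num_copies VF EF {0..<n} E) / (real q * real (c_num r VF EF n)) \<ge> 1 - \<epsilon>)})"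

end

theory Submission
  imports Defs "HOL-Analysis.Analysis"
begin

text \<open>
  Lower bound. A graph \<open>H\<close> with \<open>t\<^sub>r(n) + q\<close> edges and few copies of \<open>F\<close> has few copies of
  \<open>K\<^sub>r\<^sub>+\<^sub>1\<close>, since duplicating a vertex of a complete multipartite pattern at worst squares its
  density. The Moon-Moser inequalities are then almost tight, and for a suitable \<open>r\<close>-clique the
  common neighbourhoods of its \<open>(r-1)\<close>-subsets almost partition \<open>H\<close> into \<open>r\<close> nearly
  independent sets. Take a partition with fewest edges inside the parts (bad edges). Since the
  Turan graph maximises the number of cross pairs, there are at least \<open>q\<close> more bad edges than
  missing cross edges. A bad edge whose ends have few missing edges lies in about
  \<open>\<alpha>\<^sub>F n^(f-2)\<close> copies of \<open>F\<close>. A vertex with linearly many bad edges has, by minimality,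
  linearly many neighbours in every part; if these are \<open>\<xi>\<^sub>i n\<close> in part \<open>i\<close>, the vertex lies in
  about \<open>P\<^sub>F(\<xi>) n^(f-1)\<close> copies while adding at most \<open>(\<Sum>\<xi>\<^sub>i - (r-1)/r) n\<close> to the surplus. So
  each surplus edge costs \<open>\<alpha>\<^sub>F n^(f-2)\<close> copies unless \<open>P\<^sub>F(\<xi>)\<close> drops below
  \<open>\<alpha>\<^sub>F (\<Sum>\<xi>\<^sub>i - (r-1)/r)\<close>, which is what \<open>\<rho>\<close>-hat measures.

  Upper bounds. If \<open>P\<^sub>F(\<xi>) < \<alpha>\<^sub>F (\<rho> - (r-1)/r)\<close>, attach one vertex with \<open>\<xi>\<^sub>i n\<close> neighbours in
  part \<open>i\<close> to a Turan graph. For \<open>q = o(n^2)\<close>, add \<open>q\<close> edges of maximum degree \<open>o(n)\<close> inside one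
  part, so that almost all copies use a single added edge.
\<close>

section \<open>Embeddings, critical vertices and their colourings\<close>

text \<open>The obstacle is that errors must be multiplicative while the surplus may be as small as
  q = 1, so no o(n^2) loss in the edge count is affordable. Stability therefore only supplies the
  partition; afterwards edges are balanced up to pairs inside the tiny set \<open>L\<close> of
  vertices with large bad degree, and each vertex of \<open>L\<close> pays for its own share of the
  error. It can, because minimality of the partition keeps \<open>P_F\<close> at such a vertex above
  a positive constant (\<open>PF_ge\<close>), which absorbs additive o(1) terms. The lower bound is
  stated relative to the Turan graph, before ex(n,F) is known: at q = 1 it yields ex(n,F) = t_r(n)
  (\<open>ex_num_eq\<close>). For that reason its hypothesis is the predicate
  \<open>PF_dominates\<close> at q/n instead of a condition on \<rho>-hat; the predicate is proved
  outright for small arguments and, in general, up to \<rho>-hat - (r-1)/r. Copies are counted as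
  labelled embeddings, \<open>aut\<close> of them per copy: each counted one determines a vertex u
  and a colouring of F - u, so the sums that arise are those defining \<open>P_F\<close> and
  \<alpha>_F.\<close>

lemma colorable_chi:
  assumes "is_graph V E"
  shows "colorable V E (chi V E)"
proof -
  from assms have "finite V" by (simp add: is_graph_def)
  then obtain m where m: "\<forall>v\<in>V. v < m"
    using finite_nat_set_iff_bounded by blast
  have "colorable V E m" unfolding colorable_def
  proof (intro exI[of _ "\<lambda>v. v"] conjI ballI impI)
    fix u v assume "{u,v} \<in> E"
    then obtain a b where "{u,v} = {a,b}" "a \<noteq> b" using assms unfolding is_graph_def by blast
    then show "u \<noteq> v" by (metis doubleton_eq_iff)
  qed (use m in auto)
  then show ?thesis unfolding chi_def by (rule LeastI)
qed

lemma colorable_mono: "colorable V E k \<Longrightarrow> k \<le> l \<Longrightarrow> colorable V E l"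
  unfolding colorable_def by (meson order_less_le_trans)

lemma not_colorable_less_chi: "k < chi V E \<Longrightarrow> \<not> colorable V E k"
  unfolding chi_def using not_less_Least by blast

text \<open>Labelled embeddings rather than copies, since their number is governed by products of
  target-set sizes. The extensional function space gives every embedding one representative, so that
  \<open>card\<close> counts correctly.\<close>

definition emb :: "nat set \<Rightarrow> nat set set \<Rightarrow> nat \<Rightarrow> nat set set \<Rightarrow> (nat \<Rightarrow> nat) set" where
  "emb VF EF n E = {\<phi> \<in> VF \<rightarrow>\<^sub>E {0..<n}. inj_on \<phi> VF \<and> (\<forall>e\<in>EF. \<phi> ` e \<in> E)}"

lemma finite_emb: "finite VF \<Longrightarrow> finite (emb VF EF n E)"
  unfolding emb_def by (simp add: finite_PiE)

text \<open>Composition with the fixed embedding \<open>\<phi>0\<close> turns automorphisms of F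
  into the embeddings with the same image vertices and image edges;
  \<open>inv_into VF \<phi>0\<close> undoes it.\<close>

lemma card_emb_fiber:
  assumes "is_graph VF EF" and \<phi>0: "\<phi>0 \<in> emb VF EF n E"
  shows "card {\<phi> \<in> emb VF EF n E. \<phi> ` VF = \<phi>0 ` VF \<and> (\<lambda>e. \<phi> ` e) ` EF = (\<lambda>e. \<phi>0 ` e) ` EF} = aut VF EF"
proof -
  let ?A = "{\<phi> \<in> VF \<rightarrow>\<^sub>E VF. bij_betw \<phi> VF VF \<and>
      (\<forall>u\<in>VF. \<forall>v\<in>VF. {u,v} \<in> EF \<longleftrightarrow> {\<phi> u, \<phi> v} \<in> EF)}"
  let ?B = "{\<phi> \<in> emb VF EF n E. \<phi> ` VF = \<phi>0 ` VF \<and> (\<lambda>e. \<phi> ` e) ` EF = (\<lambda>e. \<phi>0 ` e) ` EF}"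
  have finV: "finite VF" using assms by (simp add: is_graph_def)
  have sub: "e \<subseteq> VF" if "e \<in> EF" for e using that assms(1) unfolding is_graph_def by blast
  have finE: "finite EF" using sub finV by (meson Pow_iff finite_Pow_iff finite_subset subsetI)
  have edge: "\<exists>u v. e = {u,v} \<and> u \<in> VF \<and> v \<in> VF" if "e \<in> EF" for e
    using that assms(1) unfolding is_graph_def by blast
  have inj0: "inj_on \<phi>0 VF" and P0: "\<phi>0 \<in> VF \<rightarrow>\<^sub>E {0..<n}" and E0: "\<And>e. e \<in> EF \<Longrightarrow> \<phi>0 ` e \<in> E"
    using \<phi>0 by (auto simp: emb_def)
  have mem0: "s \<in> EF" if "s \<subseteq> VF" "\<phi>0 ` s \<in> (\<lambda>e. \<phi>0 ` e) ` EF" for s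
    using that inj0 sub by (metis (no_types, lifting) imageE inj_on_image_eq_iff)
  have "bij_betw (\<lambda>\<psi>. restrict (\<phi>0 \<circ> \<psi>) VF) ?A ?B"
  proof (rule bij_betwI[where g = "\<lambda>\<phi>. restrict (inv_into VF \<phi>0 \<circ> \<phi>) VF"])
    show "(\<lambda>\<psi>. restrict (\<phi>0 \<circ> \<psi>) VF) \<in> ?A \<rightarrow> ?B"
    proof
      fix \<psi> assume "\<psi> \<in> ?A"
      then have P: "\<psi> \<in> VF \<rightarrow>\<^sub>E VF" and b: "bij_betw \<psi> VF VF"
        and ed: "\<And>u v. u \<in> VF \<Longrightarrow> v \<in> VF \<Longrightarrow> {u,v} \<in> EF \<longleftrightarrow> {\<psi> u, \<psi> v} \<in> EF" by auto
      let ?p = "restrict (\<phi>0 \<circ> \<psi>) VF"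
      have im: "?p ` e = \<phi>0 ` (\<psi> ` e)" if "e \<subseteq> VF" for e using that by force
      have psiE: "\<psi> ` e \<in> EF" if "e \<in> EF" for e
        using edge[OF that] ed that by auto
      \<comment> \<open>An automorphism permutes the finite set \<open>EF\<close>, so the image edge
        set stays the same; being mapped into \<open>EF\<close> would only give an
        inclusion.\<close>
      have "inj_on (\<lambda>e. \<psi> ` e) EF"
        by (rule inj_onI) (use inj_on_image_eq_iff[OF bij_betw_imp_inj_on[OF b]] sub in blast)
      then have surjE: "(\<lambda>e. \<psi> ` e) ` EF = EF"
        using endo_inj_surj[OF finE, of "\<lambda>e. \<psi> ` e"] psiE by blast
      have "(\<lambda>e. ?p ` e) ` EF = (\<lambda>e. \<phi>0 ` e) ` ((\<lambda>e. \<psi> ` e) ` EF)"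
        unfolding image_image using im sub by (intro image_cong) auto
      then have 1: "(\<lambda>e. ?p ` e) ` EF = (\<lambda>e. \<phi>0 ` e) ` EF" using surjE by simp
      have 2: "?p ` VF = \<phi>0 ` VF" using im[of VF] b by (simp add: bij_betw_def)
      have 3: "inj_on ?p VF" using b inj0
        by (metis bij_betw_def comp_inj_on inj_on_restrict_eq)
      have 4: "?p \<in> VF \<rightarrow>\<^sub>E {0..<n}" using P P0 by fastforce
      have 5: "?p ` e \<in> E" if "e \<in> EF" for e using im[OF sub[OF that]] psiE[OF that] E0 by simp
      show "?p \<in> ?B" unfolding emb_def mem_Collect_eq by (intro conjI ballI 1 2 3 4 5)
    qed
    show "(\<lambda>\<phi>. restrict (inv_into VF \<phi>0 \<circ> \<phi>) VF) \<in> ?B \<rightarrow> ?A"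
    proof
      fix \<phi> assume "\<phi> \<in> ?B"
      then have inj: "inj_on \<phi> VF" and im: "\<phi> ` VF = \<phi>0 ` VF"
        and ie: "(\<lambda>e. \<phi> ` e) ` EF = (\<lambda>e. \<phi>0 ` e) ` EF" by (auto simp: emb_def)
      let ?p = "restrict (inv_into VF \<phi>0 \<circ> \<phi>) VF"
      have inv: "\<phi>0 (?p v) = \<phi> v" "?p v \<in> VF" if "v \<in> VF" for v
        using that im by (simp add: f_inv_into_f flip: im) (metis comp_apply im imageI inv_into_into restrict_apply' that)
      have injp: "inj_on ?p VF" 
      proof (rule inj_onI)
        fix a b assume "a \<in> VF" "b \<in> VF" "?p a = ?p b"
        then have "\<phi> a = \<phi> b" using inv(1)[of a] inv(1)[of b] by argo
        then show "a = b" using inj \<open>a \<in> VF\<close> \<open>b \<in> VF\<close> by (meson inj_onD)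
      qed
      have bij: "bij_betw ?p VF VF"
        unfolding bij_betw_def using injp inv(2) finV
        by (intro conjI injp endo_inj_surj) auto
      have "{u,v} \<in> EF \<longleftrightarrow> {?p u, ?p v} \<in> EF" if "u \<in> VF" "v \<in> VF" for u v
      proof -
        have e: "\<phi>0 ` {?p u, ?p v} = \<phi> ` {u,v}" using inv that by simp
        show ?thesis
        proof
          assume "{u,v} \<in> EF"
          then have "\<phi>0 ` {?p u, ?p v} \<in> (\<lambda>e. \<phi>0 ` e) ` EF" unfolding e ie[symmetric] by blast
          then show "{?p u, ?p v} \<in> EF" using mem0[of "{?p u, ?p v}"] inv that by simp
        next
          assume "{?p u, ?p v} \<in> EF"
          then have "\<phi> ` {u,v} \<in> (\<lambda>e. \<phi> ` e) ` EF" unfolding e[symmetric] ie by blast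
          then obtain e' where "e' \<in> EF" "\<phi> ` {u,v} = \<phi> ` e'" by blast
          moreover have "{u,v} = e'"
            using inj_on_image_eq_iff[OF inj, of "{u,v}" e'] calculation sub that by auto
          ultimately show "{u,v} \<in> EF" by simp
        qed
      qed
      then show "?p \<in> ?A" using bij inv(2) by auto
    qed
    show "restrict (inv_into VF \<phi>0 \<circ> restrict (\<phi>0 \<circ> \<psi>) VF) VF = \<psi>" if "\<psi> \<in> ?A" for \<psi>
    proof
      fix x
      have P: "\<psi> \<in> VF \<rightarrow>\<^sub>E VF" using that by blast
      show "restrict (inv_into VF \<phi>0 \<circ> restrict (\<phi>0 \<circ> \<psi>) VF) VF x = \<psi> x"
        using PiE_mem[OF P] PiE_arb[OF P] inv_into_f_f[OF inj0] by (cases "x \<in> VF") simp_all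
    qed
    show "restrict (\<phi>0 \<circ> restrict (inv_into VF \<phi>0 \<circ> \<phi>) VF) VF = \<phi>" if "\<phi> \<in> ?B" for \<phi>
    proof
      fix x
      have im: "\<phi> ` VF = \<phi>0 ` VF" and P: "\<phi> \<in> VF \<rightarrow>\<^sub>E {0..<n}" using that by (simp_all only: emb_def mem_Collect_eq)
      have "\<phi> x \<in> \<phi>0 ` VF" if "x \<in> VF" using that im by blast
      then show "restrict (\<phi>0 \<circ> restrict (inv_into VF \<phi>0 \<circ> \<phi>) VF) VF x = \<phi> x"
        using PiE_arb[OF P] by (cases "x \<in> VF") (simp_all add: f_inv_into_f)
    qed
  qed
  then show ?thesis unfolding aut_def by (rule bij_betw_same_card[symmetric])
qed

lemma card_emb:
  assumes g: "is_graph VF EF"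
  shows "card (emb VF EF n E) = aut VF EF * num_copies VF EF {0..<n} E"
proof -
  let ?g = "\<lambda>\<phi>. (\<phi> ` VF, (\<lambda>e. \<phi> ` e) ` EF)"
  have finV: "finite VF" using g by (simp add: is_graph_def)
  have sub: "e \<subseteq> VF" if "e \<in> EF" for e using that g unfolding is_graph_def by blast
  have im: "?g ` emb VF EF n E = copies VF EF {0..<n} E"
  proof
    show "?g ` emb VF EF n E \<subseteq> copies VF EF {0..<n} E"
    proof
      fix y assume "y \<in> ?g ` emb VF EF n E"
      then obtain \<phi> where y: "y = ?g \<phi>" and p: "\<phi> \<in> VF \<rightarrow>\<^sub>E {0..<n}" "inj_on \<phi> VF" "\<forall>e\<in>EF. \<phi> ` e \<in> E"
        by (auto simp: emb_def)
      have "\<phi> ` VF \<subseteq> {0..<n}" using PiE_mem[OF p(1)] by blast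
      moreover have "(\<lambda>e. \<phi> ` e) ` EF \<subseteq> E" using p(3) by blast
      moreover have "bij_betw \<phi> VF (\<phi> ` VF)" using p(2) by (simp add: bij_betw_def)
      ultimately show "y \<in> copies VF EF {0..<n} E" unfolding copies_def y by blast
    qed
    show "copies VF EF {0..<n} E \<subseteq> ?g ` emb VF EF n E"
    proof
      fix y assume "y \<in> copies VF EF {0..<n} E"
      then obtain \<phi> where y: "snd y = (\<lambda>e. \<phi> ` e) ` EF" "fst y \<subseteq> {0..<n}" "snd y \<subseteq> E" "bij_betw \<phi> VF (fst y)"
        unfolding copies_def by auto
      have ims: "restrict \<phi> VF ` e = \<phi> ` e" if "e \<subseteq> VF" for e using that by force
      have "(\<lambda>e. restrict \<phi> VF ` e) ` EF = (\<lambda>e. \<phi> ` e) ` EF"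
        using ims sub by (intro image_cong) auto
      then have A: "?g (restrict \<phi> VF) = y" using y ims[of VF]
        by (simp add: bij_betw_def prod_eq_iff)
      have B: "restrict \<phi> VF \<in> emb VF EF n E"
        using y(1-3) ims sub y(4) unfolding emb_def bij_betw_def
        by (auto simp add: inj_on_restrict_eq image_subset_iff)
      show "y \<in> ?g ` emb VF EF n E" using imageI[OF B, of ?g] unfolding A .
    qed
  qed
  have fin: "finite (emb VF EF n E)" by (rule finite_emb[OF finV])
  have "card (emb VF EF n E) = (\<Sum>y\<in>copies VF EF {0..<n} E. card {\<phi> \<in> emb VF EF n E. ?g \<phi> = y})"
    using sum.image_gen[OF fin, of "\<lambda>_. 1::nat" ?g] im by simp
  also have "\<dots> = (\<Sum>y\<in>copies VF EF {0..<n} E. aut VF EF)"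
  proof (rule sum.cong[OF refl])
    fix y assume "y \<in> copies VF EF {0..<n} E"
    then obtain \<phi>0 where "\<phi>0 \<in> emb VF EF n E" "y = ?g \<phi>0" using im by blast
    then show "card {\<phi> \<in> emb VF EF n E. ?g \<phi> = y} = aut VF EF"
      using card_emb_fiber[OF g, of \<phi>0 n E] by simp
  qed
  finally show ?thesis by (simp add: num_copies_def)
qed

section \<open>Critical vertices and the index sets behind \<open>P_F\<close> and \<alpha>_F\<close>

locale critical =
  fixes r :: nat and VF :: "nat set" and EF :: "nat set set"
  assumes r2: "r \<ge> 2" and crit: "critical_graph r VF EF"
begin

abbreviation "f \<equiv> card VF"

lemma graph: "is_graph VF EF" using crit by (simp add: critical_graph_def)

lemma finV: "finite VF" using graph by (simp add: is_graph_def)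

lemma edge_sub: "e \<in> EF \<Longrightarrow> e \<subseteq> VF" using graph unfolding is_graph_def by blast

lemma finE: "finite EF" using edge_sub finV by (meson Pow_iff finite_Pow_iff finite_subset subsetI)

lemma edge_cases:
  assumes "e \<in> EF" obtains u v where "e = {u,v}" "u \<in> VF" "v \<in> VF" "u \<noteq> v"
  using assms graph unfolding is_graph_def by blast

lemma edge_neq: "{u,v} \<in> EF \<Longrightarrow> u \<noteq> v"
  by (metis edge_cases doubleton_eq_iff)

lemma edge_mem: "{u,v} \<in> EF \<Longrightarrow> u \<in> VF \<and> v \<in> VF"
  using edge_sub by blast

lemma not_colorable_r: "\<not> colorable VF EF r"
  using crit not_colorable_less_chi[of r VF EF] by (simp add: critical_graph_def)

lemma mono_edge_exists:
  assumes "\<And>v. v \<in> VF \<Longrightarrow> c v < r"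
  obtains u v where "{u,v} \<in> EF" "c u = c v"
  using not_colorable_r assms unfolding colorable_def by metis

lemma colorable_Suc_r: "colorable VF EF (r + 1)"
  using colorable_chi[OF graph] crit by (simp add: critical_graph_def)

text \<open>Deleting a vertex lowers the chromatic number by at most one: an (r-1)-colouring of F -
  u extends to an r-colouring of F by giving u the new colour. Hence r-colourability of F - u
  already means criticality, and the outer sum of \<open>P_F\<close> may run over all
  vertices.\<close>

lemma critical_iff:
  assumes "u \<in> VF"
  shows "critical_vertex r VF EF u \<longleftrightarrow> proper_colorings r VF EF u \<noteq> {}"
proof
  let ?W = "VF - {u}" and ?D = "{e \<in> EF. u \<notin> e}"
  have gr: "is_graph ?W ?D" unfolding is_graph_def
  proof
    show "finite ?W" using finV by simp
    show "?D \<subseteq> {{u,v} |u v. u \<in> ?W \<and> v \<in> ?W \<and> u \<noteq> v}"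
    proof
      fix e assume e: "e \<in> ?D"
      then obtain a b where "e = {a,b}" "a \<in> VF" "b \<in> VF" "a \<noteq> b" using edge_cases by blast
      then show "e \<in> {{u,v} |u v. u \<in> ?W \<and> v \<in> ?W \<and> u \<noteq> v}" using e by auto
    qed
  qed
  {
    assume "critical_vertex r VF EF u"
    then have "colorable ?W ?D r" using colorable_chi[OF gr] by (simp add: critical_vertex_def)
    then obtain c where c: "\<forall>v\<in>?W. c v < r" "\<forall>a\<in>?W. \<forall>b\<in>?W. {a,b} \<in> ?D \<longrightarrow> c a \<noteq> c b"
      unfolding colorable_def by blast
    then have "restrict c ?W \<in> proper_colorings r VF EF u"
      unfolding proper_colorings_def by auto
    then show "proper_colorings r VF EF u \<noteq> {}" by blast
  }
  assume "proper_colorings r VF EF u \<noteq> {}"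
  then obtain c where c: "c \<in> ?W \<rightarrow>\<^sub>E {0..<r}" "\<forall>v\<in>?W. \<forall>w\<in>?W. {v,w} \<in> EF \<longrightarrow> c v \<noteq> c w"
    unfolding proper_colorings_def by blast
  have "colorable ?W ?D r" unfolding colorable_def using c(2) PiE_mem[OF c(1)] by (intro exI[of _ c]) auto
  then have le: "chi ?W ?D \<le> r" unfolding chi_def by (rule Least_le)
  moreover have "\<not> chi ?W ?D < r"
  proof
    assume "chi ?W ?D < r"
    then have "colorable ?W ?D (r - 1)" using colorable_mono[OF colorable_chi[OF gr]] by simp
    then obtain d where d: "\<forall>v\<in>?W. d v < r - 1" "\<forall>a\<in>?W. \<forall>b\<in>?W. {a,b} \<in> ?D \<longrightarrow> d a \<noteq> d b"
      unfolding colorable_def by blast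
    have lt: "\<And>v. v \<in> VF \<Longrightarrow> (d(u := r - 1)) v < r"
    proof -
      fix v assume "v \<in> VF"
      then show "(d(u := r - 1)) v < r" using d(1)[rule_format, of v] r2 by (cases "v = u") auto
    qed
    obtain a b where ab: "{a,b} \<in> EF" "(d(u := r - 1)) a = (d(u := r - 1)) b"
      using mono_edge_exists[of "d(u := r - 1)"] lt by blast
    have m: "a \<in> VF" "b \<in> VF" "a \<noteq> b" using edge_neq[OF ab(1)] edge_mem[OF ab(1)] by auto
    consider "a = u" | "b = u" | "a \<noteq> u" "b \<noteq> u" by blast
    then show False
    proof cases
      case 1 then show False using d(1)[rule_format, of b] m ab(2) by simp
    next
      case 2 then show False using d(1)[rule_format, of a] m ab(2) by simp
    next
      case 3 then show False using d(2)[rule_format, of a b] m ab by simp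
    qed
  qed
  ultimately show "critical_vertex r VF EF u" using assms by (simp add: critical_vertex_def)
qed

text \<open>The index set of the double sum in \<open>P_F\<close>; vertices that are not critical
  have no colourings and drop out by themselves.\<close>

definition KC where "KC = Sigma VF (proper_colorings r VF EF)"

lemma proper_coloringsD:
  assumes "c \<in> proper_colorings r VF EF u"
  shows "c \<in> (VF - {u}) \<rightarrow>\<^sub>E {0..<r}"
    and "v \<in> VF - {u} \<Longrightarrow> w \<in> VF - {u} \<Longrightarrow> {v,w} \<in> EF \<Longrightarrow> c v \<noteq> c w"
    and "v \<in> VF - {u} \<Longrightarrow> c v < r"
  using assms PiE_mem[of c "VF - {u}" "\<lambda>_. {0..<r}" v] by (auto simp: proper_colorings_def)

lemma finite_proper_colorings: "finite (proper_colorings r VF EF u)"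
  unfolding proper_colorings_def using finV by (intro finite_subset[OF _ finite_PiE[of "VF - {u}" "\<lambda>_. {0..<r}"]]) auto

lemma finite_KC: "finite KC"
  unfolding KC_def using finV finite_proper_colorings by blast

text \<open>Otherwise u could take colour i and F would be r-colourable. Thus every \<xi>_i divides
  every monomial of \<open>P_F\<close>.\<close>

lemma KC_neighbour:
  assumes "(u,c) \<in> KC" "i < r"
  obtains w where "w \<in> VF - {u}" "{u,w} \<in> EF" "c w = i"
proof -
  have c: "c \<in> proper_colorings r VF EF u" using assms by (simp add: KC_def)
  have lt: "(c(u := i)) v < r" if "v \<in> VF" for v using proper_coloringsD(3)[OF c, of v] that assms by simp
  obtain a b where ab: "{a,b} \<in> EF" "(c(u := i)) a = (c(u := i)) b"
    using mono_edge_exists[of "c(u := i)"] lt by blast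
  have "a \<in> VF" "b \<in> VF" "a \<noteq> b" using edge_mem edge_neq ab by auto
  then show ?thesis using that[of a] that[of b] ab proper_coloringsD(2)[OF c, of a b]
    by (cases "a = u"; cases "b = u") (auto simp: insert_commute)
qed

text \<open>Indexed by vertices instead of colours, so that it matches cardinalities of
  \<open>PiE\<close> products factor by factor.\<close>

definition monomial :: "nat \<Rightarrow> (nat \<Rightarrow> nat) \<Rightarrow> (nat \<Rightarrow> real) \<Rightarrow> real" where
  "monomial u c \<xi> = (\<Prod>w\<in>VF - {u}. if {u,w} \<in> EF then \<xi> (c w) else 1 / real r)"

lemma monomial_eq:
  assumes "(u,c) \<in> KC"
  shows "monomial u c \<xi> = (\<Prod>i<r. (1 / real r) ^ xcnt VF EF u c i * \<xi> i ^ ycnt VF EF u c i)"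
proof -
  let ?h = "\<lambda>w. if {u,w} \<in> EF then \<xi> (c w) else 1 / real r"
  have c: "c ` (VF - {u}) \<subseteq> {..<r}" using assms proper_coloringsD(3) by (auto simp: KC_def)
  have "monomial u c \<xi> = (\<Prod>i<r. \<Prod>w\<in>{w \<in> VF - {u}. c w = i}. ?h w)"
    unfolding monomial_def using prod.group[OF _ _ c, of ?h] finV by simp
  also have "\<dots> = (\<Prod>i<r. (1 / real r) ^ xcnt VF EF u c i * \<xi> i ^ ycnt VF EF u c i)"
  proof (rule prod.cong[OF refl])
    fix i
    let ?X = "{v \<in> VF - {u}. {u,v} \<notin> EF \<and> c v = i}" and ?Y = "{v \<in> VF - {u}. {u,v} \<in> EF \<and> c v = i}"
    have "{w \<in> VF - {u}. c w = i} = ?X \<union> ?Y" by auto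
    then have "(\<Prod>w\<in>{w \<in> VF - {u}. c w = i}. ?h w) = (\<Prod>w\<in>?X. ?h w) * (\<Prod>w\<in>?Y. ?h w)"
      using finV by (simp add: prod.union_disjoint disjoint_iff)
    also have "(\<Prod>w\<in>?X. ?h w) = (1 / real r) ^ xcnt VF EF u c i" by (simp add: xcnt_def)
    also have "(\<Prod>w\<in>?Y. ?h w) = \<xi> i ^ ycnt VF EF u c i" by (simp add: ycnt_def)
    finally show "(\<Prod>w\<in>{w \<in> VF - {u}. c w = i}. ?h w) = (1 / real r) ^ xcnt VF EF u c i * \<xi> i ^ ycnt VF EF u c i" .
  qed
  finally show ?thesis .
qed

lemma PF_eq: "PF r VF EF \<xi> = (1 / real (aut VF EF)) * (\<Sum>(u,c)\<in>KC. monomial u c \<xi>)"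
proof -
  let ?C = "{u \<in> VF. critical_vertex r VF EF u}"
  have fp: "\<forall>u\<in>S. finite (proper_colorings r VF EF u)" for S
    using finite_proper_colorings by blast
  have KC: "KC = Sigma ?C (proper_colorings r VF EF)"
    unfolding KC_def using critical_iff by blast
  have "(\<Sum>(u,c)\<in>KC. monomial u c \<xi>) = (\<Sum>u\<in>?C. \<Sum>c\<in>proper_colorings r VF EF u. monomial u c \<xi>)"
    unfolding KC using fp finV by (subst sum.Sigma) auto
  also have "\<dots> = (\<Sum>u\<in>?C. \<Sum>c\<in>proper_colorings r VF EF u.
      \<Prod>i<r. (1 / real r) ^ xcnt VF EF u c i * \<xi> i ^ ycnt VF EF u c i)"
    by (intro sum.cong refl monomial_eq) (auto simp: KC_def)
  finally show ?thesis by (simp add: PF_def)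
qed

lemma aut_pos: "aut VF EF > 0"
proof -
  let ?A = "{\<phi> \<in> VF \<rightarrow>\<^sub>E VF. bij_betw \<phi> VF VF \<and>
      (\<forall>u\<in>VF. \<forall>v\<in>VF. {u,v} \<in> EF \<longleftrightarrow> {\<phi> u, \<phi> v} \<in> EF)}"
  have "restrict id VF \<in> ?A" by (auto simp: bij_betw_def inj_on_def)
  moreover have "finite ?A" using finV by (simp add: finite_PiE)
  ultimately show ?thesis unfolding aut_def using card_gt_0_iff by blast
qed

text \<open>Pairs for which \<open>u\<close> and its only neighbour of colour \<open>i\<close> form the edge of \<open>F\<close> that is
  mapped to an edge added inside part \<open>i\<close>.\<close>

definition K :: "nat \<Rightarrow> (nat \<times> (nat \<Rightarrow> nat)) set" where
  "K i = {(u,c) \<in> KC. ycnt VF EF u c i = 1}"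

definition partner :: "nat \<Rightarrow> nat \<Rightarrow> (nat \<Rightarrow> nat) \<Rightarrow> nat" where
  "partner i u c = (THE v. v \<in> VF - {u} \<and> {u,v} \<in> EF \<and> c v = i)"

lemma K_unique:
  assumes "(u,c) \<in> K i"
  obtains v where "{v \<in> VF - {u}. {u,v} \<in> EF \<and> c v = i} = {v}" "partner i u c = v"
proof -
  have "card {v \<in> VF - {u}. {u,v} \<in> EF \<and> c v = i} = 1" using assms by (auto simp: K_def ycnt_def)
  then obtain v where v: "{v \<in> VF - {u}. {u,v} \<in> EF \<and> c v = i} = {v}" using card_1_singletonE by blast
  have "partner i u c = v" unfolding partner_def using v by (intro the_equality) blast+
  with v that show ?thesis by blast
qed

lemma K_partner:
  assumes "(u,c) \<in> K i"
  shows "u \<in> VF" "c \<in> proper_colorings r VF EF u"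
    "partner i u c \<in> VF - {u}" "{u, partner i u c} \<in> EF" "c (partner i u c) = i"
    "w \<in> VF - {u} \<Longrightarrow> {u,w} \<in> EF \<Longrightarrow> c w = i \<Longrightarrow> w = partner i u c"
proof -
  obtain v where v: "{v \<in> VF - {u}. {u,v} \<in> EF \<and> c v = i} = {v}" "partner i u c = v"
    using K_unique[OF assms] by blast
  show "u \<in> VF" "c \<in> proper_colorings r VF EF u" using assms by (auto simp: K_def KC_def)
  show "partner i u c \<in> VF - {u}" "{u, partner i u c} \<in> EF" "c (partner i u c) = i"
    "w \<in> VF - {u} \<Longrightarrow> {u,w} \<in> EF \<Longrightarrow> c w = i \<Longrightarrow> w = partner i u c"
    using v by blast+
qed

lemma finite_K: "finite (K i)"
  using finite_KC by (rule finite_subset[rotated]) (auto simp: K_def)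

text \<open>Exchanging the colours i and j is an involution on colourings and carries
  \<open>K i\<close> into \<open>K j\<close>. So the number of ways to use an added edge is the same
  for all parts.\<close>

lemma card_K_le:
  assumes "i < r" "j < r"
  shows "card (K i) \<le> card (K j)"
proof -
  define t where "t = (\<lambda>x. if x = i then j else if x = j then i else x)"
  have tt: "t (t x) = x" for x by (auto simp: t_def)
  have tr: "t x < r \<longleftrightarrow> x < r" for x using assms by (auto simp: t_def)
  have tinj: "t x = t y \<longleftrightarrow> x = y" for x y using tt by metis
  let ?g = "\<lambda>(u, c). (u, restrict (t \<circ> c) (VF - {u}))"
  show ?thesis
  proof (rule card_inj_on_le[where f = ?g])
    show "inj_on ?g (K i)"
    proof (rule inj_onI)
      fix p q assume pq: "p \<in> K i" "q \<in> K i" "?g p = ?g q"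
      obtain u c where p: "p = (u,c)" by fastforce
      obtain u' c' where q: "q = (u',c')" by fastforce
      have u: "u' = u" using pq p q by simp
      have c: "c \<in> (VF - {u}) \<rightarrow>\<^sub>E {0..<r}" "c' \<in> (VF - {u}) \<rightarrow>\<^sub>E {0..<r}"
        using pq p q u K_partner(2) proper_coloringsD(1) by blast+
      have "restrict (t \<circ> c) (VF - {u}) = restrict (t \<circ> c') (VF - {u})" using pq p q u by simp
      then have "c w = c' w" if "w \<in> VF - {u}" for w
        using that tinj by (metis comp_apply restrict_apply')
      then have "c = c'" using c by (meson PiE_ext)
      then show "p = q" using p q u by simp
    qed
    show "?g ` K i \<subseteq> K j"
    proof
      fix q assume "q \<in> ?g ` K i"
      then obtain u c where uc: "(u,c) \<in> K i" and q: "q = (u, restrict (t \<circ> c) (VF - {u}))" by auto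
      note c = K_partner(2)[OF uc]
      have 1: "restrict (t \<circ> c) (VF - {u}) \<in> proper_colorings r VF EF u"
        using proper_coloringsD[OF c] tr tinj unfolding proper_colorings_def by auto
      have "t x = j \<longleftrightarrow> x = i" for x by (auto simp: t_def)
      then have "ycnt VF EF u (restrict (t \<circ> c) (VF - {u})) j = ycnt VF EF u c i"
        unfolding ycnt_def by (intro arg_cong[where f = card]) auto
      then show "q \<in> K j" using 1 uc q by (auto simp: K_def KC_def)
    qed
  qed (rule finite_K)
qed

definition N :: nat where "N = card (K 0)"

lemma card_K: "i < r \<Longrightarrow> card (K i) = N"
  unfolding N_def using card_K_le[of 0 i] card_K_le[of i 0] r2 by simp

text \<open>In an r-colouring of F minus its critical edge the ends of that edge must share a
  colour, or F itself would be r-colourable. Restricted to F - u, for one end u, the colouring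
  leaves the other end as the only neighbour of u in that colour.\<close>

lemma N_pos: "N > 0"
proof -
  obtain e where e: "e \<in> EF" "chi VF (EF - {e}) = r" using crit by (auto simp: critical_graph_def)
  obtain u v where uv: "e = {u,v}" "u \<in> VF" "v \<in> VF" "u \<noteq> v" using edge_cases[OF e(1)] by blast
  have "is_graph VF (EF - {e})" using graph unfolding is_graph_def by blast
  then have "colorable VF (EF - {e}) r" using colorable_chi e(2) by metis
  then obtain c where c: "\<forall>v\<in>VF. c v < r" "\<forall>a\<in>VF. \<forall>b\<in>VF. {a,b} \<in> EF - {e} \<longrightarrow> c a \<noteq> c b"
    unfolding colorable_def by (elim exE conjE) (rule that)
  obtain a b where ab: "{a,b} \<in> EF" "c a = c b" using mono_edge_exists[of c] c(1) by blast
  then have "{a,b} = e" using c edge_mem by blast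
  then have cuv: "c u = c v" using uv ab by (metis doubleton_eq_iff)
  let ?c = "restrict c (VF - {u})"
  have 1: "?c \<in> proper_colorings r VF EF u" unfolding proper_colorings_def
    using c uv by (auto simp: doubleton_eq_iff)
  have "{w \<in> VF - {u}. {u,w} \<in> EF \<and> ?c w = c u} = {v}"
  proof -
    have "w = v" if "w \<in> VF - {u}" "{u,w} \<in> EF" "c w = c u" for w
      using c(2)[rule_format, of u w] that uv by (auto simp: doubleton_eq_iff)
    then show ?thesis using uv e(1) cuv by auto
  qed
  then have "(u, ?c) \<in> K (c u)" using 1 uv by (simp add: K_def KC_def ycnt_def)
  then have "card (K (c u)) > 0" using finite_K card_gt_0_iff by blast
  then show ?thesis using card_K[of "c u"] c uv by simp
qed

text \<open>The value of \<open>\<alpha>\<^sub>F\<close>, see \<open>alpha_eq\<close>.\<close>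

definition a0 :: real where "a0 = real N * (1 / real r) ^ (f - 2) / real (aut VF EF)"

lemma a0_pos: "a0 > 0"
  unfolding a0_def using N_pos aut_pos r2 by simp

lemma f_ge3: "f \<ge> 3"
proof -
  have "K 0 \<noteq> {}" using N_pos unfolding N_def by force
  then obtain u c where "(u,c) \<in> K 0" by force
  then have uc: "(u,c) \<in> KC" by (simp add: K_def)
  obtain w where w: "w \<in> VF - {u}" "c w = 0" by (rule KC_neighbour[OF uc, of 0]) (use r2 in auto)
  obtain z where z: "z \<in> VF - {u}" "c z = 1" by (rule KC_neighbour[OF uc, of 1]) (use r2 in auto)
  have "w \<noteq> z" using w z by auto
  then have "{u,w,z} \<subseteq> VF" "card {u,w,z} = 3" using w z uc by (auto simp: KC_def)
  then show ?thesis using finV card_mono by metis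
qed

end

section \<open>Counting embeddings into a partitioned graph\<close>

lemma card_PiE_pair_le:
  assumes W: "finite W" "v \<in> W" "w \<in> W" "v \<noteq> w" and X: "finite X" and A: "\<And>a. a \<in> W \<Longrightarrow> A a \<subseteq> X"
    and R: "finite R"
  shows "card {\<phi> \<in> PiE W A. (\<phi> v, \<phi> w) \<in> R} \<le> card R * card X ^ (card W - 2)"
proof -
  let ?S = "{\<phi> \<in> PiE W A. (\<phi> v, \<phi> w) \<in> R}"
  let ?g = "\<lambda>\<phi>. ((\<phi> v, \<phi> w), restrict \<phi> (W - {v,w}))"
  have "card ?S \<le> card (R \<times> (PiE (W - {v,w}) (\<lambda>_. X)))"
  proof (rule card_inj_on_le[where f = ?g])
    show "inj_on ?g ?S"
    proof (rule inj_onI)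
      fix a b assume ab: "a \<in> ?S" "b \<in> ?S" "?g a = ?g b"
      show "a = b"
      proof (rule PiE_ext[of a W A b])
        show "a \<in> PiE W A" "b \<in> PiE W A" using ab by auto
        fix z assume z: "z \<in> W"
        show "a z = b z"
        proof (cases "z = v \<or> z = w")
          case True then show ?thesis using ab(3) by auto
        next
          case False
          have "restrict a (W - {v,w}) z = restrict b (W - {v,w}) z" using ab(3) by simp
          then show ?thesis using False z by simp
        qed
      qed
    qed
    show "?g ` ?S \<subseteq> R \<times> (PiE (W - {v,w}) (\<lambda>_. X))"
    proof (rule image_subsetI)
      fix \<phi> assume p: "\<phi> \<in> ?S"
      then have "\<phi> z \<in> X" if "z \<in> W" for z using A[OF that] PiE_mem[of \<phi> W A z] that by blast
      then show "?g \<phi> \<in> R \<times> (PiE (W - {v,w}) (\<lambda>_. X))" using p by auto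
    qed
    show "finite (R \<times> (PiE (W - {v,w}) (\<lambda>_. X)))" using R X W by (intro finite_cartesian_product finite_PiE) auto
  qed
  also have "\<dots> = card R * card X ^ (card W - 2)"
    using W by (simp add: card_cartesian_product card_PiE card_Diff_subset numeral_2_eq_2)
  finally show ?thesis .
qed

text \<open>Union bound over ordered pairs of distinct coordinates: prescribing a pair in
  \<open>R\<close> at two coordinates leaves at most |X| choices at each other one, so a pair costs
  at most \<mu> |X|^|W| maps. This serves as the embedding lemma; in use, \<open>R\<close> holds
  coincidences and missing cross pairs.\<close>

lemma PiE_avoid:
  assumes W: "finite W" and X: "finite X" and A: "\<And>a. a \<in> W \<Longrightarrow> A a \<subseteq> X"
    and R: "finite R" "real (card R) \<le> \<mu> * real (card X) ^ 2" and mu0: "\<mu> \<ge> 0"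
  shows "real (card {\<phi> \<in> PiE W A. \<forall>v\<in>W. \<forall>w\<in>W. v \<noteq> w \<longrightarrow> (\<phi> v, \<phi> w) \<notin> R})
     \<ge> (\<Prod>a\<in>W. real (card (A a))) - real (card W) ^ 2 * \<mu> * real (card X) ^ card W"
proof -
  let ?G = "{\<phi> \<in> PiE W A. \<forall>v\<in>W. \<forall>w\<in>W. v \<noteq> w \<longrightarrow> (\<phi> v, \<phi> w) \<notin> R}"
  let ?P = "{(v,w) \<in> W \<times> W. v \<noteq> w}"
  let ?B = "\<lambda>(v,w). {\<phi> \<in> PiE W A. (\<phi> v, \<phi> w) \<in> R}"
  have finP: "finite ?P" using W by (rule_tac finite_subset[of _ "W \<times> W"]) auto
  have finA: "finite (PiE W A)" using W A X by (intro finite_PiE) (auto intro: finite_subset)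
  have cov: "PiE W A \<subseteq> ?G \<union> (\<Union>p\<in>?P. ?B p)" by auto
  have finU: "finite (?G \<union> (\<Union>p\<in>?P. ?B p))" by (rule finite_subset[OF _ finA]) auto
  have each: "real (card (?B p)) \<le> \<mu> * real (card X) ^ card W" if "p \<in> ?P" for p
  proof -
    obtain v w where p: "p = (v,w)" "v \<in> W" "w \<in> W" "v \<noteq> w" using \<open>p \<in> ?P\<close> by auto
    have "card {v,w} \<le> card W" using p W by (intro card_mono) auto
    then have c2: "card W = (card W - 2) + 2" using p by simp
    have "real (card (?B p)) \<le> real (card R) * real (card X) ^ (card W - 2)"
      using card_PiE_pair_le[OF W p(2-4) X A R(1)] p(1) by (simp flip: of_nat_mult of_nat_power)
    also have "\<dots> \<le> \<mu> * real (card X) ^ 2 * real (card X) ^ (card W - 2)"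
      using R(2) by (intro mult_right_mono) auto
    also have "\<dots> = \<mu> * real (card X) ^ card W"
      by (subst (2) c2) (simp only: power_add mult_ac)
    finally show ?thesis .
  qed
  have mu: "0 \<le> \<mu> * real (card X) ^ card W" using mu0 by simp
  have "card ?P \<le> card (W \<times> W)" using W by (intro card_mono) auto
  then have cP: "real (card ?P) \<le> real (card W) ^ 2"
    by (simp add: card_cartesian_product power2_eq_square flip: of_nat_mult)
  have "card (PiE W A) \<le> card ?G + card (\<Union>p\<in>?P. ?B p)"
    using card_mono[OF finU cov] card_Un_le[of ?G "\<Union>p\<in>?P. ?B p"] by linarith
  also have "card (\<Union>p\<in>?P. ?B p) \<le> (\<Sum>p\<in>?P. card (?B p))"
    by (rule card_UN_le[OF finP])
  finally have "real (card (PiE W A)) \<le> real (card ?G) + (\<Sum>p\<in>?P. real (card (?B p)))"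
    unfolding of_nat_sum[symmetric] of_nat_add[symmetric] of_nat_le_iff by simp
  also have "(\<Sum>p\<in>?P. real (card (?B p))) \<le> (\<Sum>p\<in>?P. \<mu> * real (card X) ^ card W)"
    by (intro sum_mono each)
  also have "\<dots> = real (card ?P) * (\<mu> * real (card X) ^ card W)" by simp
  also have "\<dots> \<le> real (card W) ^ 2 * (\<mu> * real (card X) ^ card W)"
    using cP mu by (intro mult_right_mono)
  finally have "real (card (PiE W A)) \<le> real (card ?G) + real (card W) ^ 2 * (\<mu> * real (card X) ^ card W)"
    by simp
  then show ?thesis using W by (simp add: card_PiE algebra_simps)
qed

context critical
begin

text \<open>The diagonal is included so that avoiding a single relation yields injectivity together
  with all cross edges.\<close>

definition Rbad :: "nat \<Rightarrow> nat set set \<Rightarrow> (nat \<Rightarrow> nat) \<Rightarrow> (nat \<times> nat) set" where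
  "Rbad n E \<pi> = {(a,b). a < n \<and> b < n \<and> (a = b \<or> \<pi> a \<noteq> \<pi> b \<and> {a,b} \<notin> E)}"

text \<open>In use, \<open>L\<close> is the small set of vertices with large bad degree. Demanding
  that x be the only vertex of \<open>L\<close> in the image makes these families disjoint for
  distinct x.\<close>

definition Phi :: "nat \<Rightarrow> nat set set \<Rightarrow> nat set \<Rightarrow> nat \<Rightarrow> (nat \<Rightarrow> nat) set" where
  "Phi n E L x = {\<phi> \<in> emb VF EF n E. \<phi> ` VF \<inter> L = {x}}"

text \<open>With e as the only image edge inside a part, the families are disjoint for distinct e;
  avoiding \<open>L\<close> makes them disjoint from every \<open>Phi\<close>. With \<open>L\<close>
  empty and residue classes as parts they also count embeddings into a Turan graph with added
  edges.\<close>

definition Psi :: "nat \<Rightarrow> nat set set \<Rightarrow> (nat \<Rightarrow> nat) \<Rightarrow> nat set \<Rightarrow> nat set \<Rightarrow> (nat \<Rightarrow> nat) set" where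
  "Psi n E \<pi> L e = {\<phi> \<in> emb VF EF n E. \<phi> ` VF \<inter> L = {} \<and>
     {e' \<in> (\<lambda>e. \<phi> ` e) ` EF. \<forall>a\<in>e'. \<forall>b\<in>e'. \<pi> a = \<pi> b} = {e}}"

lemma finite_Rbad: "finite (Rbad n E \<pi>)"
  by (rule finite_subset[of _ "{..<n} \<times> {..<n}"]) (auto simp: Rbad_def)

lemma finite_Phi: "finite (Phi n E L x)"
  using finite_emb[OF finV] by (simp add: Phi_def)

lemma finite_Psi: "finite (Psi n E \<pi> L e)"
  using finite_emb[OF finV] by (simp add: Psi_def)

lemma emb_I:
  assumes "\<And>v. v \<in> VF \<Longrightarrow> \<phi> v < n" "\<And>v. v \<notin> VF \<Longrightarrow> \<phi> v = undefined"
    "\<And>v w. v \<in> VF \<Longrightarrow> w \<in> VF \<Longrightarrow> v \<noteq> w \<Longrightarrow> \<phi> v \<noteq> \<phi> w"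
    "\<And>v w. v \<in> VF \<Longrightarrow> w \<in> VF \<Longrightarrow> v \<noteq> w \<Longrightarrow> {v,w} \<in> EF \<Longrightarrow> {\<phi> v, \<phi> w} \<in> E"
  shows "\<phi> \<in> emb VF EF n E"
proof -
  have "\<phi> ` e \<in> E" if e: "e \<in> EF" for e
  proof -
    obtain u v where "e = {u,v}" "u \<in> VF" "v \<in> VF" "u \<noteq> v" using edge_cases[OF e] by blast
    then show ?thesis using assms(4)[of u v] e by simp
  qed
  moreover have "\<phi> \<in> VF \<rightarrow>\<^sub>E {0..<n}" using assms(1,2) by (auto simp: PiE_iff extensional_def)
  moreover have "inj_on \<phi> VF" using assms(3) by (meson inj_onI)
  ultimately show ?thesis by (simp add: emb_def)
qed

lemma emb_D:
  assumes "\<phi> \<in> emb VF EF n E"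
  shows "v \<in> VF \<Longrightarrow> \<phi> v < n" "v \<notin> VF \<Longrightarrow> \<phi> v = undefined"
    "v \<in> VF \<Longrightarrow> w \<in> VF \<Longrightarrow> \<phi> v = \<phi> w \<Longrightarrow> v = w"
    "{v,w} \<in> EF \<Longrightarrow> {\<phi> v, \<phi> w} \<in> E"
proof -
  have P: "\<phi> \<in> VF \<rightarrow>\<^sub>E {0..<n}" and inj: "inj_on \<phi> VF" and e: "\<forall>e\<in>EF. \<phi> ` e \<in> E"
    using assms by (simp_all add: emb_def)
  show "v \<in> VF \<Longrightarrow> \<phi> v < n" using PiE_mem[OF P, of v] by simp
  show "v \<notin> VF \<Longrightarrow> \<phi> v = undefined" using PiE_arb[OF P] by simp
  show "v \<in> VF \<Longrightarrow> w \<in> VF \<Longrightarrow> \<phi> v = \<phi> w \<Longrightarrow> v = w" using inj by (meson inj_onD)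
  show "{v,w} \<in> EF \<Longrightarrow> {\<phi> v, \<phi> w} \<in> E" using e by force
qed

lemma emb_eqI:
  assumes "\<phi> \<in> emb VF EF n E" "\<psi> \<in> emb VF EF n E" "\<And>v. v \<in> VF \<Longrightarrow> \<phi> v = \<psi> v"
  shows "\<phi> = \<psi>"
  using assms emb_D(2)[OF assms(1)] emb_D(2)[OF assms(2)] by (metis ext)

text \<open>For each (u,c) in \<open>KC\<close> put u on x, neighbours w of u into D (c w) and other
  vertices into S (c w); \<open>PiE_avoid\<close> discards the maps that collide or hit a missing
  cross pair. Different choices give different embeddings: u is the only vertex sent into
  \<open>L\<close>, and c is read off from the parts.\<close>

lemma Phi_lower:
  assumes x: "x < n" "x \<in> L"
    and D: "\<And>j y. j < r \<Longrightarrow> y \<in> D j \<Longrightarrow> y < n \<and> \<pi> y = j \<and> {x,y} \<in> E \<and> y \<notin> L"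
    and S: "\<And>j y. j < r \<Longrightarrow> y \<in> S j \<Longrightarrow> y < n \<and> \<pi> y = j \<and> y \<notin> L"
    and mu: "real (card (Rbad n E \<pi>)) \<le> \<mu> * real n ^ 2" "\<mu> \<ge> 0"
  shows "real (card (Phi n E L x)) \<ge> (\<Sum>(u,c)\<in>KC.
     (\<Prod>w\<in>VF - {u}. if {u,w} \<in> EF then real (card (D (c w))) else real (card (S (c w))))
       - real f ^ 2 * \<mu> * real n ^ (f - 1))"
proof -
  define A where "A = (\<lambda>u c w. if {u,w} \<in> EF then D (c w) else S (c w))"
  define Z where "Z = (\<lambda>(u,c). {\<psi> \<in> PiE (VF - {u}) (A u c).
     \<forall>v\<in>VF - {u}. \<forall>w\<in>VF - {u}. v \<noteq> w \<longrightarrow> (\<psi> v, \<psi> w) \<notin> Rbad n E \<pi>})"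
  have Asub: "A u c w \<subseteq> {0..<n}" and Api: "y \<in> A u c w \<Longrightarrow> \<pi> y = c w \<and> y \<notin> L \<and> ({u,w} \<in> EF \<longrightarrow> {x,y} \<in> E)"
    if "(u,c) \<in> KC" "w \<in> VF - {u}" for u c w y
  proof -
    have "c w < r" using that proper_coloringsD(3) by (auto simp: KC_def)
    then show "A u c w \<subseteq> {0..<n}" "y \<in> A u c w \<Longrightarrow> \<pi> y = c w \<and> y \<notin> L \<and> ({u,w} \<in> EF \<longrightarrow> {x,y} \<in> E)"
      using D S by (auto simp: A_def split: if_splits)
  qed
  have Zmem: "\<psi> w \<in> A u c w" if "(u,c) \<in> KC" "\<psi> \<in> Z (u,c)" "w \<in> VF - {u}" for u c \<psi> w
    using that by (auto simp: Z_def)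
  have finZ: "finite (Z p)" if "p \<in> KC" for p
  proof -
    obtain u c where p: "p = (u,c)" by fastforce
    have "finite (PiE (VF - {u}) (A u c))"
      using Asub that p finV by (intro finite_PiE) (auto intro!: finite_subset[of _ "{0..<n}"])
    then show ?thesis unfolding Z_def p by simp
  qed
  let ?g = "\<lambda>((u,c),\<psi>). \<psi>(u := x)"
  have inPhi: "\<psi>(u := x) \<in> Phi n E L x" if uc: "(u,c) \<in> KC" and psi: "\<psi> \<in> Z (u,c)" for u c \<psi>
  proof -
    let ?p = "\<psi>(u := x)"
    have u: "u \<in> VF" and c: "c \<in> proper_colorings r VF EF u" using uc by (auto simp: KC_def)
    have m: "\<psi> w < n" "\<pi> (\<psi> w) = c w" "\<psi> w \<notin> L" "{u,w} \<in> EF \<Longrightarrow> {x, \<psi> w} \<in> E"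
      if "w \<in> VF - {u}" for w
      using Zmem[OF uc psi that] Api[OF uc that] Asub[OF uc that] by auto
    have nR: "(\<psi> v, \<psi> w) \<notin> Rbad n E \<pi>" if "v \<in> VF - {u}" "w \<in> VF - {u}" "v \<noteq> w" for v w
      using psi that by (auto simp: Z_def)
    have ext: "\<psi> w = undefined" if "w \<notin> VF - {u}" for w
      using psi that PiE_arb[of \<psi> "VF - {u}" "A u c" w] by (simp add: Z_def)
    have xm: "\<psi> w \<noteq> x" if "w \<in> VF - {u}" for w using m(3)[OF that] x by auto
    have em: "?p \<in> emb VF EF n E"
    proof (rule emb_I)
      fix v assume "v \<in> VF" then show "?p v < n" using m(1)[of v] x by simp
    next
      fix v assume "v \<notin> VF" then show "?p v = undefined" using ext[of v] u by auto
    next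
      fix v w assume vw: "v \<in> VF" "w \<in> VF" "v \<noteq> w"
      then show "?p v \<noteq> ?p w"
        using xm[of v] xm[of w] nR[of v w] m(1)[of v] by (auto simp: Rbad_def)
    next
      fix v w assume vw: "v \<in> VF" "w \<in> VF" "v \<noteq> w" and e: "{v,w} \<in> EF"
      consider "v = u" | "w = u" | "v \<noteq> u" "w \<noteq> u" by blast
      then show "{?p v, ?p w} \<in> E"
      proof cases
        case 1 then show ?thesis using m(4)[of w] vw e by auto
      next
        case 2 then show ?thesis using m(4)[of v] vw e by (auto simp: insert_commute)
      next
        case 3
        then have "c v \<noteq> c w" using proper_coloringsD(2)[OF c, of v w] vw e by simp
        then show ?thesis using nR[of v w] m(1,2)[of v] m(1,2)[of w] vw 3 by (auto simp: Rbad_def)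
      qed
    qed
    have "?p ` VF \<inter> L = {x}"
    proof
      show "?p ` VF \<inter> L \<subseteq> {x}" using m(3) by auto
      show "{x} \<subseteq> ?p ` VF \<inter> L" using u x by force
    qed
    then show ?thesis using em by (simp add: Phi_def)
  qed
  have "card (Sigma KC Z) \<le> card (Phi n E L x)"
  proof (rule card_inj_on_le[where f = ?g])
    show "?g ` Sigma KC Z \<subseteq> Phi n E L x" using inPhi by auto
    show "inj_on ?g (Sigma KC Z)"
    proof (rule inj_onI)
      fix p q assume pq: "p \<in> Sigma KC Z" "q \<in> Sigma KC Z" "?g p = ?g q"
      obtain u c \<psi> where p: "p = ((u,c),\<psi>)" by (metis prod.exhaust)
      obtain u' c' \<psi>' where q: "q = ((u',c'),\<psi>')" by (metis prod.exhaust)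
      have uc: "(u,c) \<in> KC" "\<psi> \<in> Z (u,c)" "(u',c') \<in> KC" "\<psi>' \<in> Z (u',c')" using pq p q by auto
      have eq: "\<psi>(u := x) = \<psi>'(u' := x)" using pq p q by simp
      have u: "u \<in> VF" "u' \<in> VF" using uc by (auto simp: KC_def)
      have uu: "u = u'"
      proof (rule ccontr)
        assume ne: "u \<noteq> u'"
        then have "\<psi> u' = x" using fun_cong[OF eq, of u'] by simp
        moreover have "\<psi> u' \<notin> L" using Zmem[OF uc(1,2), of u'] Api[OF uc(1), of u'] u ne by auto
        ultimately show False using x by simp
      qed
      have ps: "\<psi> w = \<psi>' w" if "w \<in> VF - {u}" for w using fun_cong[OF eq, of w] that uu by simp
      have "c w = c' w" if "w \<in> VF - {u}" for w
      proof -
        have "\<pi> (\<psi> w) = c w" using Api[OF uc(1) that Zmem[OF uc(1,2) that]] by simp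
        moreover have w': "w \<in> VF - {u'}" using that uu by simp
        have "\<pi> (\<psi>' w) = c' w" using Api[OF uc(3) w' Zmem[OF uc(3,4) w']] by simp
        ultimately show ?thesis using ps[OF that] by simp
      qed
      moreover have "c \<in> (VF - {u}) \<rightarrow>\<^sub>E {0..<r}" "c' \<in> (VF - {u}) \<rightarrow>\<^sub>E {0..<r}"
        using uc(1,3) uu proper_coloringsD(1) unfolding KC_def by simp_all
      ultimately have cc: "c = c'" by (meson PiE_ext)
      have "\<psi> \<in> PiE (VF - {u}) (A u c)" "\<psi>' \<in> PiE (VF - {u}) (A u c)" using uc uu cc by (auto simp: Z_def)
      then have "\<psi> = \<psi>'" using ps by (meson PiE_ext)
      then show "p = q" using p q uu cc by simp
    qed
  qed (rule finite_Phi)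
  moreover have "card (Sigma KC Z) = (\<Sum>p\<in>KC. card (Z p))"
    using finite_KC finZ by (simp add: card_SigmaI)
  ultimately have le: "(\<Sum>p\<in>KC. real (card (Z p))) \<le> real (card (Phi n E L x))"
    by (metis of_nat_le_iff of_nat_sum)
  have "(\<Prod>w\<in>VF - {u}. if {u,w} \<in> EF then real (card (D (c w))) else real (card (S (c w))))
       - real f ^ 2 * \<mu> * real n ^ (f - 1) \<le> real (card (Z (u,c)))" if uc: "(u,c) \<in> KC" for u c
  proof -
    have cW: "card (VF - {u}) = f - 1" using uc finV by (simp add: KC_def)
    have mu': "real (card (Rbad n E \<pi>)) \<le> \<mu> * real (card {0..<n}) ^ 2" using mu by simp
    have "(\<Prod>a\<in>VF - {u}. real (card (A u c a))) - real (f - 1) ^ 2 * \<mu> * real n ^ (f - 1) \<le> real (card (Z (u,c)))"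
      using PiE_avoid[OF _ _ Asub[OF uc] finite_Rbad mu' mu(2), of "VF - {u}"] finV
      unfolding Z_def by (simp add: cW)
    moreover have "real (f - 1) ^ 2 * \<mu> * real n ^ (f - 1) \<le> real f ^ 2 * \<mu> * real n ^ (f - 1)"
      using mu(2) by (intro mult_right_mono power_mono) auto
    moreover have "(\<Prod>a\<in>VF - {u}. real (card (A u c a))) =
      (\<Prod>w\<in>VF - {u}. if {u,w} \<in> EF then real (card (D (c w))) else real (card (S (c w))))"
      unfolding A_def by (intro prod.cong) auto
    ultimately show ?thesis by linarith
  qed
  then have "(\<Sum>(u,c)\<in>KC.
     (\<Prod>w\<in>VF - {u}. if {u,w} \<in> EF then real (card (D (c w))) else real (card (S (c w))))
       - real f ^ 2 * \<mu> * real n ^ (f - 1)) \<le> (\<Sum>p\<in>KC. real (card (Z p)))"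
    by (intro sum_mono) auto
  then show ?thesis using le by linarith
qed

text \<open>Each (u,c) in \<open>K i\<close> places u on x and its partner on y. Candidates in part
  i itself need no adjacency to x or y, because apart from each other neither u nor its partner has
  an F-neighbour of colour i. The reversed placement is counted too: it belongs to the pair whose
  distinguished vertex is the partner.\<close>

lemma Psi_lower:
  assumes xy: "x < n" "y < n" "x \<noteq> y" "{x,y} \<in> E" "x \<notin> L" "y \<notin> L" "\<pi> x = i" "\<pi> y = i" "i < r"
    and G: "\<And>j z. j < r \<Longrightarrow> z \<in> G j \<Longrightarrow>
      z < n \<and> \<pi> z = j \<and> z \<notin> L \<and> z \<noteq> x \<and> z \<noteq> y \<and> (j \<noteq> i \<longrightarrow> {x,z} \<in> E \<and> {y,z} \<in> E)"
    and g: "\<And>j. j < r \<Longrightarrow> g \<le> real (card (G j))" "0 \<le> g"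
    and mu: "real (card (Rbad n E \<pi>)) \<le> \<mu> * real n ^ 2" "\<mu> \<ge> 0"
  shows "real (card (Psi n E \<pi> L {x,y})) \<ge> real N * (g ^ (f - 2) - real f ^ 2 * \<mu> * real n ^ (f - 2))"
proof -
  define W where "W = (\<lambda>u c. VF - {u, partner i u c})"
  define Z where "Z = (\<lambda>(u,c). {\<psi> \<in> PiE (W u c) (\<lambda>w. G (c w)).
     \<forall>v\<in>W u c. \<forall>w\<in>W u c. v \<noteq> w \<longrightarrow> (\<psi> v, \<psi> w) \<notin> Rbad n E \<pi>})"
  have clt: "c w < r" if "(u,c) \<in> K i" "w \<in> W u c" for u c w
    using that proper_coloringsD(3)[OF K_partner(2)] by (auto simp: W_def)
  have Asub: "G (c w) \<subseteq> {0..<n}" if "(u,c) \<in> K i" "w \<in> W u c" for u c w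
    using G[OF clt[OF that]] by auto
  have Zm: "\<psi> w \<in> G (c w)" if "\<psi> \<in> Z (u,c)" "w \<in> W u c" for u c \<psi> w
    using that by (auto simp: Z_def)
  have finZ: "finite (Z p)" if "p \<in> K i" for p
  proof -
    obtain u c where p: "p = (u,c)" by fastforce
    have "finite (PiE (W u c) (\<lambda>w. G (c w)))"
      using Asub that p finV by (intro finite_PiE) (auto intro!: finite_subset[of _ "{0..<n}"] simp: W_def)
    then show ?thesis unfolding Z_def p by simp
  qed
  let ?g = "\<lambda>((u,c),\<psi>). \<psi>(u := x, partner i u c := y)"
  have props: "\<psi> w < n \<and> \<pi> (\<psi> w) = c w \<and> \<psi> w \<notin> L \<and> \<psi> w \<noteq> x \<and> \<psi> w \<noteq> y \<and> (c w \<noteq> i \<longrightarrow> {x, \<psi> w} \<in> E \<and> {y, \<psi> w} \<in> E)"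
    if "(u,c) \<in> K i" "\<psi> \<in> Z (u,c)" "w \<in> W u c" for u c \<psi> w
    using G[OF clt[OF that(1,3)] Zm[OF that(2,3)]] .
  have inPsi: "\<psi>(u := x, partner i u c := y) \<in> Psi n E \<pi> L {x,y}" if uc: "(u,c) \<in> K i" and psi: "\<psi> \<in> Z (u,c)" for u c \<psi>
  proof -
    define v where "v = partner i u c"
    note kp = K_partner[OF uc, folded v_def]
    have v: "v \<in> VF" "v \<noteq> u" using kp(3) by auto
    let ?p = "\<psi>(u := x, v := y)"
    have Wmem: "w \<in> W u c \<longleftrightarrow> w \<in> VF \<and> w \<noteq> u \<and> w \<noteq> v" for w by (auto simp: W_def v_def)
    have m: "\<psi> w < n" "\<pi> (\<psi> w) = c w" "\<psi> w \<notin> L" "\<psi> w \<noteq> x" "\<psi> w \<noteq> y" "c w \<noteq> i \<Longrightarrow> {x, \<psi> w} \<in> E" "c w \<noteq> i \<Longrightarrow> {y, \<psi> w} \<in> E"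
      if "w \<in> VF" "w \<noteq> u" "w \<noteq> v" for w
      using props[OF uc psi, of w] that Wmem by blast+
    have nR: "(\<psi> a, \<psi> w) \<notin> Rbad n E \<pi>" if "a \<in> W u c" "w \<in> W u c" "a \<noteq> w" for a w
      using psi that by (auto simp: Z_def)
    have ext: "\<psi> w = undefined" if "w \<notin> W u c" for w
      using psi that PiE_arb[of \<psi> "W u c" "\<lambda>w. G (c w)" w] by (simp add: Z_def)
    have pv: "\<pi> (?p w) = (if w = u then i else c w)" if "w \<in> VF" for w
      using m(2)[of w] that kp(5) xy v by auto
    have cu: "c w \<noteq> i" if "{u,w} \<in> EF" "w \<noteq> v" for w
      using kp(6)[of w] that edge_mem edge_neq by blast
    have cv: "c w \<noteq> i" if "{v,w} \<in> EF" "w \<noteq> u" for w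
      using proper_coloringsD(2)[OF kp(2), of v w] that edge_mem[OF that(1)] kp(5) v by auto
    have em: "?p \<in> emb VF EF n E"
    proof (rule emb_I)
      fix w assume "w \<in> VF" then show "?p w < n" using m(1)[of w] xy by simp
    next
      fix w assume "w \<notin> VF" then show "?p w = undefined" using ext[of w] kp(1) v by (auto simp: Wmem)
    next
      fix a w assume vw: "a \<in> VF" "w \<in> VF" "a \<noteq> w"
      show "?p a \<noteq> ?p w"
      proof (cases "a \<in> W u c \<and> w \<in> W u c")
        case True
        then have "\<psi> a \<noteq> \<psi> w" using nR[of a w] m(1)[of a] vw by (auto simp: Rbad_def Wmem)
        then show ?thesis using True by (simp add: Wmem)
      next
        case False
        then show ?thesis using vw m(4)[of a] m(5)[of a] m(4)[of w] m(5)[of w] xy(3) v by (auto simp: Wmem)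
      qed
    next
      fix a w assume vw: "a \<in> VF" "w \<in> VF" "a \<noteq> w" and e: "{a,w} \<in> EF"
      have e': "{w,a} \<in> EF" using e by (simp add: insert_commute)
      show "{?p a, ?p w} \<in> E"
      proof (cases "a \<in> W u c \<and> w \<in> W u c")
        case True
        then have "c a \<noteq> c w" using proper_coloringsD(2)[OF kp(2), of a w] vw e by (auto simp: Wmem)
        then show ?thesis using nR[of a w] m(1,2)[of a] m(1,2)[of w] True vw(3) by (auto simp: Rbad_def Wmem)
      next
        case False
        then consider "a = u" "w = v" | "a = v" "w = u" | "a = u" "w \<noteq> v" | "a = v" "w \<noteq> u"
          | "w = u" "a \<noteq> v" | "w = v" "a \<noteq> u"
          using vw Wmem by blast
        then show ?thesis
        proof cases
          case 1 then show ?thesis using xy(4) v by simp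
        next
          case 2 then show ?thesis using xy(4) v by (simp add: insert_commute)
        next
          case 3
          then have "{x, \<psi> w} \<in> E" using m(6)[of w] cu[of w] vw e by simp
          then show ?thesis using 3 vw v by simp
        next
          case 4
          then have "{y, \<psi> w} \<in> E" using m(7)[of w] cv[of w] vw e by simp
          then show ?thesis using 4 vw v by simp
        next
          case 5
          then have "{\<psi> a, x} \<in> E" using m(6)[of a] cu[of a] vw e' by (simp add: insert_commute)
          then show ?thesis using 5 vw v by simp
        next
          case 6
          then have "{\<psi> a, y} \<in> E" using m(7)[of a] cv[of a] vw e' by (simp add: insert_commute)
          then show ?thesis using 6 vw v by simp
        qed
      qed
    qed
    have L0: "?p ` VF \<inter> L = {}" using m(3) xy by auto
    have "{e' \<in> (\<lambda>e. ?p ` e) ` EF. \<forall>a\<in>e'. \<forall>b\<in>e'. \<pi> a = \<pi> b} = {{x,y}}"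
    proof
      show "{{x,y}} \<subseteq> {e' \<in> (\<lambda>e. ?p ` e) ` EF. \<forall>a\<in>e'. \<forall>b\<in>e'. \<pi> a = \<pi> b}"
      proof -
        have "{x,y} = ?p ` {u,v}" using v by auto
        then have "{x,y} \<in> (\<lambda>e. ?p ` e) ` EF" using kp(4) by blast
        then show ?thesis using xy by auto
      qed
      show "{e' \<in> (\<lambda>e. ?p ` e) ` EF. \<forall>a\<in>e'. \<forall>b\<in>e'. \<pi> a = \<pi> b} \<subseteq> {{x,y}}"
      proof
        fix e' assume "e' \<in> {e' \<in> (\<lambda>e. ?p ` e) ` EF. \<forall>a\<in>e'. \<forall>b\<in>e'. \<pi> a = \<pi> b}"
        then obtain e where e: "e \<in> EF" "e' = ?p ` e" and mono: "\<forall>a\<in>e'. \<forall>b\<in>e'. \<pi> a = \<pi> b" by blast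
        obtain a b where ab: "e = {a,b}" "a \<in> VF" "b \<in> VF" "a \<noteq> b" using edge_cases[OF e(1)] by blast
        have eq: "\<pi> (?p a) = \<pi> (?p b)" using mono e(2) ab(1) by blast
        have "{a,b} = {u,v}"
        proof (rule ccontr)
          assume ne: "{a,b} \<noteq> {u,v}"
          consider "a = u" | "b = u" | "a \<noteq> u" "b \<noteq> u" by blast
          then show False
          proof cases
            case 1
            then have "b \<noteq> v" using ne by auto
            then show False using cu[of b] 1 ab e(1) eq pv[of a] pv[of b] by auto
          next
            case 2
            then have "a \<noteq> v" using ne by auto
            then show False using cu[of a] 2 ab e(1) eq pv[of a] pv[of b] by (auto simp: insert_commute)
          next
            case 3
            then show False using proper_coloringsD(2)[OF kp(2), of a b] ab e(1) eq pv[of a] pv[of b] by simp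
          qed
        qed
        then show "e' \<in> {{x,y}}" using e(2) ab(1) v by auto
      qed
    qed
    then show ?thesis using em L0 unfolding Psi_def v_def by simp
  qed
  have "card (Sigma (K i) Z) \<le> card (Psi n E \<pi> L {x,y})"
  proof (rule card_inj_on_le[where f = ?g])
    show "?g ` Sigma (K i) Z \<subseteq> Psi n E \<pi> L {x,y}" using inPsi by auto
    show "inj_on ?g (Sigma (K i) Z)"
    proof (rule inj_onI)
      fix p q assume pq: "p \<in> Sigma (K i) Z" "q \<in> Sigma (K i) Z" "?g p = ?g q"
      obtain u c \<psi> where p: "p = ((u,c),\<psi>)" by (metis prod.exhaust)
      obtain u' c' \<psi>' where q: "q = ((u',c'),\<psi>')" by (metis prod.exhaust)
      have uc: "(u,c) \<in> K i" "\<psi> \<in> Z (u,c)" "(u',c') \<in> K i" "\<psi>' \<in> Z (u',c')" using pq p q by auto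
      have eq: "\<psi>(u := x, partner i u c := y) = \<psi>'(u' := x, partner i u' c' := y)" using pq p q by simp
      have ux: "w = u" if "w \<in> VF" "(\<psi>(u := x, partner i u c := y)) w = x" for w
        using that props[OF uc(1,2), of w] xy(3) by (auto simp: W_def split: if_splits)
      have "(\<psi>(u := x, partner i u c := y)) u' = x"
        unfolding eq using K_partner(3)[OF uc(3)] by simp
      then have uu: "u' = u" using ux K_partner(1)[OF uc(3)] by blast
      have pc: "\<pi> ((\<psi>(u := x, partner i u c := y)) w) = c w" if "w \<in> VF - {u}" for w
        using props[OF uc(1,2), of w] that K_partner(5)[OF uc(1)] xy by (auto simp: W_def)
      have pc': "\<pi> ((\<psi>'(u' := x, partner i u' c' := y)) w) = c' w" if "w \<in> VF - {u}" for w
        using props[OF uc(3,4), of w] that K_partner(5)[OF uc(3)] xy uu by (auto simp: W_def)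
      have "c w = c' w" if "w \<in> VF - {u}" for w using pc[OF that] pc'[OF that] eq by simp
      moreover have "c \<in> (VF - {u}) \<rightarrow>\<^sub>E {0..<r}" "c' \<in> (VF - {u}) \<rightarrow>\<^sub>E {0..<r}"
        using proper_coloringsD(1)[OF K_partner(2)[OF uc(1)]] proper_coloringsD(1)[OF K_partner(2)[OF uc(3)]] uu by simp_all
      ultimately have cc: "c = c'" by (meson PiE_ext)
      have ps: "\<psi> w = \<psi>' w" if "w \<in> W u c" for w
        using fun_cong[OF eq, of w] that uu cc by (simp add: W_def)
      have "\<psi> \<in> PiE (W u c) (\<lambda>w. G (c w))" "\<psi>' \<in> PiE (W u c) (\<lambda>w. G (c w))" using uc uu cc by (auto simp: Z_def)
      then have "\<psi> = \<psi>'" using ps by (meson PiE_ext)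
      then show "p = q" using p q uu cc by simp
    qed
  qed (rule finite_Psi)
  moreover have "card (Sigma (K i) Z) = (\<Sum>p\<in>K i. card (Z p))"
    using finite_K finZ by (simp add: card_SigmaI)
  ultimately have le: "(\<Sum>p\<in>K i. real (card (Z p))) \<le> real (card (Psi n E \<pi> L {x,y}))"
    by (metis of_nat_le_iff of_nat_sum)
  have "g ^ (f - 2) - real f ^ 2 * \<mu> * real n ^ (f - 2) \<le> real (card (Z p))" if "p \<in> K i" for p
  proof -
    obtain u c where p: "p = (u,c)" by fastforce
    then have uc: "(u,c) \<in> K i" using that by simp
    have cW: "card (W u c) = f - 2"
      using K_partner(1,3)[OF uc] finV by (simp add: W_def card_Diff_subset numeral_2_eq_2)
    have mu': "real (card (Rbad n E \<pi>)) \<le> \<mu> * real (card {0..<n}) ^ 2" using mu by simp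
    have finW: "finite (W u c)" using finV by (simp add: W_def)
    have "(\<Prod>a\<in>W u c. real (card (G (c a)))) - real (f - 2) ^ 2 * \<mu> * real n ^ (f - 2) \<le> real (card (Z p))"
      using PiE_avoid[OF finW finite_atLeastLessThan Asub[OF uc] finite_Rbad mu' mu(2)]
      unfolding Z_def p by (simp add: cW)
    moreover have "real (f - 2) ^ 2 * \<mu> * real n ^ (f - 2) \<le> real f ^ 2 * \<mu> * real n ^ (f - 2)"
      using mu(2) by (intro mult_right_mono power_mono) auto
    moreover have "g ^ (f - 2) \<le> (\<Prod>a\<in>W u c. real (card (G (c a))))"
    proof -
      have "(\<Prod>a\<in>W u c. g) \<le> (\<Prod>a\<in>W u c. real (card (G (c a))))"
        using g clt[OF uc] by (intro prod_mono) auto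
      then show ?thesis using cW by simp
    qed
    ultimately show ?thesis by linarith
  qed
  then have "(\<Sum>p\<in>K i. g ^ (f - 2) - real f ^ 2 * \<mu> * real n ^ (f - 2)) \<le> (\<Sum>p\<in>K i. real (card (Z p)))"
    by (intro sum_mono) auto
  then show ?thesis using le card_K[OF xy(9)] by simp
qed

text \<open>The placement of \<open>Psi_lower\<close> can be inverted: the vertex sent to x and the
  parts of the other images recover a pair in \<open>K i\<close>, and only the f - 2 remaining
  vertices are free. Hence the leading terms of both bounds agree, which pins down
  \<alpha>_F.\<close>

lemma Psi_upper:
  assumes pi: "\<And>z. z < n \<Longrightarrow> \<pi> z < r"
    and s: "\<And>j. j < r \<Longrightarrow> real (card {z. z < n \<and> \<pi> z = j}) \<le> s"
    and xy: "x \<noteq> y" "\<pi> x = i" "\<pi> y = i" "i < r"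
  shows "real (card (Psi n E \<pi> L {x,y})) \<le> real N * s ^ (f - 2)"
proof -
  define W where "W = (\<lambda>u c. VF - {u, partner i u c})"
  define V where "V = (\<lambda>j. {z. z < n \<and> \<pi> z = j})"
  define Z where "Z = (\<lambda>(u,c). PiE (W u c) (\<lambda>w. V (c w)))"
  define U where "U = (\<lambda>\<phi>. THE u. u \<in> VF \<and> \<phi> u = x)"
  define C where "C = (\<lambda>\<phi>. restrict (\<pi> \<circ> \<phi>) (VF - {U \<phi>}))"
  let ?g = "\<lambda>\<phi>. ((U \<phi>, C \<phi>), restrict \<phi> (W (U \<phi>) (C \<phi>)))"
  have key: "U \<phi> \<in> VF \<and> \<phi> (U \<phi>) = x \<and> (U \<phi>, C \<phi>) \<in> K i \<and> \<phi> (partner i (U \<phi>) (C \<phi>)) = y"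
    if ph: "\<phi> \<in> Psi n E \<pi> L {x,y}" for \<phi>
  proof -
    have em: "\<phi> \<in> emb VF EF n E" and set: "{e' \<in> (\<lambda>e. \<phi> ` e) ` EF. \<forall>a\<in>e'. \<forall>b\<in>e'. \<pi> a = \<pi> b} = {{x,y}}"
      using ph by (simp_all add: Psi_def)
    have "{x,y} \<in> {e' \<in> (\<lambda>e. \<phi> ` e) ` EF. \<forall>a\<in>e'. \<forall>b\<in>e'. \<pi> a = \<pi> b}" unfolding set by simp
    then obtain e where e: "e \<in> EF" "\<phi> ` e = {x,y}" by (metis (no_types, lifting) imageE mem_Collect_eq)
    \<comment> \<open>Any F-edge with both images in one part must be the edge mapped to {x,y}. This
      gives both the properness of the colouring and the uniqueness of the neighbour of colour
      i.\<close>
    have mono: "{\<phi> a, \<phi> b} = {x,y}" if "{a,b} \<in> EF" "\<pi> (\<phi> a) = \<pi> (\<phi> b)" for a b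
    proof -
      have "\<phi> ` {a,b} \<in> {e' \<in> (\<lambda>e. \<phi> ` e) ` EF. \<forall>a\<in>e'. \<forall>b\<in>e'. \<pi> a = \<pi> b}"
        using that by (auto intro!: image_eqI[of _ _ "{a,b}"])
      then show ?thesis unfolding set by simp
    qed
    have "x \<in> \<phi> ` e" "y \<in> \<phi> ` e" using e(2) by auto
    then obtain u v where uv: "u \<in> e" "\<phi> u = x" "v \<in> e" "\<phi> v = y" by blast
    have uvV: "u \<in> VF" "v \<in> VF" "u \<noteq> v" using uv edge_sub[OF e(1)] xy by auto
    have "e = {u,v}" using edge_cases[OF e(1)] uv uvV(3) by (metis doubleton_eq_iff insertE singletonD)
    then have uvE: "{u,v} \<in> EF" using e by simp
    have Uu: "U \<phi> = u" unfolding U_def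
      using uv uvV emb_D(3)[OF em] by (intro the_equality) auto
    have Cw: "C \<phi> w = \<pi> (\<phi> w)" if "w \<in> VF - {u}" for w using that by (simp add: C_def Uu)
    have pcol: "C \<phi> \<in> proper_colorings r VF EF u" unfolding proper_colorings_def mem_Collect_eq
    proof (intro conjI ballI impI)
      show "C \<phi> \<in> (VF - {u}) \<rightarrow>\<^sub>E {0..<r}" using emb_D(1)[OF em] pi by (auto simp: C_def Uu)
      fix a b assume ab: "a \<in> VF - {u}" "b \<in> VF - {u}" "{a,b} \<in> EF"
      show "C \<phi> a \<noteq> C \<phi> b"
      proof
        assume "C \<phi> a = C \<phi> b"
        then have "{\<phi> a, \<phi> b} = {x,y}" using mono ab Cw by simp
        then have "\<phi> a = x \<or> \<phi> b = x" by (metis doubleton_eq_iff)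
        then show False using emb_D(3)[OF em, of a u] emb_D(3)[OF em, of b u] ab uv uvV by auto
      qed
    qed
    have only: "{w \<in> VF - {u}. {u,w} \<in> EF \<and> C \<phi> w = i} = {v}"
    proof
      show "{v} \<subseteq> {w \<in> VF - {u}. {u,w} \<in> EF \<and> C \<phi> w = i}" using uv uvV uvE Cw xy by auto
      show "{w \<in> VF - {u}. {u,w} \<in> EF \<and> C \<phi> w = i} \<subseteq> {v}"
      proof
        fix w assume w: "w \<in> {w \<in> VF - {u}. {u,w} \<in> EF \<and> C \<phi> w = i}"
        then have "{\<phi> u, \<phi> w} = {x,y}" using mono[of u w] Cw[of w] uv xy by auto
        then have "\<phi> w = y" using uv xy by (auto simp: doubleton_eq_iff)
        then show "w \<in> {v}" using emb_D(3)[OF em, of w v] w uv uvV by auto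
      qed
    qed
    have K: "(u, C \<phi>) \<in> K i" using pcol only uvV by (simp add: K_def KC_def ycnt_def)
    have "partner i u (C \<phi>) = v" using K_unique[OF K] only by (metis singleton_inject)
    then show ?thesis using K Uu uv uvV by simp
  qed
  have "card (Psi n E \<pi> L {x,y}) \<le> card (Sigma (K i) Z)"
  proof (rule card_inj_on_le[where f = ?g])
    show "inj_on ?g (Psi n E \<pi> L {x,y})"
    proof (rule inj_onI)
      fix a b assume ab: "a \<in> Psi n E \<pi> L {x,y}" "b \<in> Psi n E \<pi> L {x,y}" "?g a = ?g b"
      have em: "a \<in> emb VF EF n E" "b \<in> emb VF EF n E" using ab by (auto simp: Psi_def)
      have eqs: "U a = U b" "C a = C b" using ab(3) by auto
      have rs: "restrict a (W (U a) (C a)) = restrict b (W (U a) (C a))" using ab(3) eqs by simp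
      show "a = b"
      proof (rule emb_eqI[OF em])
        fix w assume w: "w \<in> VF"
        consider "w = U a" | "w = partner i (U a) (C a)" | "w \<in> W (U a) (C a)" using w by (auto simp: W_def)
        then show "a w = b w"
        proof cases
          case 1 then show ?thesis using key[OF ab(1)] key[OF ab(2)] eqs by simp
        next
          case 2 then show ?thesis using key[OF ab(1)] key[OF ab(2)] eqs by simp
        next
          case 3 then show ?thesis using fun_cong[OF rs, of w] by simp
        qed
      qed
    qed
    show "?g ` Psi n E \<pi> L {x,y} \<subseteq> Sigma (K i) Z"
    proof (rule image_subsetI)
      fix \<phi> assume ph: "\<phi> \<in> Psi n E \<pi> L {x,y}"
      have em: "\<phi> \<in> emb VF EF n E" using ph by (simp add: Psi_def)
      have "restrict \<phi> (W (U \<phi>) (C \<phi>)) \<in> Z (U \<phi>, C \<phi>)"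
        using emb_D(1)[OF em] by (auto simp: Z_def W_def V_def C_def)
      then show "?g \<phi> \<in> Sigma (K i) Z" using key[OF ph] by simp
    qed
    show "finite (Sigma (K i) Z)"
      using finite_K finV by (auto simp: Z_def W_def V_def intro!: finite_SigmaI finite_PiE)
  qed
  also have "\<dots> = (\<Sum>p\<in>K i. card (Z p))"
    using finite_K finV by (subst card_SigmaI) (auto simp: Z_def W_def V_def intro!: finite_PiE)
  finally have "real (card (Psi n E \<pi> L {x,y})) \<le> (\<Sum>p\<in>K i. real (card (Z p)))"
    unfolding of_nat_sum[symmetric] of_nat_le_iff .
  also have "\<dots> \<le> (\<Sum>p\<in>K i. s ^ (f - 2))"
  proof (rule sum_mono)
    fix p assume "p \<in> K i"
    obtain u c where p: "p = (u,c)" by fastforce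
    then have uc: "(u,c) \<in> K i" using \<open>p \<in> K i\<close> by simp
    have cW: "card (W u c) = f - 2"
      using K_partner(1,3)[OF uc] finV by (simp add: W_def card_Diff_subset numeral_2_eq_2)
    have finW: "finite (W u c)" using finV by (simp add: W_def)
    have clt: "c w < r" if "w \<in> W u c" for w
      using that proper_coloringsD(3)[OF K_partner(2)[OF uc]] by (auto simp: W_def)
    have "real (card (Z p)) = (\<Prod>a\<in>W u c. real (card (V (c a))))"
      using finW by (simp add: Z_def p card_PiE)
    also have "\<dots> \<le> (\<Prod>a\<in>W u c. s)" using s clt by (intro prod_mono) (auto simp: V_def)
    finally show "real (card (Z p)) \<le> s ^ (f - 2)" using cW by simp
  qed
  finally show ?thesis using card_K[OF xy(4)] by simp
qed

end

section \<open>One extra edge in the Turan graph\<close>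

lemma card_residue_class:
  fixes r :: nat assumes "j < r"
  shows "n div r \<le> card {z. z < n \<and> z mod r = j}" "card {z. z < n \<and> z mod r = j} \<le> n div r + 1"
proof -
  have r0: "r > 0" using assms by simp
  let ?S = "{z. z < n \<and> z mod r = j}"
  have fin: "finite ?S" by simp
  have "(\<lambda>a. a * r + j) ` {..<n div r} \<subseteq> ?S"
  proof (rule image_subsetI)
    fix a assume "a \<in> {..<n div r}"
    then have "Suc a * r \<le> (n div r) * r" by (intro mult_right_mono) auto
    also have "\<dots> \<le> n" by simp
    finally show "a * r + j \<in> ?S" using assms by auto
  qed
  moreover have "inj_on (\<lambda>a. a * r + j) {..<n div r}" using r0 by (auto simp: inj_on_def)
  ultimately show "n div r \<le> card ?S" 
    using card_mono[OF fin, of "(\<lambda>a. a * r + j) ` {..<n div r}"] by (simp add: card_image)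
  have "inj_on (\<lambda>z. z div r) ?S" using r0 by (auto simp: inj_on_def) (metis div_mult_mod_eq)
  moreover have "(\<lambda>z. z div r) ` ?S \<subseteq> {..n div r}" by (auto intro: div_le_mono)
  ultimately show "card ?S \<le> n div r + 1" using card_inj_on_le[of "\<lambda>z. z div r" ?S "{..n div r}"] by simp
qed

lemma card_residue_class_real:
  fixes r :: nat assumes "j < r"
  shows "real n / real r - 1 \<le> real (card {z. z < n \<and> z mod r = j})"
    "real (card {z. z < n \<and> z mod r = j}) \<le> real n / real r + 1"
proof -
  have r0: "r > 0" using assms by simp
  have "(n div r) * r \<le> n" by simp
  then have "real (n div r) * real r \<le> real n" by (simp flip: of_nat_mult)
  then have "real (n div r) \<le> real n / real r" using r0 by (simp add: pos_le_divide_eq)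
  moreover have "n \<le> (n div r + 1) * r"
    using div_mult_mod_eq[of n r] mod_less_divisor[OF r0, of n] by (simp only: distrib_right)
  then have "real n \<le> (real (n div r) + 1) * real r" by (metis of_nat_1 of_nat_add of_nat_le_iff of_nat_mult)
  then have "real n / real r - 1 \<le> real (n div r)" using r0 by (simp add: pos_divide_le_eq diff_le_eq)
  moreover have "real (n div r) \<le> real (card {z. z < n \<and> z mod r = j})"
    "real (card {z. z < n \<and> z mod r = j}) \<le> real (n div r) + 1"
    using card_residue_class[OF assms, of n] by linarith+
  ultimately show "real n / real r - 1 \<le> real (card {z. z < n \<and> z mod r = j})"
    "real (card {z. z < n \<and> z mod r = j}) \<le> real n / real r + 1" by linarith+
qed

lemma turan_iff: "{a,b} \<in> turan_edges r n \<longleftrightarrow> a < n \<and> b < n \<and> a mod r \<noteq> b mod r"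
  unfolding turan_edges_def by (auto simp: doubleton_eq_iff)

lemma pairs_iff: "{a,b} \<in> pairs n \<longleftrightarrow> a < n \<and> b < n \<and> a \<noteq> b"
  unfolding pairs_def by (auto simp: doubleton_eq_iff)

context critical
begin

text \<open>The classes of the Turan graph colour it with r colours, so an embedding of F needs an
  edge inside a class, and only {x,y} is available.\<close>

lemma emb_turan_insert:
  assumes "x < n" "y < n" "x \<noteq> y" "x mod r = y mod r"
  shows "emb VF EF n (insert {x,y} (turan_edges r n)) = Psi n (insert {x,y} (turan_edges r n)) (\<lambda>z. z mod r) {} {x,y}"
proof
  let ?E = "insert {x,y} (turan_edges r n)"
  show "Psi n ?E (\<lambda>z. z mod r) {} {x,y} \<subseteq> emb VF EF n ?E" by (auto simp: Psi_def)
  show "emb VF EF n ?E \<subseteq> Psi n ?E (\<lambda>z. z mod r) {} {x,y}"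
  proof
    fix \<phi> assume em: "\<phi> \<in> emb VF EF n ?E"
    have one: "{\<phi> a, \<phi> b} = {x,y}" if "{a,b} \<in> EF" "\<phi> a mod r = \<phi> b mod r" for a b
      using emb_D(4)[OF em that(1)] that(2) turan_iff[of "\<phi> a" "\<phi> b" r n] by auto
    have "\<And>v. v \<in> VF \<Longrightarrow> \<phi> v mod r < r" using r2 by simp
    then obtain u v where uv: "{u,v} \<in> EF" "\<phi> u mod r = \<phi> v mod r"
      using mono_edge_exists[of "\<lambda>v. \<phi> v mod r"] by blast
    have "{e' \<in> (\<lambda>e. \<phi> ` e) ` EF. \<forall>a\<in>e'. \<forall>b\<in>e'. a mod r = b mod r} = {{x,y}}" (is "?M = _")
    proof
      show "?M \<subseteq> {{x,y}}"
      proof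
        fix e' assume "e' \<in> ?M"
        then obtain e where e: "e \<in> EF" "e' = \<phi> ` e" "\<forall>a\<in>e'. \<forall>b\<in>e'. a mod r = b mod r" by blast
        obtain a b where ab: "e = {a,b}" using edge_cases[OF e(1)] by blast
        then show "e' \<in> {{x,y}}" using one[of a b] e by simp
      qed
      have "{x,y} = \<phi> ` {u,v}" using one[OF uv] by simp
      then have "{x,y} \<in> (\<lambda>e. \<phi> ` e) ` EF" using uv(1) by (rule image_eqI)
      then show "{{x,y}} \<subseteq> ?M" using assms(4) by simp
    qed
    then show "\<phi> \<in> Psi n ?E (\<lambda>z. z mod r) {} {x,y}" using em by (simp add: Psi_def)
  qed
qed

text \<open>Of the loss 3, one is the rounding of n/r and two are the points x and y. The density
  1/n is that of the diagonal, the only part of \<open>Rbad\<close> left in a Turan graph.\<close>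

lemma card_emb_turan_insert:
  assumes "x < n" "y < n" "x \<noteq> y" "x mod r = y mod r" "n \<ge> 3 * r"
  shows "real N * ((real n / real r - 3) ^ (f - 2) - real f ^ 2 * (1 / real n) * real n ^ (f - 2))
       \<le> real (card (emb VF EF n (insert {x,y} (turan_edges r n))))" (is ?A)
    "real (card (emb VF EF n (insert {x,y} (turan_edges r n)))) \<le> real N * (real n / real r + 1) ^ (f - 2)" (is ?B)
proof -
  let ?E = "insert {x,y} (turan_edges r n)" and ?\<pi> = "\<lambda>z. z mod r"
  have r0: "r > 0" using r2 by simp
  show ?B unfolding emb_turan_insert[OF assms(1-4)]
    by (rule Psi_upper[where i = "x mod r"]) (use assms r0 card_residue_class_real(2) in auto)
  define G where "G = (\<lambda>j. {z. z < n \<and> z mod r = j} - {x,y})"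
  have n0: "n > 0" using assms by simp
  have "Rbad n ?E ?\<pi> \<subseteq> (\<lambda>a. (a,a)) ` {..<n}" by (auto simp: Rbad_def turan_iff)
  then have "card (Rbad n ?E ?\<pi>) \<le> card ((\<lambda>a. (a,a)) ` {..<n})" by (intro card_mono) auto
  also have "\<dots> \<le> n" using card_image_le[of "{..<n}" "\<lambda>a. (a,a)"] by simp
  finally have mu: "real (card (Rbad n ?E ?\<pi>)) \<le> (1 / real n) * real n ^ 2"
    using n0 by (simp add: power2_eq_square)
  have g: "real n / real r - 3 \<le> real (card (G j))" if "j < r" for j
  proof -
    have "card {z. z < n \<and> z mod r = j} \<le> card (G j) + card {x,y}"
    proof -
      have "{z. z < n \<and> z mod r = j} \<subseteq> G j \<union> {x,y}" by (auto simp: G_def)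
      then have "card {z. z < n \<and> z mod r = j} \<le> card (G j \<union> {x,y})" by (intro card_mono) (auto simp: G_def)
      then show ?thesis using card_Un_le[of "G j" "{x,y}"] by linarith
    qed
    then have "real (card {z. z < n \<and> z mod r = j}) \<le> real (card (G j)) + 2"
      using assms(3) by simp
    then show ?thesis using card_residue_class_real(1)[OF that, of n] by linarith
  qed
  have "3 \<le> real n / real r" using assms(5) r0 by (simp add: pos_le_divide_eq flip: of_nat_mult)
  then have g0: "0 \<le> real n / real r - 3" by simp
  show ?A unfolding emb_turan_insert[OF assms(1-4)]
  proof (rule Psi_lower[where i = "x mod r" and G = G])
    show "real (card (Rbad n ?E ?\<pi>)) \<le> 1 / real n * (real n)\<^sup>2" using mu by simp
  qed (use assms r0 g g0 in \<open>auto simp: G_def turan_iff\<close>)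
qed

lemma c_num_attained:
  assumes "n > r"
  obtains x y where "x < n" "y < n" "x \<noteq> y" "x mod r = y mod r"
    "c_num r VF EF n = num_copies VF EF {0..<n} (insert {x,y} (turan_edges r n))"
proof -
  let ?S = "{num_copies VF EF {0..<n} (insert e (turan_edges r n)) | e. e \<in> pairs n - turan_edges r n}"
  have "{0,r} \<in> pairs n - turan_edges r n" using assms r2 by (simp add: pairs_iff turan_iff)
  then have "?S \<noteq> {}" by blast
  then have "c_num r VF EF n \<in> ?S" unfolding c_num_def by (rule Inf_nat_def1)
  then obtain e where e: "e \<in> pairs n - turan_edges r n"
    "c_num r VF EF n = num_copies VF EF {0..<n} (insert e (turan_edges r n))" by blast
  obtain x y where "e = {x,y}" using e(1) unfolding pairs_def by blast
  then show ?thesis using that[of x y] e by (simp add: pairs_iff turan_iff)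
qed

text \<open>Both bounds on the number of embeddings are independent of the added edge, so the choice
  that attains the minimum does not matter.\<close>

lemma c_num_lim: "(\<lambda>n. real (c_num r VF EF n) / real n ^ (f - 2)) \<longlonglongrightarrow> a0"
proof (rule tendsto_sandwich)
  let ?a = "real (aut VF EF)"
  let ?l = "\<lambda>n. real N * ((1 / real r - 3 / real n) ^ (f - 2) - real f ^ 2 * (1 / real n)) / ?a"
  let ?u = "\<lambda>n. real N * (1 / real r + 1 / real n) ^ (f - 2) / ?a"
  have a0': "?a > 0" using aut_pos by simp
  have lim: "(\<lambda>n. c / real n) \<longlonglongrightarrow> 0" for c :: real by (rule lim_const_over_n)
  have "?l \<longlonglongrightarrow> real N * ((1 / real r - 0) ^ (f - 2) - real f ^ 2 * 0) / ?a"
    using a0' by (intro tendsto_intros lim) auto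
  then show "?l \<longlonglongrightarrow> a0" by (simp add: a0_def)
  have "?u \<longlonglongrightarrow> real N * (1 / real r + 0) ^ (f - 2) / ?a"
    using a0' by (intro tendsto_intros lim) auto
  then show "?u \<longlonglongrightarrow> a0" by (simp add: a0_def)
  have both: "?l n \<le> real (c_num r VF EF n) / real n ^ (f - 2) \<and> real (c_num r VF EF n) / real n ^ (f - 2) \<le> ?u n"
    if n: "n \<ge> 3 * r" for n
  proof -
    have nr: "n > r" and n0: "n > 0" using n r2 by auto
    obtain x y where xy: "x < n" "y < n" "x \<noteq> y" "x mod r = y mod r"
      "c_num r VF EF n = num_copies VF EF {0..<n} (insert {x,y} (turan_edges r n))"
      by (rule c_num_attained[OF nr])
    have eq: "real (card (emb VF EF n (insert {x,y} (turan_edges r n)))) = ?a * real (c_num r VF EF n)"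
      using card_emb[OF graph, of n "insert {x,y} (turan_edges r n)"] xy(5) by simp
    note b = card_emb_turan_insert[OF xy(1-4) n, unfolded eq]
    have np: "real n ^ (f - 2) > 0" using n0 by simp
    have p1: "(1 / real r - 3 / real n) ^ (f - 2) * real n ^ (f - 2) = (real n / real r - 3) ^ (f - 2)"
      using n0 by (simp add: power_mult_distrib[symmetric] left_diff_distrib)
    have p2: "(1 / real r + 1 / real n) ^ (f - 2) * real n ^ (f - 2) = (real n / real r + 1) ^ (f - 2)"
      using n0 by (simp add: power_mult_distrib[symmetric] distrib_right)
    have "?l n * real n ^ (f - 2) * ?a = real N * ((1 / real r - 3 / real n) ^ (f - 2) * real n ^ (f - 2) - real f ^ 2 * (1 / real n) * real n ^ (f - 2))"
      using a0' by (simp add: field_simps)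
    also have "\<dots> \<le> ?a * real (c_num r VF EF n)" unfolding p1 by (rule b(1))
    finally have "?l n * real n ^ (f - 2) \<le> real (c_num r VF EF n)"
      using a0' by (metis mult.commute mult_le_cancel_left_pos)
    moreover have "?a * real (c_num r VF EF n) \<le> ?u n * real n ^ (f - 2) * ?a"
      using b(2) a0' p2 by (simp add: field_simps)
    then have "real (c_num r VF EF n) \<le> ?u n * real n ^ (f - 2)"
      using a0' by (metis mult.commute mult_le_cancel_left_pos)
    ultimately show ?thesis using np by (simp add: pos_le_divide_eq pos_divide_le_eq)
  qed
  show "\<forall>\<^sub>F n in sequentially. ?l n \<le> real (c_num r VF EF n) / real n ^ (f - 2)"
    using eventually_ge_at_top[of "3 * r"] by eventually_elim (use both in blast)
  show "\<forall>\<^sub>F n in sequentially. real (c_num r VF EF n) / real n ^ (f - 2) \<le> ?u n"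
    using eventually_ge_at_top[of "3 * r"] by eventually_elim (use both in blast)
qed

lemma alpha_eq: "alpha r VF EF = a0"
  unfolding alpha_def using c_num_lim by (rule limI)

end

section \<open>Stability\<close>

definition cliques :: "nat \<Rightarrow> nat set set \<Rightarrow> nat \<Rightarrow> nat set set" where
  "cliques n E s = {K. K \<subseteq> {0..<n} \<and> card K = s \<and> (\<forall>a\<in>K. \<forall>b\<in>K. a \<noteq> b \<longrightarrow> {a,b} \<in> E)}"

definition ext :: "nat \<Rightarrow> nat set set \<Rightarrow> nat set \<Rightarrow> nat set" where
  "ext n E J = {w \<in> {0..<n}. w \<notin> J \<and> (\<forall>a\<in>J. {a,w} \<in> E)}"

definition num_arcs :: "nat set set \<Rightarrow> nat set \<Rightarrow> nat" where
  "num_arcs E A = card {(a,b). a \<in> A \<and> b \<in> A \<and> {a,b} \<in> E}"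

lemma finite_cliques: "finite (cliques n E s)"
  by (rule finite_subset[of _ "Pow {0..<n}"]) (auto simp: cliques_def)

lemma finite_ext: "finite (ext n E J)" by (simp add: ext_def)

lemma cliqueD:
  assumes "K \<in> cliques n E s"
  shows "finite K" "card K = s" "K \<subseteq> {0..<n}" "a \<in> K \<Longrightarrow> b \<in> K \<Longrightarrow> a \<noteq> b \<Longrightarrow> {a,b} \<in> E"
  using assms by (auto simp: cliques_def intro: finite_subset)

lemma clique_insert:
  assumes "J \<in> cliques n E s" "w \<in> ext n E J"
  shows "insert w J \<in> cliques n E (Suc s)"
  using assms cliqueD(1)[OF assms(1)] unfolding cliques_def ext_def
  by (auto simp: insert_commute)

lemma clique_remove:
  assumes "K \<in> cliques n E (Suc s)" "v \<in> K"
  shows "K - {v} \<in> cliques n E s" "v \<in> ext n E (K - {v})"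
  using assms cliqueD(1)[OF assms(1)] unfolding cliques_def ext_def
  by (auto simp: insert_commute)

text \<open>An (s+1)-clique with a marked vertex is the same thing as an s-clique with a vertex
  extending it. The later double counts are instances for suitable weights g.\<close>

lemma cliques_swap:
  fixes g :: "nat set \<Rightarrow> nat \<Rightarrow> real"
  shows "(\<Sum>K\<in>cliques n E (Suc s). \<Sum>v\<in>K. g (K - {v}) v) = (\<Sum>J\<in>cliques n E s. \<Sum>w\<in>ext n E J. g J w)"
proof -
  have "(\<Sum>K\<in>cliques n E (Suc s). \<Sum>v\<in>K. g (K - {v}) v) =
    (\<Sum>(K,v)\<in>Sigma (cliques n E (Suc s)) (\<lambda>K. K). g (K - {v}) v)"
    using finite_cliques cliqueD(1) by (subst sum.Sigma) auto
  also have "\<dots> = (\<Sum>(J,w)\<in>Sigma (cliques n E s) (ext n E). g J w)"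
    by (rule sum.reindex_bij_witness[where i = "\<lambda>(J,w). (insert w J, w)" and j = "\<lambda>(K,v). (K - {v}, v)"])
       (auto simp: clique_remove clique_insert insert_absorb, auto simp: ext_def)
  also have "\<dots> = (\<Sum>J\<in>cliques n E s. \<Sum>w\<in>ext n E J. g J w)"
    using finite_cliques finite_ext by (subst sum.Sigma) auto
  finally show ?thesis .
qed

lemma sum_ext: "(\<Sum>J\<in>cliques n E s. real (card (ext n E J))) = real (Suc s) * real (card (cliques n E (Suc s)))"
proof -
  have "(\<Sum>J\<in>cliques n E s. real (card (ext n E J))) = (\<Sum>K\<in>cliques n E (Suc s). \<Sum>v\<in>K. 1)"
    using cliques_swap[of "\<lambda>_ _. 1" n E s] by simp
  also have "\<dots> = (\<Sum>K\<in>cliques n E (Suc s). real (Suc s))"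
    by (intro sum.cong refl) (simp add: cliqueD(2))
  finally show ?thesis by simp
qed

text \<open>A vertex extending both K - {v} and K - {v'} for distinct v and v' lies outside K and is
  adjacent to all of K, so it extends K. Vertices that do not extend K are therefore counted at most
  once, the others at most s + 1 times.\<close>

lemma ext_multiplicity:
  assumes K: "K \<in> cliques n E (Suc s)"
  shows "card {v \<in> K. w \<in> ext n E (K - {v})}
     \<le> (if w \<in> (\<Union>v\<in>K. ext n E (K - {v})) then 1 else 0) + s * (if w \<in> ext n E K then 1 else 0)"
proof (cases "w \<in> ext n E K")
  case True
  have "K \<noteq> {}" using cliqueD(2)[OF K] by auto
  then have "w \<in> (\<Union>v\<in>K. ext n E (K - {v}))" using True by (auto simp: ext_def)
  moreover have "card {v \<in> K. w \<in> ext n E (K - {v})} \<le> card K"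
    using cliqueD(1)[OF K] by (intro card_mono) auto
  ultimately show ?thesis using True cliqueD(2)[OF K] by simp
next
  case False
  have fin: "finite {v \<in> K. w \<in> ext n E (K - {v})}" using cliqueD(1)[OF K] by simp
  have "v = v'" if "v \<in> K" "v' \<in> K" "w \<in> ext n E (K - {v})" "w \<in> ext n E (K - {v'})" for v v'
  proof (rule ccontr)
    assume "v \<noteq> v'"
    then have "w \<in> ext n E K" using that by (auto simp: ext_def)
    then show False using False by simp
  qed
  then have le1: "card {v \<in> K. w \<in> ext n E (K - {v})} \<le> 1"
    using fin by (intro card_le_Suc0_iff_eq[THEN iffD2, simplified One_nat_def[symmetric]]) auto
  show ?thesis
  proof (cases "w \<in> (\<Union>v\<in>K. ext n E (K - {v}))")
    case True then show ?thesis using le1 by simp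
  next
    case False
    then have "{v \<in> K. w \<in> ext n E (K - {v})} = {}" by auto
    then have "card {v \<in> K. w \<in> ext n E (K - {v})} = 0" by (simp only: card.empty)
    then show ?thesis by linarith
  qed
qed

lemma sum_card_ext_le:
  assumes K: "K \<in> cliques n E (Suc s)"
  shows "(\<Sum>v\<in>K. card (ext n E (K - {v}))) \<le> card (\<Union>v\<in>K. ext n E (K - {v})) + s * card (ext n E K)"
proof -
  let ?U = "\<Union>v\<in>K. ext n E (K - {v})"
  have finK: "finite K" using cliqueD(1)[OF K] .
  have sub: "ext n E J \<subseteq> {..<n}" for J by (auto simp: ext_def)
  have ind: "card A = (\<Sum>w<n. if w \<in> A then 1 else 0)" if "A \<subseteq> {..<n}" for A
  proof -
    have "{w \<in> {..<n}. w \<in> A} = A" using that by auto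
    then show ?thesis using sum.inter_filter[of "{..<n}" "\<lambda>_. 1::nat" "\<lambda>w. w \<in> A"] by simp
  qed
  have "(\<Sum>v\<in>K. card (ext n E (K - {v}))) = (\<Sum>v\<in>K. \<Sum>w<n. if w \<in> ext n E (K - {v}) then 1 else 0)"
    using ind[OF sub] by simp
  also have "\<dots> = (\<Sum>w<n. \<Sum>v\<in>K. if w \<in> ext n E (K - {v}) then 1 else 0)" by (rule sum.swap)
  also have "\<dots> = (\<Sum>w<n. card {v \<in> K. w \<in> ext n E (K - {v})})"
    using finK by (simp add: sum.inter_filter[symmetric])
  also have "\<dots> \<le> (\<Sum>w<n. (if w \<in> ?U then 1 else 0) + s * (if w \<in> ext n E K then 1 else 0))"
    by (intro sum_mono ext_multiplicity[OF K])
  also have "\<dots> = (\<Sum>w<n. if w \<in> ?U then 1 else 0) + s * (\<Sum>w<n. if w \<in> ext n E K then 1 else 0)"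
    by (simp only: sum.distrib sum_distrib_left)
  also have "\<dots> = card ?U + s * card (ext n E K)"
    using ind[of ?U] ind[OF sub, of K] sub by (simp add: UN_least)
  finally show ?thesis .
qed

text \<open>Cauchy-Schwarz for the numbers of extensions. Squaring means weighting each extension of
  J by the number of extensions of J, and \<open>cliques_swap\<close> moves this weight to the
  larger cliques.\<close>

lemma sum_ext_sq_lower:
  "(real (Suc s) * real (card (cliques n E (Suc s))))\<^sup>2
     \<le> real (card (cliques n E s)) * (\<Sum>K\<in>cliques n E (Suc s). \<Sum>v\<in>K. real (card (ext n E (K - {v}))))"
proof -
  have "(\<Sum>J\<in>cliques n E s. real (card (ext n E J)))\<^sup>2
     \<le> (\<Sum>J\<in>cliques n E s. (real (card (ext n E J)))\<^sup>2) * real (card (cliques n E s))"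
    by (rule sum_squared_le_sum_of_squares)
  also have "(\<Sum>J\<in>cliques n E s. (real (card (ext n E J)))\<^sup>2) =
    (\<Sum>K\<in>cliques n E (Suc s). \<Sum>v\<in>K. real (card (ext n E (K - {v}))))"
    using cliques_swap[of "\<lambda>J _. real (card (ext n E J))" n E s] by (simp add: power2_eq_square)
  finally show ?thesis unfolding sum_ext by (simp add: mult.commute)
qed

lemma Moon_Moser:
  "(real (Suc s) * real (card (cliques n E (Suc s))))\<^sup>2
     \<le> real (card (cliques n E s)) * (real n * real (card (cliques n E (Suc s)))
        + real s * real (Suc (Suc s)) * real (card (cliques n E (Suc (Suc s)))))"
proof -
  have "(\<Sum>v\<in>K. real (card (ext n E (K - {v})))) \<le> real n + real s * real (card (ext n E K))"
    if K: "K \<in> cliques n E (Suc s)" for K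
  proof -
    have "card (\<Union>v\<in>K. ext n E (K - {v})) \<le> card {..<n}"
      by (intro card_mono) (auto simp: ext_def)
    then have "(\<Sum>v\<in>K. card (ext n E (K - {v}))) \<le> n + s * card (ext n E K)"
      using sum_card_ext_le[OF K] by simp
    then have "real (\<Sum>v\<in>K. card (ext n E (K - {v}))) \<le> real (n + s * card (ext n E K))"
      by (rule of_nat_mono)
    then show ?thesis by simp
  qed
  then have "(\<Sum>K\<in>cliques n E (Suc s). \<Sum>v\<in>K. real (card (ext n E (K - {v}))))
     \<le> (\<Sum>K\<in>cliques n E (Suc s). real n + real s * real (card (ext n E K)))" by (rule sum_mono)
  also have "\<dots> = real n * real (card (cliques n E (Suc s))) + real s * (\<Sum>K\<in>cliques n E (Suc s). real (card (ext n E K)))"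
    by (simp add: sum.distrib sum_distrib_left mult.commute)
  also have "\<dots> = real n * real (card (cliques n E (Suc s)))
        + real s * real (Suc (Suc s)) * real (card (cliques n E (Suc (Suc s))))"
    unfolding sum_ext by simp
  finally show ?thesis using sum_ext_sq_lower[of s n E] by (meson mult_left_mono of_nat_0_le_iff order_trans)
qed

lemma card_cliques_1: "card (cliques n E (Suc 0)) = n"
proof -
  have "cliques n E (Suc 0) = (\<lambda>a. {a}) ` {0..<n}"
    unfolding cliques_def by (auto simp: card_Suc_eq)
  then show ?thesis by (simp add: card_image inj_on_def)
qed

lemma cliques_2: "E \<subseteq> pairs n \<Longrightarrow> cliques n E 2 = E"
proof
  assume E: "E \<subseteq> pairs n"
  show "cliques n E 2 \<subseteq> E" unfolding cliques_def by (auto simp: card_2_iff)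
  show "E \<subseteq> cliques n E 2"
  proof
    fix e assume e: "e \<in> E"
    then obtain a b where "e = {a,b}" "a < n" "b < n" "a \<noteq> b" using E unfolding pairs_def by blast
    then show "e \<in> cliques n E 2" using e by (auto simp: cliques_def insert_commute)
  qed
qed

text \<open>Moon-Moser solved for the next clique count: each further size costs one more d. For d =
  n/r these are the ratios of the Turan graph, so the induction loses nothing at leading order.
  \<open>pos\<close> keeps n - s d positive, so all counts stay positive and can be
  cancelled.\<close>

lemma clique_ratio:
  fixes d :: real
  assumes E: "E \<subseteq> pairs n" and n: "n > 0" and r: "r \<ge> 2" and d: "d \<ge> 0"
    and e: "2 * real (card E) \<ge> real n * (real n - d)"
    and pos: "real n - (real r - 1) * d \<ge> real n / (2 * real r)"
    and s: "1 \<le> s" "s < r"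
  shows "card (cliques n E s) > 0 \<and> card (cliques n E (Suc s)) > 0 \<and>
     (real n - real s * d) * real (card (cliques n E s)) \<le> real (Suc s) * real (card (cliques n E (Suc s)))"
  using s
proof (induction s rule: nat_induct_at_least)
  case base
  have "(real n - d) > 0"
  proof -
    have "0 < real n / (2 * real r)" using n r by simp
    moreover have "d \<le> (real r - 1) * d" using d r by (simp add: mult_le_cancel_right1)
    ultimately show ?thesis using pos by linarith
  qed
  then have "0 < real n * (real n - d)" using n by simp
  then have "0 < real (card E)" using e by linarith
  then have "card E > 0" by simp
  moreover have "cliques n E (Suc 1) = E" using cliques_2[OF E] by (simp add: numeral_2_eq_2)
  ultimately show ?case using e n card_cliques_1[of n E] by (simp add: mult.commute)
next
  case (Suc s)
  let ?k = "\<lambda>s. real (card (cliques n E s))"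
  have IH: "?k s > 0" "?k (Suc s) > 0" "(real n - real s * d) * ?k s \<le> real (Suc s) * ?k (Suc s)"
    using Suc by auto
  have s1: "real s \<ge> 1" using Suc(1) by simp
  have MM: "(real (Suc s) * ?k (Suc s))\<^sup>2 \<le> ?k s * (real n * ?k (Suc s) + real s * real (Suc (Suc s)) * ?k (Suc (Suc s)))"
    by (rule Moon_Moser)
  have "real (Suc s) * ?k (Suc s) * ((real n - real s * d) * ?k s) \<le> (real (Suc s) * ?k (Suc s))\<^sup>2"
    unfolding power2_eq_square using IH by (intro mult_left_mono) auto
  then have "?k s * (real (Suc s) * (real n - real s * d) * ?k (Suc s))
     \<le> ?k s * (real n * ?k (Suc s) + real s * real (Suc (Suc s)) * ?k (Suc (Suc s)))"
    using MM by (simp add: mult_ac)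
  then have "real (Suc s) * (real n - real s * d) * ?k (Suc s)
     \<le> real n * ?k (Suc s) + real s * real (Suc (Suc s)) * ?k (Suc (Suc s))"
    using IH(1) by (simp add: mult_le_cancel_left_pos)
  then have "real s * ((real n - real (Suc s) * d) * ?k (Suc s)) \<le> real s * (real (Suc (Suc s)) * ?k (Suc (Suc s)))"
    by (simp add: algebra_simps)
  then have main: "(real n - real (Suc s) * d) * ?k (Suc s) \<le> real (Suc (Suc s)) * ?k (Suc (Suc s))"
    using s1 by (simp add: mult_le_cancel_left_pos)
  have "real n - real (Suc s) * d > 0"
  proof -
    have "0 < real n / (2 * real r)" using n r by simp
    moreover have "real (Suc s) * d \<le> (real r - 1) * d" using d Suc(3) by (intro mult_right_mono) auto
    ultimately show ?thesis using pos by linarith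
  qed
  then have "0 < real (Suc (Suc s)) * ?k (Suc (Suc s))" using main IH(2) by (meson less_le_trans mult_pos_pos)
  then have "?k (Suc (Suc s)) > 0" by (simp add: zero_less_mult_iff)
  then show ?case using main IH(2) by simp
qed

text \<open>Each step multiplies the count by at least (n / (2r)) / r, using n - s d \<ge> n / (2r)
  and s + 1 \<le> r.\<close>

lemma clique_count:
  fixes d :: real
  assumes E: "E \<subseteq> pairs n" and n: "n > 0" and r: "r \<ge> 2" and d: "d \<ge> 0"
    and e: "2 * real (card E) \<ge> real n * (real n - d)"
    and pos: "real n - (real r - 1) * d \<ge> real n / (2 * real r)"
    and s: "1 \<le> s" "s \<le> r"
  shows "(real n / (2 * real r ^ 2)) ^ s \<le> real (card (cliques n E s))"
  using s
proof (induction s rule: nat_induct_at_least)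
  case base
  have "real n / (2 * real r ^ 2) \<le> real n / 1"
  proof (rule divide_left_mono)
    have "1 \<le> (real r)\<^sup>2" using r by simp
    then show "1 \<le> 2 * (real r)\<^sup>2" by linarith
  qed (use r in auto)
  then show ?case by (simp add: card_cliques_1)
next
  case (Suc s)
  let ?k = "\<lambda>s. real (card (cliques n E s))"
  have IH: "(real n / (2 * real r ^ 2)) ^ s \<le> ?k s" using Suc by simp
  have cr: "(real n - real s * d) * ?k s \<le> real (Suc s) * ?k (Suc s)"
    using clique_ratio[OF E n r d e pos, of s] Suc by simp
  have "real s * d \<le> (real r - 1) * d" using d Suc(3) by (intro mult_right_mono) auto
  then have "real n / (2 * real r) \<le> real n - real s * d" using pos by linarith
  then have "real n / (2 * real r) * ?k s \<le> real (Suc s) * ?k (Suc s)"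
    using cr by (meson mult_right_mono of_nat_0_le_iff order_trans)
  also have "\<dots> \<le> real r * ?k (Suc s)" using Suc(3) by (intro mult_right_mono) auto
  finally have "real n / (2 * real r ^ 2) * ?k s \<le> ?k (Suc s)"
    using r by (simp add: field_simps power2_eq_square)
  moreover have "real n / (2 * real r ^ 2) * (real n / (2 * real r ^ 2)) ^ s \<le> real n / (2 * real r ^ 2) * ?k s"
    using IH by (intro mult_left_mono) auto
  ultimately show ?case by simp
qed

text \<open>An ordered edge inside the common neighbourhood of an s-clique extends it to an
  (s+2)-clique. For s = r - 1 this is how a shortage of (r+1)-cliques makes common neighbourhoods
  almost independent.\<close>

lemma sum_arcs_ext:
  assumes E: "E \<subseteq> pairs n"
  shows "(\<Sum>J\<in>cliques n E s. real (num_arcs E (ext n E J)))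
     = real (Suc s) * (real (Suc (Suc s)) * real (card (cliques n E (Suc (Suc s)))))"
proof -
  have arcs: "real (num_arcs E (ext n E J)) = (\<Sum>w\<in>ext n E J. real (card (ext n E (insert w J))))" for J
  proof -
    have nl: "{a,a} \<notin> E" for a using E pairs_iff[of a a n] by auto
    have "{(a,b). a \<in> ext n E J \<and> b \<in> ext n E J \<and> {a,b} \<in> E} = Sigma (ext n E J) (\<lambda>w. ext n E (insert w J))"
      using nl by (auto simp: ext_def)
    then show ?thesis using finite_ext by (simp add: num_arcs_def card_SigmaI)
  qed
  have "(\<Sum>J\<in>cliques n E s. real (num_arcs E (ext n E J))) =
    (\<Sum>J\<in>cliques n E s. \<Sum>w\<in>ext n E J. real (card (ext n E (insert w J))))" by (simp only: arcs)
  also have "\<dots> = (\<Sum>K\<in>cliques n E (Suc s). \<Sum>v\<in>K. real (card (ext n E (insert v (K - {v})))))"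
    by (rule cliques_swap[symmetric])
  also have "\<dots> = (\<Sum>K\<in>cliques n E (Suc s). real (Suc s) * real (card (ext n E K)))"
  proof (rule sum.cong[OF refl])
    fix K assume K: "K \<in> cliques n E (Suc s)"
    have "(\<Sum>v\<in>K. real (card (ext n E (insert v (K - {v}))))) = (\<Sum>v\<in>K. real (card (ext n E K)))"
      by (intro sum.cong refl) (simp add: insert_absorb)
    then show "(\<Sum>v\<in>K. real (card (ext n E (insert v (K - {v}))))) = real (Suc s) * real (card (ext n E K))"
      using cliqueD(2)[OF K] by simp
  qed
  also have "\<dots> = real (Suc s) * (\<Sum>K\<in>cliques n E (Suc s). real (card (ext n E K)))"
    by (simp only: sum_distrib_left)
  finally show ?thesis unfolding sum_ext .
qed

text \<open>Bounds the ordered edges inside parts when the sets \<open>ext n E (K - {v})\<close>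
  become the parts: an uncovered vertex is charged 2n, an upper bound for its arcs in both
  directions.\<close>

definition part_cost :: "nat \<Rightarrow> nat set set \<Rightarrow> nat set \<Rightarrow> real" where
  "part_cost n E K = 2 * real n * (real n - real (card (\<Union>v\<in>K. ext n E (K - {v}))))
     + (\<Sum>v\<in>K. real (num_arcs E (ext n E (K - {v}))))"

text \<open>By Cauchy-Schwarz the r common neighbourhoods have total size at least r (n - (r-1) d)
  on average over the r-cliques, which is n when d = n/r. Their overlaps and their inner edges are
  both paid for by (r+1)-cliques; 3r(r+1) bounds the factor (2(r-1) + r)(r+1) that results.\<close>

lemma sum_part_cost:
  fixes d :: real
  assumes E: "E \<subseteq> pairs n" and n: "n > 0" and r: "r \<ge> 2" and d: "d \<ge> 0"
    and e: "2 * real (card E) \<ge> real n * (real n - d)"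
    and pos: "real n - (real r - 1) * d \<ge> real n / (2 * real r)"
  shows "(\<Sum>K\<in>cliques n E r. part_cost n E K) \<le>
     real (card (cliques n E r)) * (2 * real n * (real r - 1) * (real r * d - real n))
     + real n * (3 * real r * (real r + 1)) * real (card (cliques n E (Suc r)))"
proof -
  define s where "s = r - 1"
  have rs: "r = Suc s" and s1: "1 \<le> s" "s < r" using r by (auto simp: s_def)
  let ?k = "\<lambda>s. real (card (cliques n E s))"
  let ?X = "\<Sum>K\<in>cliques n E r. \<Sum>v\<in>K. real (card (ext n E (K - {v})))"
  have cr: "?k s > 0" "?k r > 0" "(real n - real s * d) * ?k s \<le> real r * ?k r"
    using clique_ratio[OF E n r d e pos s1] rs by auto
  have "(real r * ?k r) * ((real n - real s * d) * ?k s) \<le> (real r * ?k r)\<^sup>2"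
    unfolding power2_eq_square using cr by (intro mult_left_mono) auto
  also have "\<dots> \<le> ?k s * ?X" using sum_ext_sq_lower[of s n E] unfolding rs .
  finally have "?k s * (real r * ?k r * (real n - real s * d)) \<le> ?k s * ?X" by (simp add: mult_ac)
  then have X: "real r * ?k r * (real n - real s * d) \<le> ?X" using cr(1) by (simp add: mult_le_cancel_left_pos)
  have U: "real n - real (card (\<Union>v\<in>K. ext n E (K - {v})))
     \<le> real n - (\<Sum>v\<in>K. real (card (ext n E (K - {v})))) + real s * real (card (ext n E K))"
    if K: "K \<in> cliques n E r" for K
  proof -
    have "real (\<Sum>v\<in>K. card (ext n E (K - {v}))) \<le> real (card (\<Union>v\<in>K. ext n E (K - {v})) + s * card (ext n E K))"
      using sum_card_ext_le[of K n E s] K rs by (intro of_nat_mono) simp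
    then show ?thesis by simp
  qed
  have A: "(\<Sum>K\<in>cliques n E r. \<Sum>v\<in>K. real (num_arcs E (ext n E (K - {v})))) \<le> real n * (real r * (real (Suc r) * ?k (Suc r)))"
  proof -
    have "(\<Sum>K\<in>cliques n E r. \<Sum>v\<in>K. real (num_arcs E (ext n E (K - {v})))) =
      (\<Sum>J\<in>cliques n E s. \<Sum>w\<in>ext n E J. real (num_arcs E (ext n E J)))"
      unfolding rs by (rule cliques_swap)
    also have "\<dots> \<le> (\<Sum>J\<in>cliques n E s. real n * real (num_arcs E (ext n E J)))"
    proof (rule sum_mono)
      fix J
      \<comment> \<open>An (r-1)-clique lies in at most n cliques of size r, so its inner arcs are
        charged at most n times.\<close>
      have "card (ext n E J) \<le> card {0..<n}" by (intro card_mono) (auto simp: ext_def)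
      then show "(\<Sum>w\<in>ext n E J. real (num_arcs E (ext n E J))) \<le> real n * real (num_arcs E (ext n E J))"
        by (simp add: mult_right_mono)
    qed
    also have "\<dots> = real n * (\<Sum>J\<in>cliques n E s. real (num_arcs E (ext n E J)))" by (simp only: sum_distrib_left)
    finally show ?thesis unfolding sum_arcs_ext[OF E] rs .
  qed
  have "(\<Sum>K\<in>cliques n E r. part_cost n E K) \<le> (\<Sum>K\<in>cliques n E r. 2 * real n *
      (real n - (\<Sum>v\<in>K. real (card (ext n E (K - {v})))) + real s * real (card (ext n E K)))
       + (\<Sum>v\<in>K. real (num_arcs E (ext n E (K - {v})))))"
    unfolding part_cost_def by (intro sum_mono add_right_mono mult_left_mono U) auto
  also have "\<dots> = 2 * real n * (real n * ?k r - ?X + real s * (\<Sum>K\<in>cliques n E r. real (card (ext n E K))))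
     + (\<Sum>K\<in>cliques n E r. \<Sum>v\<in>K. real (num_arcs E (ext n E (K - {v}))))"
    by (simp add: sum.distrib sum_subtractf sum_distrib_left[symmetric])
  also have "\<dots> \<le> 2 * real n * (real n * ?k r - real r * ?k r * (real n - real s * d) + real s * (real (Suc r) * ?k (Suc r)))
     + real n * (real r * (real (Suc r) * ?k (Suc r)))"
    unfolding sum_ext by (intro add_mono mult_left_mono A diff_mono X) auto
  also have "\<dots> = ?k r * (2 * real n * (real n - real r * (real n - real s * d)))
     + real n * ((2 * real s + real r) * real (Suc r)) * ?k (Suc r)"
    by (simp add: algebra_simps)
  also have "\<dots> \<le> ?k r * (2 * real n * (real n - real r * (real n - real s * d)))
     + real n * (3 * real r * (real r + 1)) * ?k (Suc r)"
    using rs by (intro add_left_mono mult_right_mono mult_left_mono mult_mono) auto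
  also have "real n - real r * (real n - real s * d) = (real r - 1) * (real r * d - real n)"
    using rs by (simp add: algebra_simps)
  finally show ?thesis by (simp add: mult.assoc)
qed

lemma clique_partition:
  assumes E: "E \<subseteq> pairs n" and K: "K \<in> cliques n E r" and r: "r > 0"
  obtains \<pi> where "\<And>z. \<pi> z < r" "real (card {(a,b). \<pi> a = \<pi> b \<and> {a,b} \<in> E}) \<le> part_cost n E K"
proof -
  let ?A = "\<lambda>v. ext n E (K - {v})"
  let ?U = "\<Union>v\<in>K. ?A v"
  obtain h where h: "bij_betw h {0..<r} K"
    using ex_bij_betw_nat_finite[OF cliqueD(1)[OF K]] cliqueD(2)[OF K] by auto
  \<comment> \<open>A vertex in several of the sets picks one of them, an uncovered vertex goes to
    part 0. Numbers from n on are uncovered as well, which keeps \<open>\<pi>\<close> below r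
    everywhere.\<close>
  define \<pi> where "\<pi> = (\<lambda>z. if z \<in> ?U then (SOME i. i < r \<and> z \<in> ?A (h i)) else 0)"
  have ex: "\<exists>i. i < r \<and> z \<in> ?A (h i)" if zU: "z \<in> ?U" for z
  proof -
    obtain v where v: "v \<in> K" "z \<in> ?A v" using zU by blast
    then have "v \<in> h ` {0..<r}" using h by (simp add: bij_betw_def)
    then show ?thesis using v by auto
  qed
  have pi: "\<pi> z < r \<and> z \<in> ?A (h (\<pi> z))" if "z \<in> ?U" for z
    using someI_ex[OF ex[OF that]] that by (simp add: \<pi>_def)
  have lt: "\<pi> z < r" for z using pi[of z] r by (cases "z \<in> ?U") (auto simp: \<pi>_def)
  let ?W = "{0..<n} - ?U"
  let ?arc = "\<lambda>A. {(a,b). a \<in> A \<and> b \<in> A \<and> {a,b} \<in> E}"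
  have finarc: "finite (?arc (?A v))" for v
    by (rule finite_subset[of _ "?A v \<times> ?A v"]) (auto simp: finite_ext)
  have sub: "{(a,b). \<pi> a = \<pi> b \<and> {a,b} \<in> E} \<subseteq> (?W \<times> {0..<n} \<union> {0..<n} \<times> ?W) \<union> (\<Union>v\<in>K. ?arc (?A v))"
  proof (rule subrelI)
    fix a b assume "(a,b) \<in> {(a,b). \<pi> a = \<pi> b \<and> {a,b} \<in> E}"
    then have ab: "\<pi> a = \<pi> b" "{a,b} \<in> E" by auto
    then have lt: "a < n" "b < n" using E pairs_iff by blast+
    show "(a,b) \<in> (?W \<times> {0..<n} \<union> {0..<n} \<times> ?W) \<union> (\<Union>v\<in>K. ?arc (?A v))"
    proof (cases "a \<in> ?U \<and> b \<in> ?U")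
      case True
      then have "a \<in> ?A (h (\<pi> a))" "b \<in> ?A (h (\<pi> a))" "h (\<pi> a) \<in> K"
        using pi[of a] pi[of b] ab h by (auto simp: bij_betw_def)
      then show ?thesis using ab(2) by blast
    next
      case False then show ?thesis using lt by auto
    qed
  qed
  have Usub: "?U \<subseteq> {0..<n}" by (auto simp: ext_def)
  have finU: "finite ?U" by (rule finite_subset[OF Usub]) simp
  have cW: "card ?W = n - card ?U" using card_Diff_subset[OF finU Usub] by simp
  have Un: "card ?U \<le> n" using card_mono[OF _ Usub] by simp
  have "card {(a,b). \<pi> a = \<pi> b \<and> {a,b} \<in> E} \<le> card ((?W \<times> {0..<n} \<union> {0..<n} \<times> ?W) \<union> (\<Union>v\<in>K. ?arc (?A v)))"
    using cliqueD(1)[OF K] finarc by (intro card_mono sub) auto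
  also have "\<dots> \<le> card (?W \<times> {0..<n}) + card ({0..<n} \<times> ?W) + card (\<Union>v\<in>K. ?arc (?A v))"
    by (meson add_le_mono card_Un_le order_trans order_refl)
  also have "\<dots> \<le> card ?W * n + n * card ?W + (\<Sum>v\<in>K. card (?arc (?A v)))"
    using card_UN_le[OF cliqueD(1)[OF K], of "\<lambda>v. ?arc (?A v)"] by (simp add: card_cartesian_product)
  finally have "card {(a,b). \<pi> a = \<pi> b \<and> {a,b} \<in> E} \<le> 2 * n * (n - card ?U) + (\<Sum>v\<in>K. num_arcs E (?A v))"
    unfolding cW num_arcs_def by (simp add: algebra_simps)
  then have "real (card {(a,b). \<pi> a = \<pi> b \<and> {a,b} \<in> E}) \<le> real (2 * n * (n - card ?U) + (\<Sum>v\<in>K. num_arcs E (?A v)))"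
    by (rule of_nat_mono)
  also have "\<dots> = part_cost n E K" using Un by (simp add: part_cost_def of_nat_diff)
  finally show ?thesis using that lt by blast
qed

lemma few_cliques_partition:
  fixes d :: real
  assumes E: "E \<subseteq> pairs n" and n: "n > 0" and r: "r \<ge> 2" and d: "d \<ge> 0"
    and e: "2 * real (card E) \<ge> real n * (real n - d)"
    and pos: "real n - (real r - 1) * d \<ge> real n / (2 * real r)"
  obtains \<pi> where "\<And>z. \<pi> z < r"
    "real (card {(a,b). \<pi> a = \<pi> b \<and> {a,b} \<in> E}) \<le> 2 * real n * (real r - 1) * (real r * d - real n)
      + real n * (3 * real r * (real r + 1)) * (real (card (cliques n E (Suc r))) / real (card (cliques n E r)))"
proof -
  let ?C = "cliques n E r" and ?b = "2 * real n * (real r - 1) * (real r * d - real n)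
      + real n * (3 * real r * (real r + 1)) * (real (card (cliques n E (Suc r))) / real (card (cliques n E r)))"
  have "(real n / (2 * real r ^ 2)) ^ r \<le> real (card ?C)"
    using r by (intro clique_count[OF E n r d e pos]) auto
  moreover have "0 < (real n / (2 * real r ^ 2)) ^ r" using n r by simp
  ultimately have k: "real (card ?C) > 0" by linarith
  have "\<exists>K\<in>?C. part_cost n E K \<le> ?b"
  proof (rule ccontr)
    assume "\<not> (\<exists>K\<in>?C. part_cost n E K \<le> ?b)"
    then have "(\<Sum>K\<in>?C. ?b) < (\<Sum>K\<in>?C. part_cost n E K)"
      using k finite_cliques by (intro sum_strict_mono) (auto simp: not_le)
    moreover have "(\<Sum>K\<in>?C. ?b) = real (card ?C) * (2 * real n * (real r - 1) * (real r * d - real n))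
     + real n * (3 * real r * (real r + 1)) * real (card (cliques n E (Suc r)))"
      using k by (simp add: distrib_left)
    ultimately show False using sum_part_cost[OF E n r d e pos] by linarith
  qed
  then obtain K where K: "K \<in> ?C" "part_cost n E K \<le> ?b" by blast
  obtain \<pi> where "\<And>z. \<pi> z < r" "real (card {(a,b). \<pi> a = \<pi> b \<and> {a,b} \<in> E}) \<le> part_cost n E K"
    by (rule clique_partition[OF E K(1)]) (use r in auto)
  then show ?thesis using that K(2) order_trans by blast
qed

section \<open>Duplicating vertices of complete multipartite patterns\<close>

definition homs :: "nat \<Rightarrow> nat set set \<Rightarrow> nat set \<Rightarrow> (nat \<Rightarrow> nat) \<Rightarrow> (nat \<Rightarrow> nat) set" where
  "homs n E I \<kappa> = {\<psi> \<in> I \<rightarrow>\<^sub>E {0..<n}. \<forall>a\<in>I. \<forall>b\<in>I. \<kappa> a \<noteq> \<kappa> b \<longrightarrow> {\<psi> a, \<psi> b} \<in> E}"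

lemma finite_homs: "finite I \<Longrightarrow> finite (homs n E I \<kappa>)"
  unfolding homs_def by (simp add: finite_PiE)

text \<open>Two vertices of the same class impose no edge on each other, so once the other images
  are fixed the twin i' may be chosen independently of i from the same set \<open>D \<rho>\<close>.
  Cauchy-Schwarz over the n^(|I|-1) choices for the others gives the square.\<close>

lemma homs_duplicate:
  assumes I: "finite I" "i \<in> I" "i' \<notin> I" "\<kappa> i' = \<kappa> i"
  shows "(real (card (homs n E I \<kappa>)))\<^sup>2 \<le> real (card (homs n E (insert i' I) \<kappa>)) * real n ^ (card I - 1)"
proof -
  define P where "P = PiE (I - {i}) (\<lambda>_. {0..<n})"
  define D where "D = (\<lambda>\<rho>. {z \<in> {0..<n}. \<rho>(i := z) \<in> homs n E I \<kappa>})"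
  have finP: "finite P" using I by (simp add: P_def finite_PiE)
  have finD: "finite (D \<rho>)" for \<rho> by (simp add: D_def)
  have cP: "card P = n ^ (card I - 1)" using I by (simp add: P_def card_PiE)
  have "card (homs n E I \<kappa>) \<le> card (Sigma P D)"
  proof (rule card_inj_on_le[where f = "\<lambda>\<psi>. (restrict \<psi> (I - {i}), \<psi> i)"])
    show "inj_on (\<lambda>\<psi>. (restrict \<psi> (I - {i}), \<psi> i)) (homs n E I \<kappa>)"
    proof (rule inj_onI)
      fix a b assume ab: "a \<in> homs n E I \<kappa>" "b \<in> homs n E I \<kappa>" "(restrict a (I - {i}), a i) = (restrict b (I - {i}), b i)"
      have rs: "restrict a (I - {i}) = restrict b (I - {i})" "a i = b i" using ab(3) by auto
      have "a w = b w" if "w \<in> I" for w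
        using fun_cong[OF rs(1), of w] rs(2) that by (cases "w = i") auto
      moreover have "a \<in> I \<rightarrow>\<^sub>E {0..<n}" "b \<in> I \<rightarrow>\<^sub>E {0..<n}" using ab by (auto simp: homs_def)
      ultimately show "a = b" by (meson PiE_ext)
    qed
    show "(\<lambda>\<psi>. (restrict \<psi> (I - {i}), \<psi> i)) ` homs n E I \<kappa> \<subseteq> Sigma P D"
    proof (rule image_subsetI)
      fix \<psi> assume h: "\<psi> \<in> homs n E I \<kappa>"
      then have P: "\<psi> \<in> I \<rightarrow>\<^sub>E {0..<n}" by (simp add: homs_def)
      have "(restrict \<psi> (I - {i}))(i := \<psi> i) = \<psi>"
      proof
        fix x show "((restrict \<psi> (I - {i}))(i := \<psi> i)) x = \<psi> x"
          using PiE_arb[OF P, of x] by auto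
      qed
      then show "(restrict \<psi> (I - {i}), \<psi> i) \<in> Sigma P D"
        using h PiE_mem[OF P] I by (auto simp: P_def D_def)
    qed
    show "finite (Sigma P D)" using finP finD by blast
  qed
  then have h1: "real (card (homs n E I \<kappa>)) \<le> (\<Sum>\<rho>\<in>P. real (card (D \<rho>)))"
    using finP finD by (simp add: card_SigmaI flip: of_nat_sum)
  have "card (Sigma P (\<lambda>\<rho>. D \<rho> \<times> D \<rho>)) \<le> card (homs n E (insert i' I) \<kappa>)"
  proof (rule card_inj_on_le[where f = "\<lambda>(\<rho>,z,z'). \<rho>(i := z, i' := z')"])
    have ii: "i \<noteq> i'" using I by auto
    show "inj_on (\<lambda>(\<rho>,z,z'). \<rho>(i := z, i' := z')) (Sigma P (\<lambda>\<rho>. D \<rho> \<times> D \<rho>))"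
    proof (rule inj_onI)
      fix p q assume pq: "p \<in> Sigma P (\<lambda>\<rho>. D \<rho> \<times> D \<rho>)" "q \<in> Sigma P (\<lambda>\<rho>. D \<rho> \<times> D \<rho>)"
        "(\<lambda>(\<rho>,z,z'). \<rho>(i := z, i' := z')) p = (\<lambda>(\<rho>,z,z'). \<rho>(i := z, i' := z')) q"
      obtain \<rho> z z' where p: "p = (\<rho>,z,z')" by (metis prod.exhaust)
      obtain \<sigma> y y' where q: "q = (\<sigma>,y,y')" by (metis prod.exhaust)
      have eq: "\<rho>(i := z, i' := z') = \<sigma>(i := y, i' := y')" using pq(3) p q by simp
      have "z = y" "z' = y'" using fun_cong[OF eq, of i] fun_cong[OF eq, of i'] ii by auto
      moreover have "\<rho> = \<sigma>"
      proof (rule PiE_ext[of \<rho> "I - {i}" "\<lambda>_. {0..<n}" \<sigma>])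
        show "\<rho> \<in> I - {i} \<rightarrow>\<^sub>E {0..<n}" "\<sigma> \<in> I - {i} \<rightarrow>\<^sub>E {0..<n}" using pq p q by (auto simp: P_def)
        fix x assume "x \<in> I - {i}"
        then show "\<rho> x = \<sigma> x" using fun_cong[OF eq, of x] I(3) by (auto split: if_splits)
      qed
      ultimately show "p = q" using p q by simp
    qed
    show "(\<lambda>(\<rho>,z,z'). \<rho>(i := z, i' := z')) ` Sigma P (\<lambda>\<rho>. D \<rho> \<times> D \<rho>) \<subseteq> homs n E (insert i' I) \<kappa>"
    proof (rule image_subsetI)
      fix p assume "p \<in> Sigma P (\<lambda>\<rho>. D \<rho> \<times> D \<rho>)"
      then obtain \<rho> z z' where p: "p = (\<rho>,z,z')" "\<rho> \<in> P" "z \<in> D \<rho>" "z' \<in> D \<rho>" by auto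
      have z: "z < n" "\<rho>(i := z) \<in> homs n E I \<kappa>" and z': "z' < n" "\<rho>(i := z') \<in> homs n E I \<kappa>"
        using p by (auto simp: D_def)
      let ?f = "\<rho>(i := z, i' := z')"
      have Pr: "\<rho> \<in> I - {i} \<rightarrow>\<^sub>E {0..<n}" using p(2) by (simp add: P_def)
      have fm: "?f \<in> insert i' I \<rightarrow>\<^sub>E {0..<n}"
      proof (rule PiE_I)
        fix x assume "x \<in> insert i' I"
        then show "?f x \<in> {0..<n}" using PiE_mem[OF Pr, of x] z(1) z'(1) by auto
      next
        fix x assume "x \<notin> insert i' I"
        then show "?f x = undefined" using PiE_arb[OF Pr, of x] I(2) by auto
      qed
      have e1: "{(\<rho>(i := z)) a, (\<rho>(i := z)) b} \<in> E" if "a \<in> I" "b \<in> I" "\<kappa> a \<noteq> \<kappa> b" for a b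
        using z(2) that unfolding homs_def by blast
      have e2: "{(\<rho>(i := z')) a, (\<rho>(i := z')) b} \<in> E" if "a \<in> I" "b \<in> I" "\<kappa> a \<noteq> \<kappa> b" for a b
        using z'(2) that unfolding homs_def by blast
      have new: "{?f a, ?f i'} \<in> E" if "a \<in> I" "\<kappa> a \<noteq> \<kappa> i'" for a
      proof -
        have "a \<noteq> i" "a \<noteq> i'" using that I by auto
        then show ?thesis using e2[of a i] that I by simp
      qed
      have "{?f a, ?f b} \<in> E" if ab: "a \<in> insert i' I" "b \<in> insert i' I" "\<kappa> a \<noteq> \<kappa> b" for a b
      proof -
        consider "a = i'" "b \<in> I" | "b = i'" "a \<in> I" | "a \<in> I" "b \<in> I" using ab by auto
        then show ?thesis
        proof cases
          case 1 then show ?thesis using new[of b] ab(3) by (simp add: insert_commute)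
        next
          case 2 then show ?thesis using new[of a] ab(3) by simp
        next
          case 3
          then have "a \<noteq> i'" "b \<noteq> i'" using I(3) by auto
          then show ?thesis using e1[of a b] 3 ab(3) by simp
        qed
      qed
      then show "(\<lambda>(\<rho>,z,z'). \<rho>(i := z, i' := z')) p \<in> homs n E (insert i' I) \<kappa>"
        using fm p(1) by (simp only: homs_def mem_Collect_eq prod.case) blast
    qed
    show "finite (homs n E (insert i' I) \<kappa>)" using I by (intro finite_homs) simp
  qed
  then have h2: "(\<Sum>\<rho>\<in>P. (real (card (D \<rho>)))\<^sup>2) \<le> real (card (homs n E (insert i' I) \<kappa>))"
    using finP finD by (simp add: card_SigmaI card_cartesian_product power2_eq_square flip: of_nat_sum of_nat_mult)
  have "(real (card (homs n E I \<kappa>)))\<^sup>2 \<le> (\<Sum>\<rho>\<in>P. real (card (D \<rho>)))\<^sup>2"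
    using h1 by (intro power_mono) auto
  also have "\<dots> \<le> (\<Sum>\<rho>\<in>P. (real (card (D \<rho>)))\<^sup>2) * real (card P)"
    by (rule sum_squared_le_sum_of_squares)
  also have "\<dots> \<le> real (card (homs n E (insert i' I) \<kappa>)) * real (card P)"
    using h2 by (intro mult_right_mono) auto
  finally show ?thesis using cP by simp
qed

text \<open>Every duplication squares the density \<delta>, so |J| of them give the exponent
  2^|J|.\<close>

lemma homs_blowup:
  assumes J: "finite J" and I: "finite I" "J \<inter> I = {}" "\<kappa> ` J \<subseteq> \<kappa> ` I" "I \<noteq> {}"
    and n: "n > 0" and h: "\<delta> * real n ^ card I \<le> real (card (homs n E I \<kappa>))" "\<delta> \<ge> 0"
  shows "\<delta> ^ (2 ^ card J) * real n ^ (card I + card J) \<le> real (card (homs n E (I \<union> J) \<kappa>))"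
  using J I
proof (induction J rule: finite_induct)
  case empty then show ?case using h by simp
next
  case (insert j J)
  let ?I = "I \<union> J" and ?D = "\<delta> ^ (2 ^ card J)"
  have IH: "?D * real n ^ (card I + card J) \<le> real (card (homs n E ?I \<kappa>))"
    using insert by simp
  obtain i where i: "i \<in> I" "\<kappa> j = \<kappa> i" using insert.prems by auto
  have c: "card ?I = card I + card J" using insert by (intro card_Un_disjoint) auto
  have c1: "card I > 0" using insert.prems by (simp add: card_gt_0_iff)
  have dup: "(real (card (homs n E ?I \<kappa>)))\<^sup>2 \<le> real (card (homs n E (insert j ?I) \<kappa>)) * real n ^ (card ?I - 1)"
    using insert i by (intro homs_duplicate[of _ i]) auto
  have "(?D * real n ^ (card I + card J))\<^sup>2 \<le> (real (card (homs n E ?I \<kappa>)))\<^sup>2"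
    using IH h(2) by (intro power_mono) auto
  then have "(?D * real n ^ (card I + card J))\<^sup>2 \<le> real (card (homs n E (insert j ?I) \<kappa>)) * real n ^ (card ?I - 1)"
    using dup by linarith
  moreover have "(?D * real n ^ (card I + card J))\<^sup>2 = (?D ^ 2 * real n ^ (card I + card J + 1)) * real n ^ (card ?I - 1)"
  proof -
    have "(card I + card J) * 2 = (card I + card J + 1) + (card ?I - 1)" using c c1 by simp
    then have "real n ^ ((card I + card J) * 2) = real n ^ (card I + card J + 1) * real n ^ (card ?I - 1)"
      by (simp only: power_add[symmetric])
    then show ?thesis by (simp only: power_mult_distrib power_mult[symmetric, of "real n"] mult.assoc)
  qed
  ultimately have "?D ^ 2 * real n ^ (card I + card J + 1) \<le> real (card (homs n E (insert j ?I) \<kappa>))"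
    using n by (simp add: mult_le_cancel_right_pos)
  moreover have "?D ^ 2 = \<delta> ^ (2 ^ card (insert j J))"
    using insert by (simp add: power_mult[symmetric] mult.commute)
  ultimately show ?case using insert by simp
qed

lemma card_cliques_le_homs:
  assumes I: "finite I" "inj_on \<kappa> I"
  shows "card (cliques n E (card I)) \<le> card (homs n E I \<kappa>)"
proof -
  define b :: "nat set \<Rightarrow> nat \<Rightarrow> nat" where "b = (\<lambda>K. SOME h. bij_betw h I K)"
  have b: "bij_betw (b K) I K" if K: "K \<in> cliques n E (card I)" for K
  proof -
    have "\<exists>h. bij_betw h I K" using finite_same_card_bij[OF I(1) cliqueD(1)[OF K]] cliqueD(2)[OF K] by simp
    then show ?thesis unfolding b_def by (rule someI_ex)
  qed
  show ?thesis
  proof (rule card_inj_on_le[where f = "\<lambda>K. restrict (b K) I"])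
    show "inj_on (\<lambda>K. restrict (b K) I) (cliques n E (card I))"
    proof (rule inj_onI)
      fix K K' assume K: "K \<in> cliques n E (card I)" "K' \<in> cliques n E (card I)" "restrict (b K) I = restrict (b K') I"
      have "K = b K ` I" "K' = b K' ` I" using b K by (auto simp: bij_betw_def)
      moreover have "b K ` I = b K' ` I"
        using K(3) by (metis image_restrict_eq)
      ultimately show "K = K'" by simp
    qed
    show "(\<lambda>K. restrict (b K) I) ` cliques n E (card I) \<subseteq> homs n E I \<kappa>"
    proof (rule image_subsetI)
      fix K assume K: "K \<in> cliques n E (card I)"
      have m: "b K a \<in> K" if "a \<in> I" for a using b[OF K] that by (auto simp: bij_betw_def)
      have "{b K a, b K c} \<in> E" if "a \<in> I" "c \<in> I" "\<kappa> a \<noteq> \<kappa> c" for a c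
      proof -
        have "a \<noteq> c" using that by auto
        then have "b K a \<noteq> b K c" using b[OF K] that unfolding bij_betw_def by (meson inj_onD)
        then show ?thesis using cliqueD(4)[OF K] m that by blast
      qed
      then show "restrict (b K) I \<in> homs n E I \<kappa>" using m cliqueD(3)[OF K] by (auto simp: homs_def)
    qed
  qed (use I in \<open>simp add: finite_homs\<close>)
qed

context critical
begin

text \<open>A proper (r+1)-colouring makes F a subgraph of the complete multipartite pattern on its
  colour classes, which is a blow-up of the (r+1)-clique on a transversal. At most f^2 n^(f-1) maps
  fail to be injective and are subtracted.\<close>

lemma cliques_give_emb:
  assumes n: "n > 0" and k: "\<delta> * real n ^ (r + 1) \<le> real (card (cliques n E (r + 1)))" "\<delta> \<ge> 0"
  shows "\<delta> ^ (2 ^ (f - (r + 1))) * real n ^ f - real f ^ 2 * real n ^ (f - 1) \<le> real (card (emb VF EF n E))"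
proof -
  obtain \<kappa> where \<kappa>: "\<forall>v\<in>VF. \<kappa> v < r + 1" "\<forall>u\<in>VF. \<forall>v\<in>VF. {u,v} \<in> EF \<longrightarrow> \<kappa> u \<noteq> \<kappa> v"
    using colorable_Suc_r unfolding colorable_def by blast
  \<comment> \<open>With a colour missing, the remaining ones could be renumbered below r and F
    would be r-colourable. So a transversal has exactly r + 1 vertices.\<close>
  have surj: "\<kappa> ` VF = {..<r+1}"
  proof (rule ccontr)
    assume ne: "\<kappa> ` VF \<noteq> {..<r+1}"
    have "\<kappa> ` VF \<subseteq> {..<r+1}" using \<kappa>(1) by auto
    then have "card (\<kappa> ` VF) < card {..<r+1}" using ne by (intro psubset_card_mono) auto
    then have cl: "card (\<kappa> ` VF) \<le> r" by simp
    obtain g where g: "bij_betw g (\<kappa> ` VF) {0..<card (\<kappa> ` VF)}"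
      using ex_bij_betw_finite_nat[of "\<kappa> ` VF"] finV by auto
    have "g (\<kappa> v) < r" if "v \<in> VF" for v
    proof -
      have "g (\<kappa> v) \<in> {0..<card (\<kappa> ` VF)}" using g that unfolding bij_betw_def by blast
      then show ?thesis using cl by simp
    qed
    then obtain u v where uv: "{u,v} \<in> EF" "g (\<kappa> u) = g (\<kappa> v)" using mono_edge_exists[of "\<lambda>v. g (\<kappa> v)"] by blast
    then have "\<kappa> u = \<kappa> v" using g edge_mem[OF uv(1)] unfolding bij_betw_def by (meson imageI inj_onD)
    then show False using \<kappa>(2) uv(1) edge_mem[OF uv(1)] by blast
  qed
  obtain I where I: "I \<subseteq> VF" "inj_on \<kappa> I" "\<kappa> ` I = \<kappa> ` VF"
    by (metis (no_types, opaque_lifting) subset_image_inj order_refl)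
  have finI: "finite I" using I(1) finV finite_subset by blast
  have cI: "card I = r + 1" using card_image[OF I(2)] I(3) surj by simp
  have "\<delta> * real n ^ card I \<le> real (card (homs n E I \<kappa>))"
    using card_cliques_le_homs[OF finI I(2), of n E] k(1) unfolding cI by linarith
  then have "\<delta> ^ (2 ^ card (VF - I)) * real n ^ (card I + card (VF - I)) \<le> real (card (homs n E (I \<union> (VF - I)) \<kappa>))"
    using finV finI I cI n k(2) by (intro homs_blowup) auto
  moreover have "I \<union> (VF - I) = VF" using I by auto
  moreover have "card (VF - I) = f - (r + 1)" using card_Diff_subset[OF finI I(1)] cI by simp
  moreover have "card I + card (VF - I) = f" using card_Diff_subset[OF finI I(1)] card_mono[OF finV I(1)] by simp
  ultimately have hom: "\<delta> ^ (2 ^ (f - (r + 1))) * real n ^ f \<le> real (card (homs n E VF \<kappa>))" by simp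
  let ?P = "{(v,w) \<in> VF \<times> VF. v \<noteq> w}"
  let ?R = "(\<lambda>a. (a,a)) ` {0..<n}"
  let ?B = "\<lambda>(v,w). {\<phi> \<in> VF \<rightarrow>\<^sub>E {0..<n}. (\<phi> v, \<phi> w) \<in> ?R}"
  have finP: "finite ?P" using finV by (rule_tac finite_subset[of _ "VF \<times> VF"]) auto
  have "homs n E VF \<kappa> \<subseteq> emb VF EF n E \<union> (\<Union>p\<in>?P. ?B p)"
  proof
    fix \<phi> assume h: "\<phi> \<in> homs n E VF \<kappa>"
    then have P: "\<phi> \<in> VF \<rightarrow>\<^sub>E {0..<n}" by (simp add: homs_def)
    show "\<phi> \<in> emb VF EF n E \<union> (\<Union>p\<in>?P. ?B p)"
    proof (cases "inj_on \<phi> VF")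
      case True
      have "\<phi> \<in> emb VF EF n E"
      proof (rule emb_I)
        show "\<And>v. v \<in> VF \<Longrightarrow> \<phi> v < n" using PiE_mem[OF P] by auto
        show "\<And>v. v \<notin> VF \<Longrightarrow> \<phi> v = undefined" using PiE_arb[OF P] by auto
        show "\<And>v w. v \<in> VF \<Longrightarrow> w \<in> VF \<Longrightarrow> v \<noteq> w \<Longrightarrow> \<phi> v \<noteq> \<phi> w" using True by (meson inj_onD)
        fix v w assume "v \<in> VF" "w \<in> VF" "{v,w} \<in> EF"
        then show "{\<phi> v, \<phi> w} \<in> E" using \<kappa>(2) h by (simp add: homs_def)
      qed
      then show ?thesis by blast
    next
      case False
      then obtain v w where vw: "v \<in> VF" "w \<in> VF" "v \<noteq> w" "\<phi> v = \<phi> w" by (auto simp: inj_on_def)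
      then have "\<phi> \<in> ?B (v,w)" using P PiE_mem[OF P vw(2)] by auto
      then show ?thesis using vw by blast
    qed
  qed
  then have "card (homs n E VF \<kappa>) \<le> card (emb VF EF n E \<union> (\<Union>p\<in>?P. ?B p))"
    using finite_emb[OF finV] finP finV by (intro card_mono) (auto simp: finite_PiE)
  also have "\<dots> \<le> card (emb VF EF n E) + (\<Sum>p\<in>?P. card (?B p))"
    using card_Un_le[of "emb VF EF n E" "\<Union>p\<in>?P. ?B p"] card_UN_le[OF finP, of ?B] by linarith
  also have "(\<Sum>p\<in>?P. card (?B p)) \<le> (\<Sum>p\<in>?P. n ^ (f - 1))"
  proof (rule sum_mono)
    fix p assume "p \<in> ?P"
    then obtain v w where p: "p = (v,w)" "v \<in> VF" "w \<in> VF" "v \<noteq> w" by auto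
    have "card (?B p) \<le> card ?R * card {0..<n} ^ (f - 2)"
      unfolding p(1) prod.case using p finV by (intro card_PiE_pair_le) auto
    also have "card ?R = n" by (simp add: card_image inj_on_def)
    also have "n * card {0..<n} ^ (f - 2) = n ^ (f - 1)"
    proof -
      have "f - 1 = Suc (f - 2)" using f_ge3 by simp
      then show ?thesis by simp
    qed
    finally show "card (?B p) \<le> n ^ (f - 1)" .
  qed
  also have "\<dots> \<le> f ^ 2 * n ^ (f - 1)"
  proof -
    have "card ?P \<le> card (VF \<times> VF)" using finV by (intro card_mono) auto
    then show ?thesis by (simp add: card_cartesian_product power2_eq_square)
  qed
  finally have "real (card (homs n E VF \<kappa>)) \<le> real (card (emb VF EF n E) + f ^ 2 * n ^ (f - 1))"
    by (simp only: of_nat_le_iff add_left_mono)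
  then show ?thesis using hom by simp
qed

lemma stability:
  fixes \<mu> :: real
  assumes mu: "\<mu> > 0"
  obtains \<delta> n0 where "\<delta> > 0" "\<And>n E. n \<ge> n0 \<Longrightarrow> E \<subseteq> pairs n \<Longrightarrow>
     (1 - 1 / real r) * real n ^ 2 / 2 - \<delta> * real n ^ 2 \<le> real (card E) \<Longrightarrow>
     real (card (emb VF EF n E)) \<le> \<delta> * real n ^ f \<Longrightarrow>
     \<exists>\<pi>. (\<forall>z. \<pi> z < r) \<and> real (card {(a,b). \<pi> a = \<pi> b \<and> {a,b} \<in> E}) \<le> \<mu> * real n ^ 2"
proof -
  define R where "R = real r"
  have R2: "R \<ge> 2" using r2 by (simp add: R_def)
  \<comment> \<open>Chosen so that the clique term of \<open>few_cliques_partition\<close> becomes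
    (\<mu>/2) n^2 after division by the lower bound (n/(2r^2))^r for the number of
    r-cliques.\<close>
  define \<delta>1 where "\<delta>1 = \<mu> / (6 * R * (R + 1) * (2 * R ^ 2) ^ r)"
  have d1: "\<delta>1 > 0" using mu R2 by (simp add: \<delta>1_def)
  define \<epsilon> where "\<epsilon> = \<delta>1 ^ (2 ^ (f - (r + 1)))"
  have eps: "\<epsilon> > 0" using d1 by (simp add: \<epsilon>_def)
  \<comment> \<open>The three bounds serve, in order, to derive few (r+1)-cliques from few
    embeddings, to secure the positivity condition of the Moon-Moser induction, and to keep the
    first cost term below (\<mu>/2) n^2.\<close>
  define \<delta> where "\<delta> = min (\<epsilon> / 2) (min (1 / (4 * R ^ 2)) (\<mu> / (8 * R ^ 2)))"
  have del: "\<delta> > 0" using eps mu R2 by (simp add: \<delta>_def)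
  have del1: "\<delta> \<le> \<epsilon> / 2" "\<delta> \<le> 1 / (4 * R ^ 2)" "\<delta> \<le> \<mu> / (8 * R ^ 2)" by (auto simp: \<delta>_def)
  obtain n0 :: nat where n0: "real n0 > 2 * real f ^ 2 / \<epsilon>" using reals_Archimedean2 by blast
  show ?thesis
  proof (rule that[of \<delta> "Suc n0"])
    show "\<delta> > 0" by (rule del)
    fix n E assume n: "n \<ge> Suc n0" and E: "E \<subseteq> pairs n"
      and e: "(1 - 1 / real r) * real n ^ 2 / 2 - \<delta> * real n ^ 2 \<le> real (card E)"
      and em: "real (card (emb VF EF n E)) \<le> \<delta> * real n ^ f"
    have npos: "n > 0" "real n > 0" using n by auto
    have k: "real (card (cliques n E (r + 1))) \<le> \<delta>1 * real n ^ (r + 1)"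
    proof (rule ccontr)
      assume "\<not> ?thesis"
      then have "\<epsilon> * real n ^ f - real f ^ 2 * real n ^ (f - 1) \<le> real (card (emb VF EF n E))"
        unfolding \<epsilon>_def using d1 npos by (intro cliques_give_emb) auto
      then have "\<epsilon> * real n ^ f - real f ^ 2 * real n ^ (f - 1) \<le> \<epsilon> / 2 * real n ^ f"
        using em del1(1) npos by (meson mult_right_mono order_trans zero_le_power less_imp_le)
      then have "\<epsilon> / 2 * real n ^ f \<le> real f ^ 2 * real n ^ (f - 1)" by simp
      moreover have "real n ^ f = real n * real n ^ (f - 1)"
        using f_ge3 by (metis Suc_diff_1 gr0I not_numeral_le_zero power_Suc)
      ultimately have "(\<epsilon> / 2 * real n) * real n ^ (f - 1) \<le> real f ^ 2 * real n ^ (f - 1)" by (simp add: mult_ac)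
      then have "\<epsilon> / 2 * real n \<le> real f ^ 2" using npos by (simp add: mult_le_cancel_right_pos)
      then have "real n \<le> 2 * real f ^ 2 / \<epsilon>" using eps by (simp add: field_simps)
      then show False using n0 n by linarith
    qed
    \<comment> \<open>The Turan value n/R plus twice the deficit allowed in the edge density, so
      that 2|E| \<ge> n (n - d).\<close>
    define d where "d = real n / R + 2 * \<delta> * real n"
    have d0: "d \<ge> 0" using R2 del npos by (simp add: d_def)
    have ee: "2 * real (card E) \<ge> real n * (real n - d)"
      using e unfolding d_def R_def[symmetric] by (simp add: algebra_simps power2_eq_square)
    have "(R - 1) * (2 * \<delta>) \<le> 1 / (2 * R)"
    proof -
      have "(R - 1) * (2 * \<delta>) \<le> R * (2 * \<delta>)" using del by (intro mult_right_mono) auto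
      also have "\<dots> \<le> R * (2 * (1 / (4 * R ^ 2)))" using del1(2) R2 by (intro mult_left_mono) auto
      also have "\<dots> = 1 / (2 * R)" using R2 by (simp add: power2_eq_square field_simps)
      finally show ?thesis .
    qed
    then have "real n * ((R - 1) * (2 * \<delta>)) \<le> real n * (1 / (2 * R))" by (intro mult_left_mono) auto
    then have pos: "real n - (real r - 1) * d \<ge> real n / (2 * real r)"
      unfolding d_def R_def[symmetric] using R2 by (simp add: field_simps)
    obtain \<pi> where \<pi>: "\<And>z. \<pi> z < r" "real (card {(a,b). \<pi> a = \<pi> b \<and> {a,b} \<in> E}) \<le> 2 * real n * (R - 1) * (R * d - real n)
      + real n * (3 * R * (R + 1)) * (real (card (cliques n E (Suc r))) / real (card (cliques n E r)))"
      unfolding R_def by (rule few_cliques_partition[OF E npos(1) r2 d0 ee pos]) blast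
    have t1: "2 * real n * (R - 1) * (R * d - real n) \<le> \<mu> / 2 * real n ^ 2"
    proof -
      have eq: "R * d - real n = 2 * R * \<delta> * real n" using R2 by (simp add: d_def field_simps)
      have "2 * real n * (R - 1) * (R * d - real n) = (4 * (R - 1) * R * \<delta>) * real n ^ 2"
        unfolding eq by (simp add: power2_eq_square)
      also have "\<dots> \<le> (\<mu> / 2) * real n ^ 2"
      proof (rule mult_right_mono)
        have "4 * (R - 1) * R * \<delta> \<le> 4 * R * R * \<delta>" using R2 del by (intro mult_right_mono) auto
        also have "\<dots> \<le> 4 * R * R * (\<mu> / (8 * R ^ 2))" using del1(3) R2 by (intro mult_left_mono) auto
        also have "\<dots> = \<mu> / 2" using R2 by (simp add: power2_eq_square)
        finally show "4 * (R - 1) * R * \<delta> \<le> \<mu> / 2" .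
      qed simp
      finally show ?thesis .
    qed
    have t2: "real n * (3 * R * (R + 1)) * (real (card (cliques n E (Suc r))) / real (card (cliques n E r))) \<le> \<mu> / 2 * real n ^ 2"
    proof -
      have c: "(real n / (2 * R ^ 2)) ^ r \<le> real (card (cliques n E r))"
        unfolding R_def using r2 by (intro clique_count[OF E npos(1) r2 d0 ee pos]) auto
      have c0: "0 < (real n / (2 * R ^ 2)) ^ r" using npos R2 by simp
      have "real (card (cliques n E (Suc r))) / real (card (cliques n E r)) \<le> (\<delta>1 * real n ^ (r + 1)) / (real n / (2 * R ^ 2)) ^ r"
        using k c c0 by (intro frac_le) auto
      also have "\<dots> = \<delta>1 * (2 * R ^ 2) ^ r * real n"
        using npos R2 by (simp add: power_divide field_simps)
      finally have "real n * (3 * R * (R + 1)) * (real (card (cliques n E (Suc r))) / real (card (cliques n E r)))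
        \<le> real n * (3 * R * (R + 1)) * (\<delta>1 * (2 * R ^ 2) ^ r * real n)"
        using R2 by (intro mult_left_mono) auto
      also have "\<dots> = (3 * R * (R + 1) * (2 * R ^ 2) ^ r * \<delta>1) * real n ^ 2" by (simp add: power2_eq_square)
      also have "3 * R * (R + 1) * (2 * R ^ 2) ^ r * \<delta>1 = \<mu> / 2"
      proof -
        define q where "q = (2 * R ^ 2) ^ r"
        have "q > 0" using R2 by (simp add: q_def)
        then show ?thesis unfolding \<delta>1_def q_def[symmetric] using R2 by (simp add: divide_simps)
      qed
      finally show ?thesis .
    qed
    show "\<exists>\<pi>. (\<forall>z. \<pi> z < r) \<and> real (card {(a,b). \<pi> a = \<pi> b \<and> {a,b} \<in> E}) \<le> \<mu> * real n ^ 2"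
    proof (intro exI[of _ \<pi>] conjI allI)
      show "\<pi> z < r" for z by (rule \<pi>(1))
      have "\<mu> / 2 * real n ^ 2 + \<mu> / 2 * real n ^ 2 = \<mu> * real n ^ 2" by simp
      then show "real (card {(a,b). \<pi> a = \<pi> b \<and> {a,b} \<in> E}) \<le> \<mu> * real n ^ 2" using \<pi>(2) t1 t2 by linarith
    qed
  qed
qed

end

section \<open>Bad and missing edges of a partitioned graph\<close>

lemma card_arcs:
  assumes "E \<subseteq> pairs n"
  shows "card {(a,b). {a,b} \<in> E} = 2 * card E"
proof -
  have fin: "finite E" by (rule finite_subset[OF assms]) (auto simp: pairs_def intro: finite_subset[of _ "Pow {..<n}"])
  let ?A = "\<lambda>e. {(a,b). {a,b} = e}"
  have two: "card (?A e) = 2 \<and> finite (?A e)" if "e \<in> E" for e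
  proof -
    obtain x y where e: "e = {x,y}" "x \<noteq> y" using \<open>e \<in> E\<close> assms unfolding pairs_def by blast
    then have "?A e = {(x,y),(y,x)}" by (auto simp: doubleton_eq_iff)
    then show ?thesis using e by simp
  qed
  have "{(a,b). {a,b} \<in> E} = (\<Union>e\<in>E. ?A e)" by auto
  also have "card \<dots> = (\<Sum>e\<in>E. card (?A e))"
    using fin two by (intro card_UN_disjoint) auto
  also have "\<dots> = 2 * card E" using two by simp
  finally show ?thesis .
qed

lemma card_cross_pairs:
  fixes \<pi> :: "nat \<Rightarrow> nat"
  assumes "\<And>z. z < n \<Longrightarrow> \<pi> z < r"
  shows "card {(a,b). a < n \<and> b < n \<and> \<pi> a \<noteq> \<pi> b} + (\<Sum>i<r. card {z. z < n \<and> \<pi> z = i} ^ 2) = n ^ 2"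
    and "(\<Sum>i<r. card {z. z < n \<and> \<pi> z = i}) = n"
proof -
  let ?V = "\<lambda>i. {z. z < n \<and> \<pi> z = i}"
  let ?C = "{(a,b). a < n \<and> b < n \<and> \<pi> a \<noteq> \<pi> b}"
  have finC: "finite ?C" by (rule finite_subset[of _ "{..<n} \<times> {..<n}"]) auto
  have "card (\<Union>i<r. ?V i \<times> ?V i) = (\<Sum>i<r. card (?V i \<times> ?V i))"
    by (rule card_UN_disjoint) auto
  then have 1: "card (\<Union>i<r. ?V i \<times> ?V i) = (\<Sum>i<r. card (?V i) ^ 2)"
    by (simp add: card_cartesian_product power2_eq_square)
  have "?C \<union> (\<Union>i<r. ?V i \<times> ?V i) = {..<n} \<times> {..<n}" using assms by auto
  then have "card (?C \<union> (\<Union>i<r. ?V i \<times> ?V i)) = n ^ 2" by (simp add: card_cartesian_product power2_eq_square)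
  moreover have "card (?C \<union> (\<Union>i<r. ?V i \<times> ?V i)) = card ?C + card (\<Union>i<r. ?V i \<times> ?V i)"
    using finC by (intro card_Un_disjoint) auto
  ultimately show "card ?C + (\<Sum>i<r. card (?V i) ^ 2) = n ^ 2" using 1 by simp
  have "card (\<Union>i<r. ?V i) = (\<Sum>i<r. card (?V i))" by (rule card_UN_disjoint) auto
  moreover have "(\<Union>i<r. ?V i) = {..<n}" using assms by auto
  ultimately show "(\<Sum>i<r. card (?V i)) = n" by simp
qed

lemma turan_sub: "turan_edges r n \<subseteq> pairs n"
  unfolding turan_edges_def pairs_def by blast

lemma turan_arcs: "2 * card (turan_edges r n) = card {(a,b). a < n \<and> b < n \<and> a mod r \<noteq> b mod r}"
  using card_arcs[OF turan_sub, of r n] by (simp add: turan_iff)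

text \<open>For integers a^2 \<ge> (2k+1) a - k(k+1), because (a-k)(a-k-1) \<ge> 0, with equality
  exactly at k and k + 1. The linear side sums to the same value for any two partitions, and for k =
  n div r the residue classes attain equality.\<close>

lemma turan_optimal:
  fixes \<pi> :: "nat \<Rightarrow> nat"
  assumes r: "r > 0" and pi: "\<And>z. z < n \<Longrightarrow> \<pi> z < r"
  shows "card {(a,b). a < n \<and> b < n \<and> \<pi> a \<noteq> \<pi> b} \<le> 2 * card (turan_edges r n)"
proof -
  define k where "k = int (n div r)"
  define a where "a = (\<lambda>i. int (card {z. z < n \<and> \<pi> z = i}))"
  define b where "b = (\<lambda>i. int (card {z. z < n \<and> z mod r = i}))"
  have sa: "(\<Sum>i<r. a i) = int n" using card_cross_pairs(2)[of n \<pi> r, OF pi] by (simp add: a_def flip: of_nat_sum)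
  have sb: "(\<Sum>i<r. b i) = int n" using card_cross_pairs(2)[of n "\<lambda>z. z mod r" r] r by (simp add: b_def flip: of_nat_sum)
  have "(\<Sum>i<r. b i ^ 2) = (\<Sum>i<r. (2 * k + 1) * b i - k * (k + 1))"
  proof (rule sum.cong[OF refl])
    fix i assume "i \<in> {..<r}"
    then have "b i = k \<or> b i = k + 1" using card_residue_class[of i r n] unfolding b_def k_def by force
    then show "b i ^ 2 = (2 * k + 1) * b i - k * (k + 1)" by (auto simp: power2_eq_square algebra_simps)
  qed
  also have "\<dots> = (\<Sum>i<r. (2 * k + 1) * a i - k * (k + 1))"
    by (simp add: sum_subtractf sum_distrib_left[symmetric] sa sb)
  also have "\<dots> \<le> (\<Sum>i<r. a i ^ 2)"
  proof (rule sum_mono)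
    fix i
    have "(a i - k) * (a i - k - 1) \<ge> 0"
      by (cases "a i \<le> k") (auto intro: mult_nonpos_nonpos)
    then show "(2 * k + 1) * a i - k * (k + 1) \<le> a i ^ 2" by (simp add: power2_eq_square algebra_simps)
  qed
  finally have "int (\<Sum>i<r. card {z. z < n \<and> z mod r = i} ^ 2) \<le> int (\<Sum>i<r. card {z. z < n \<and> \<pi> z = i} ^ 2)"
    by (simp add: a_def b_def)
  then have "(\<Sum>i<r. card {z. z < n \<and> z mod r = i} ^ 2) \<le> (\<Sum>i<r. card {z. z < n \<and> \<pi> z = i} ^ 2)"
    by (simp only: of_nat_le_iff)
  moreover have "card {(a,b). a < n \<and> b < n \<and> a mod r \<noteq> b mod r} + (\<Sum>i<r. card {z. z < n \<and> z mod r = i} ^ 2) = n ^ 2"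
    by (rule card_cross_pairs(1)) (use r in simp)
  ultimately show ?thesis unfolding turan_arcs
    using card_cross_pairs(1)[of n \<pi> r, OF pi] by linarith
qed

lemma turan_lower:
  assumes r: "r > 0"
  shows "(1 - 1 / real r) * real n ^ 2 - 2 * real n - real r \<le> 2 * real (card (turan_edges r n))"
proof -
  have "(\<Sum>i<r. real (card {z. z < n \<and> z mod r = i}) ^ 2) \<le> (\<Sum>i<r. (real n / real r + 1) ^ 2)"
    by (intro sum_mono power_mono card_residue_class_real) auto
  also have "\<dots> = real n ^ 2 / real r + 2 * real n + real r"
    using r by (simp add: power2_eq_square field_simps)
  finally have 1: "(\<Sum>i<r. real (card {z. z < n \<and> z mod r = i}) ^ 2) \<le> real n ^ 2 / real r + 2 * real n + real r" .
  have "real (2 * card (turan_edges r n) + (\<Sum>i<r. card {z. z < n \<and> z mod r = i} ^ 2)) = real (n ^ 2)"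
    unfolding turan_arcs using card_cross_pairs(1)[of n "\<lambda>z. z mod r" r] r by simp
  then show ?thesis using 1 by (simp add: algebra_simps)
qed

text \<open>Pairs that meet L are counted from an end in L, so only those with both ends in L are
  counted too often; they reappear on the left.\<close>

lemma symmetric_relation_split:
  fixes S :: "(nat \<times> nat) set"
  assumes S: "S \<subseteq> {..<n} \<times> {..<n}" and sym: "\<And>a b. (a,b) \<in> S \<Longrightarrow> (b,a) \<in> S" and L: "L \<subseteq> {..<n}"
  shows "card S + card (S \<inter> L \<times> L) = 2 * (\<Sum>x\<in>L. card {y. (x,y) \<in> S}) + card (S \<inter> (-L) \<times> (-L))"
proof -
  have fin: "finite S" by (rule finite_subset[OF S]) simp
  have finL: "finite L" by (rule finite_subset[OF L]) simp
  have 1: "card (S \<inter> L \<times> UNIV) = (\<Sum>x\<in>L. card {y. (x,y) \<in> S})"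
  proof -
    have "S \<inter> L \<times> UNIV = Sigma L (\<lambda>x. {y. (x,y) \<in> S})" by auto
    moreover have "finite {y. (x,y) \<in> S}" for x
      by (rule finite_subset[of _ "{..<n}"]) (use S in auto)
    ultimately show ?thesis using finL by (simp add: card_SigmaI)
  qed
  have 2: "card (S \<inter> UNIV \<times> L) = card (S \<inter> L \<times> UNIV)"
    by (rule bij_betw_same_card[of "\<lambda>(a,b). (b,a)"], rule bij_betwI[where g = "\<lambda>(a,b). (b,a)"]) (auto simp: sym)
  have "S \<inter> UNIV \<times> L = (S \<inter> L \<times> L) \<union> (S \<inter> (-L) \<times> L)" by auto
  then have 3: "card (S \<inter> UNIV \<times> L) = card (S \<inter> L \<times> L) + card (S \<inter> (-L) \<times> L)"
    using fin by (simp add: card_Un_disjoint disjoint_iff)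
  have "S = (S \<inter> L \<times> UNIV) \<union> ((S \<inter> (-L) \<times> L) \<union> (S \<inter> (-L) \<times> (-L)))" by auto
  then have "card S = card ((S \<inter> L \<times> UNIV) \<union> ((S \<inter> (-L) \<times> L) \<union> (S \<inter> (-L) \<times> (-L))))" by simp
  also have "\<dots> = card (S \<inter> L \<times> UNIV) + card ((S \<inter> (-L) \<times> L) \<union> (S \<inter> (-L) \<times> (-L)))"
    using fin by (intro card_Un_disjoint) auto
  also have "card ((S \<inter> (-L) \<times> L) \<union> (S \<inter> (-L) \<times> (-L))) = card (S \<inter> (-L) \<times> L) + card (S \<inter> (-L) \<times> (-L))"
    using fin by (intro card_Un_disjoint) auto
  finally show ?thesis using 1 2 3 by simp
qed

text \<open>Moving a single vertex x to part j changes only the pairs at x. In a partition with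
  fewest inner pairs no such move can gain, so no vertex has fewer neighbours in another part than
  in its own.\<close>

lemma max_cut_exists:
  fixes \<pi>0 :: "nat \<Rightarrow> nat"
  assumes E: "E \<subseteq> pairs n" and pi0: "\<And>z. \<pi>0 z < r"
  obtains \<pi> where "\<And>z. \<pi> z < r"
    "card {(a,b). \<pi> a = \<pi> b \<and> {a,b} \<in> E} \<le> card {(a,b). \<pi>0 a = \<pi>0 b \<and> {a,b} \<in> E}"
    "\<And>x j. j < r \<Longrightarrow> card {y. \<pi> y = \<pi> x \<and> {x,y} \<in> E} \<le> card {y. \<pi> y = j \<and> {x,y} \<in> E}"
proof -
  let ?B = "\<lambda>\<pi>::nat \<Rightarrow> nat. {(a,b). \<pi> a = \<pi> b \<and> {a,b} \<in> E}"
  obtain \<pi> where lt: "\<forall>z. \<pi> z < r" and min: "\<And>\<pi>'. (\<forall>z. \<pi>' z < r) \<Longrightarrow> card (?B \<pi>) \<le> card (?B \<pi>')"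
    using ex_has_least_nat[of "\<lambda>\<pi>. \<forall>z. \<pi> z < r" \<pi>0 "\<lambda>\<pi>. card (?B \<pi>)"] pi0 by blast
  have nl: "{a,a} \<notin> E" for a using E pairs_iff[of a a n] by auto
  have bd: "a < n \<and> b < n" if "{a,b} \<in> E" for a b using that E pairs_iff[of a b n] by auto
  have split: "card (?B \<sigma>) = card {(a,b). a \<noteq> x \<and> b \<noteq> x \<and> \<sigma> a = \<sigma> b \<and> {a,b} \<in> E} + 2 * card {y. \<sigma> y = \<sigma> x \<and> {x,y} \<in> E}"
    for \<sigma> :: "nat \<Rightarrow> nat" and x
  proof -
    let ?S = "{(a,b). a \<noteq> x \<and> b \<noteq> x \<and> \<sigma> a = \<sigma> b \<and> {a,b} \<in> E}" and ?N = "{y. \<sigma> y = \<sigma> x \<and> {x,y} \<in> E}"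
    have finS: "finite ?S" by (rule finite_subset[of _ "{..<n} \<times> {..<n}"]) (use bd in auto)
    have finN: "finite ?N" by (rule finite_subset[of _ "{..<n}"]) (use bd in auto)
    have xN: "x \<notin> ?N" using nl[of x] by simp
    have 1: "?B \<sigma> = ?S \<union> ({x} \<times> ?N \<union> ?N \<times> {x})" by (auto simp: insert_commute)
    have 2: "card (?S \<union> ({x} \<times> ?N \<union> ?N \<times> {x})) = card ?S + card ({x} \<times> ?N \<union> ?N \<times> {x})"
      using finS finN by (intro card_Un_disjoint) auto
    have 3: "card ({x} \<times> ?N \<union> ?N \<times> {x}) = card ({x} \<times> ?N) + card (?N \<times> {x})"
      using finN xN by (intro card_Un_disjoint) auto
    show ?thesis unfolding 1 2 3 by (simp add: card_cartesian_product)
  qed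
  have "card {y. \<pi> y = \<pi> x \<and> {x,y} \<in> E} \<le> card {y. \<pi> y = j \<and> {x,y} \<in> E}" if "j < r" for x j
  proof -
    let ?p = "\<pi>(x := j)"
    have "card (?B \<pi>) \<le> card (?B ?p)" using lt that by (intro min) auto
    moreover have "{(a,b). a \<noteq> x \<and> b \<noteq> x \<and> ?p a = ?p b \<and> {a,b} \<in> E} = {(a,b). a \<noteq> x \<and> b \<noteq> x \<and> \<pi> a = \<pi> b \<and> {a,b} \<in> E}"
      by auto
    moreover have "{y. ?p y = ?p x \<and> {x,y} \<in> E} \<subseteq> {y. \<pi> y = j \<and> {x,y} \<in> E}" using nl by auto
    then have "card {y. ?p y = ?p x \<and> {x,y} \<in> E} \<le> card {y. \<pi> y = j \<and> {x,y} \<in> E}"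
      by (intro card_mono) (auto intro: finite_subset[of _ "{..<n}"] dest: bd)
    ultimately show ?thesis using split[of \<pi> x] split[of ?p x] by simp
  qed
  then show ?thesis using that[of \<pi>] lt min[of \<pi>0] pi0 by blast
qed

section \<open>Degree accounting for a fixed partition\<close>

locale pgraph = critical +
  fixes n :: nat and E :: "nat set set" and \<pi> :: "nat \<Rightarrow> nat"
  assumes E: "E \<subseteq> pairs n" and pi: "\<And>z. \<pi> z < r" and n0: "n > 0"
begin

definition "V i = {z. z < n \<and> \<pi> z = i}"
definition "nb x i = {y. \<pi> y = i \<and> {x,y} \<in> E}"
definition "dB x = card (nb x (\<pi> x))"
definition "mis x = {y. y < n \<and> \<pi> y \<noteq> \<pi> x \<and> {x,y} \<notin> E}"
definition "dM x = card (mis x)"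
text \<open>Ordered pairs, so bad edges are counted twice here, and missing edges twice in
  \<open>M2\<close>; no orientation has to be chosen until embeddings are counted.\<close>

definition "B2 = {(a,b). \<pi> a = \<pi> b \<and> {a,b} \<in> E}"
definition "M2 = {(a,b). a < n \<and> b < n \<and> \<pi> a \<noteq> \<pi> b \<and> {a,b} \<notin> E}"

lemma E_bound: "{a,b} \<in> E \<Longrightarrow> a < n \<and> b < n \<and> a \<noteq> b" using E pairs_iff[of a b n] by auto

lemma nb_sub: "nb x i \<subseteq> V i" by (auto simp: nb_def V_def dest: E_bound)

lemma finite_V: "finite (V i)" by (simp add: V_def)

lemma finite_nb: "finite (nb x i)" using nb_sub finite_V finite_subset by blast

lemma finite_mis: "finite (mis x)" by (simp add: mis_def)

lemma B2_sub: "B2 \<subseteq> {..<n} \<times> {..<n}" by (auto simp: B2_def dest: E_bound)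

lemma M2_sub: "M2 \<subseteq> {..<n} \<times> {..<n}" by (auto simp: M2_def)

lemma finite_B2: "finite B2" by (rule finite_subset[OF B2_sub]) simp

lemma finite_M2: "finite M2" by (rule finite_subset[OF M2_sub]) simp

lemma edge_balance: "2 * card E + card M2 = card {(a,b). a < n \<and> b < n \<and> \<pi> a \<noteq> \<pi> b} + card B2"
proof -
  let ?A = "{(a,b). {a,b} \<in> E}" and ?X = "{(a,b). \<pi> a \<noteq> \<pi> b \<and> {a,b} \<in> E}"
  have finX: "finite ?X" by (rule finite_subset[of _ "{..<n} \<times> {..<n}"]) (auto dest: E_bound)
  have "?A = B2 \<union> ?X" by (auto simp: B2_def)
  then have "2 * card E = card (B2 \<union> ?X)" using card_arcs[OF E] by simp
  also have "\<dots> = card B2 + card ?X" using finite_B2 finX by (intro card_Un_disjoint) (auto simp: B2_def)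
  finally have 1: "2 * card E = card B2 + card ?X" .
  have "{(a,b). a < n \<and> b < n \<and> \<pi> a \<noteq> \<pi> b} = ?X \<union> M2" by (auto simp: M2_def dest: E_bound)
  then have "card {(a,b). a < n \<and> b < n \<and> \<pi> a \<noteq> \<pi> b} = card ?X + card M2"
    using finX finite_M2 by (simp add: card_Un_disjoint M2_def disjoint_iff)
  then show ?thesis using 1 by simp
qed

text \<open>The edge balance combined with the fact that no partition has more than 2 t_r(n) ordered
  cross pairs. In particular missing edges never outnumber bad ones, which is what controls
  \<open>Rbad\<close>.\<close>

lemma surplus:
  assumes "card E \<ge> card (turan_edges r n) + q"
  shows "2 * q + card M2 \<le> card B2"
  using turan_optimal[of r n \<pi>] pi r2 edge_balance assms by force

text \<open>The sum of (|V_i| - n/r)^2 equals the sum of |V_i|^2 minus n^2/r, that is, the deficit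
  of cross pairs against (1 - 1/r) n^2; and this deficit is at most |B2| + 2n + r.\<close>

lemma part_sizes:
  assumes "card E \<ge> card (turan_edges r n)" and b: "real (card B2) + 2 * real n + real r \<le> \<gamma>\<^sup>2 * real n ^ 2"
    and g: "\<gamma> \<ge> 0" and i: "i < r"
  shows "\<bar>real (card (V i)) - real n / real r\<bar> \<le> \<gamma> * real n"
proof -
  let ?v = "\<lambda>i. real (card (V i))"
  have r0: "real r > 0" using r2 by simp
  have "card {(a,b). a < n \<and> b < n \<and> \<pi> a \<noteq> \<pi> b} + (\<Sum>i<r. card (V i) ^ 2) = n ^ 2" and s: "(\<Sum>i<r. card (V i)) = n"
    using card_cross_pairs[of n \<pi> r] pi unfolding V_def by auto
  then have "real (card {(a,b). a < n \<and> b < n \<and> \<pi> a \<noteq> \<pi> b} + (\<Sum>i<r. card (V i) ^ 2)) = real (n ^ 2)" by simp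
  then have 1: "real (card {(a,b). a < n \<and> b < n \<and> \<pi> a \<noteq> \<pi> b}) + (\<Sum>i<r. ?v i ^ 2) = real n ^ 2" by simp
  have "2 * card (turan_edges r n) \<le> card {(a,b). a < n \<and> b < n \<and> \<pi> a \<noteq> \<pi> b} + card B2"
    using edge_balance assms(1) by linarith
  then have "2 * real (card (turan_edges r n)) \<le> real (card {(a,b). a < n \<and> b < n \<and> \<pi> a \<noteq> \<pi> b}) + real (card B2)"
    by linarith
  then have 2: "(\<Sum>i<r. ?v i ^ 2) \<le> real n ^ 2 / real r + \<gamma>\<^sup>2 * real n ^ 2"
    using turan_lower[of r n] r2 1 b by (simp add: algebra_simps)
  have s': "(\<Sum>i<r. ?v i) = real n" using s by (simp flip: of_nat_sum)
  define t where "t = real n / real r"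
  have "(\<Sum>i<r. (?v i - t)\<^sup>2) = (\<Sum>i<r. ?v i ^ 2 - 2 * t * ?v i + t\<^sup>2)"
    by (intro sum.cong refl) (simp add: power2_diff)
  also have "\<dots> = (\<Sum>i<r. ?v i ^ 2) - 2 * t * (\<Sum>i<r. ?v i) + real r * t\<^sup>2"
    by (simp add: sum.distrib sum_subtractf sum_distrib_left)
  also have "\<dots> = (\<Sum>i<r. ?v i ^ 2) - 2 * t * real n + real r * t\<^sup>2" unfolding s' ..
  also have "\<dots> = (\<Sum>i<r. ?v i ^ 2) - real n ^ 2 / real r"
    using r0 by (simp add: power2_eq_square field_simps t_def)
  finally have "(\<Sum>i<r. (?v i - real n / real r)\<^sup>2) \<le> (\<gamma> * real n)\<^sup>2"
    using 2 by (simp add: power_mult_distrib t_def)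
  moreover have "(?v i - real n / real r)\<^sup>2 \<le> (\<Sum>i<r. (?v i - real n / real r)\<^sup>2)"
    using i by (intro member_le_sum) auto
  ultimately have "(?v i - real n / real r)\<^sup>2 \<le> (\<gamma> * real n)\<^sup>2" by linarith
  then have "\<bar>?v i - real n / real r\<bar> \<le> \<bar>\<gamma> * real n\<bar>" by (simp only: abs_le_square_iff)
  then show ?thesis using g by simp
qed

lemma card_Rbad: "card (Rbad n E \<pi>) \<le> n + card M2"
proof -
  have "Rbad n E \<pi> \<subseteq> (\<lambda>a. (a,a)) ` {..<n} \<union> M2" by (auto simp: Rbad_def M2_def)
  then have "card (Rbad n E \<pi>) \<le> card ((\<lambda>a. (a,a)) ` {..<n} \<union> M2)"
    using finite_M2 by (intro card_mono) auto
  also have "\<dots> \<le> card ((\<lambda>a. (a,a)) ` {..<n}) + card M2" by (rule card_Un_le)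
  also have "card ((\<lambda>a. (a,a)) ` {..<n}) \<le> n" using card_image_le[of "{..<n}" "\<lambda>a. (a,a)"] by simp
  finally show ?thesis by simp
qed

lemma card_B2_ge:
  assumes "L \<subseteq> {..<n}" "\<And>x. x \<in> L \<Longrightarrow> t \<le> real (dB x)"
  shows "real (card L) * t \<le> real (card B2)"
proof -
  have finL: "finite L" by (rule finite_subset[OF assms(1)]) simp
  have "Sigma L (\<lambda>x. nb x (\<pi> x)) \<subseteq> B2" by (auto simp: nb_def B2_def)
  then have "card (Sigma L (\<lambda>x. nb x (\<pi> x))) \<le> card B2" using finite_B2 by (rule card_mono[rotated])
  then have "(\<Sum>x\<in>L. dB x) \<le> card B2" using finL finite_nb by (simp add: card_SigmaI dB_def)
  then have "(\<Sum>x\<in>L. real (dB x)) \<le> real (card B2)" by (simp flip: of_nat_sum)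
  moreover have "(\<Sum>x\<in>L. t) \<le> (\<Sum>x\<in>L. real (dB x))" using assms(2) by (rule sum_mono)
  ultimately show ?thesis by simp
qed

text \<open>The few vertices with large missing degree but small bad degree cost nothing: the edges
  they miss outnumber the bad edges they carry.\<close>

lemma surplus_split:
  fixes \<eta> \<eta>' :: real
  assumes q: "card E \<ge> card (turan_edges r n) + q"
    and L: "L = {x. x < n \<and> \<eta>' * real n \<le> real (dB x)}"
    and X: "X = {x. x < n \<and> x \<notin> L \<and> \<eta> * real n < real (dM x)}"
    and eta: "4 * \<eta>' \<le> \<eta>" "\<eta>' \<ge> 0" and Lc: "real (card L) \<le> \<eta> / 2 * real n"
    and B0: "B0 = {(x,y) \<in> B2. x \<notin> L \<and> y \<notin> L \<and> x \<notin> X \<and> y \<notin> X}"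
  shows "2 * real q \<le> 2 * (\<Sum>x\<in>L. real (dB x) - real (dM x)) + real (card L) ^ 2 + real (card B0)"
proof -
  have Ls: "L \<subseteq> {..<n}" and Xs: "X \<subseteq> {..<n}" using L X by auto
  have finL: "finite L" and finX: "finite X" using Ls Xs finite_subset by blast+
  have dBeq: "card {y. (x,y) \<in> B2} = dB x" for x
    unfolding dB_def nb_def B2_def by (intro arg_cong[where f = card]) auto
  have dMeq: "card {y. (x,y) \<in> M2} = dM x" if "x < n" for x
    unfolding dM_def mis_def M2_def using that by (intro arg_cong[where f = card]) auto
  have B: "card B2 \<le> 2 * (\<Sum>x\<in>L. dB x) + card (B2 \<inter> (-L) \<times> (-L))"
    using symmetric_relation_split[OF B2_sub _ Ls] by (simp add: dBeq) (auto simp: B2_def insert_commute)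
  have "card M2 + card (M2 \<inter> L \<times> L) = 2 * (\<Sum>x\<in>L. card {y. (x,y) \<in> M2}) + card (M2 \<inter> (-L) \<times> (-L))"
    by (rule symmetric_relation_split[OF M2_sub _ Ls]) (auto simp: M2_def insert_commute)
  moreover have "(\<Sum>x\<in>L. card {y. (x,y) \<in> M2}) = (\<Sum>x\<in>L. dM x)"
    using Ls by (intro sum.cong refl dMeq) auto
  \<comment> \<open>Missing pairs inside L enter the sum over L from both ends; this is where the
    term |L|^2 comes from.\<close>
  moreover have "card (M2 \<inter> L \<times> L) \<le> card L ^ 2"
    using card_mono[of "L \<times> L" "M2 \<inter> L \<times> L"] finL by (simp add: card_cartesian_product power2_eq_square)
  ultimately have M: "2 * (\<Sum>x\<in>L. dM x) + card (M2 \<inter> (-L) \<times> (-L)) \<le> card M2 + card L ^ 2" by linarith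
  have bX: "real (card (Sigma X (\<lambda>x. nb x (\<pi> x)))) \<le> real (card X) * (\<eta>' * real n)"
  proof -
    have "real (card (Sigma X (\<lambda>x. nb x (\<pi> x)))) = (\<Sum>x\<in>X. real (dB x))"
      using finX finite_nb by (simp add: card_SigmaI dB_def)
    also have "\<dots> \<le> (\<Sum>x\<in>X. \<eta>' * real n)" using X L by (intro sum_mono) auto
    finally show ?thesis by simp
  qed
  let ?S = "Sigma X (\<lambda>x. nb x (\<pi> x))"
  have finS: "finite ?S" using finX finite_nb by blast
  have finB0: "finite B0" using finite_B2 B0 by (auto intro: finite_subset[of _ B2])
  have "B2 \<inter> (-L) \<times> (-L) \<subseteq> B0 \<union> (?S \<union> (\<lambda>(a,b). (b,a)) ` ?S)"
  proof (rule subrelI)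
    fix a b assume "(a,b) \<in> B2 \<inter> (-L) \<times> (-L)"
    then have ab: "(a,b) \<in> B2" "a \<notin> L" "b \<notin> L" by auto
    then have nbs: "b \<in> nb a (\<pi> a)" "a \<in> nb b (\<pi> b)" by (auto simp: B2_def nb_def insert_commute)
    show "(a,b) \<in> B0 \<union> (?S \<union> (\<lambda>(a,b). (b,a)) ` ?S)"
    proof (cases "a \<in> X")
      case True then show ?thesis using nbs by auto
    next
      case False
      show ?thesis
      proof (cases "b \<in> X")
        case True then have "(b,a) \<in> ?S" using nbs by auto
        then show ?thesis by force
      next
        case False then show ?thesis using \<open>a \<notin> X\<close> ab B0 by auto
      qed
    qed
  qed
  then have "card (B2 \<inter> (-L) \<times> (-L)) \<le> card (B0 \<union> (?S \<union> (\<lambda>(a,b). (b,a)) ` ?S))"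
    using finB0 finS by (intro card_mono) auto
  also have "\<dots> \<le> card B0 + (card ?S + card ((\<lambda>(a,b). (b,a)) ` ?S))"
    by (meson add_left_mono card_Un_le order_trans)
  also have "card ((\<lambda>(a,b). (b,a)) ` ?S) \<le> card ?S" by (rule card_image_le[OF finS])
  finally have "real (card (B2 \<inter> (-L) \<times> (-L))) \<le> real (card B0) + 2 * real (card ?S)" by linarith
  then have bB: "real (card (B2 \<inter> (-L) \<times> (-L))) \<le> real (card B0) + real (card X) * (2 * \<eta>' * real n)"
    using bX by linarith
  \<comment> \<open>A vertex of X misses more than \<eta> n and at most half of that inside L, so
    \<eta> n/2 missing pairs per vertex survive outside L. Its bad degree is below \<eta>' n, and
    twice that, for both orientations, is at most \<eta> n/2.\<close>
  have mM: "real (card X) * (\<eta> / 2 * real n) \<le> real (card (M2 \<inter> (-L) \<times> (-L)))"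
  proof -
    have "Sigma X (\<lambda>x. mis x - L) \<subseteq> M2 \<inter> (-L) \<times> (-L)" using X by (auto simp: M2_def mis_def)
    then have "card (Sigma X (\<lambda>x. mis x - L)) \<le> card (M2 \<inter> (-L) \<times> (-L))"
      using finite_M2 by (intro card_mono) auto
    then have "(\<Sum>x\<in>X. card (mis x - L)) \<le> card (M2 \<inter> (-L) \<times> (-L))"
      using finX finite_mis by (simp add: card_SigmaI)
    then have "(\<Sum>x\<in>X. real (card (mis x - L))) \<le> real (card (M2 \<inter> (-L) \<times> (-L)))" by (simp flip: of_nat_sum)
    moreover have "(\<Sum>x\<in>X. \<eta> / 2 * real n) \<le> (\<Sum>x\<in>X. real (card (mis x - L)))"
    proof (rule sum_mono)
      fix x assume x: "x \<in> X"
      have "dM x \<le> card (mis x - L) + card L"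
        unfolding dM_def using diff_card_le_card_Diff[OF finL, of "mis x"] by linarith
      then have "real (dM x) \<le> real (card (mis x - L)) + real (card L)" by linarith
      moreover have "\<eta> * real n < real (dM x)" using x X by auto
      ultimately show "\<eta> / 2 * real n \<le> real (card (mis x - L))" using Lc by simp
    qed
    ultimately show ?thesis by simp
  qed
  have "real (card X) * (2 * \<eta>' * real n) \<le> real (card X) * (\<eta> / 2 * real n)"
    using eta by (intro mult_left_mono mult_right_mono) auto
  then have "real (card (B2 \<inter> (-L) \<times> (-L))) \<le> real (card B0) + real (card (M2 \<inter> (-L) \<times> (-L)))"
    using bB mM by linarith
  moreover have "2 * real q + real (card M2) \<le> real (card B2)" using surplus[OF q] by linarith
  moreover have "real (card B2) \<le> 2 * (\<Sum>x\<in>L. real (dB x)) + real (card (B2 \<inter> (-L) \<times> (-L)))"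
    using of_nat_mono[OF B, where 'a = real] by simp
  moreover have "2 * (\<Sum>x\<in>L. real (dM x)) + real (card (M2 \<inter> (-L) \<times> (-L))) \<le> real (card M2) + real (card L) ^ 2"
    using of_nat_mono[OF M, where 'a = real] by simp
  ultimately show ?thesis by (simp add: sum_subtractf)
qed

lemma Psi_unique: "\<phi> \<in> Psi n E \<pi> L e \<Longrightarrow> \<phi> \<in> Psi n E \<pi> L e' \<Longrightarrow> e = e'"
  unfolding Psi_def mem_Collect_eq by (metis (no_types, lifting) singleton_inject)

text \<open>The families are disjoint: different traces on L, an empty trace, or different inner
  edges. Since \<open>B0\<close> contains only pairs with x < y, each inner edge is used
  once.\<close>

lemma card_emb_ge:
  assumes L: "L \<subseteq> {..<n}" and B0: "B0 \<subseteq> {(x,y). x < y}" "finite B0"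
  shows "(\<Sum>x\<in>L. card (Phi n E L x)) + (\<Sum>(x,y)\<in>B0. card (Psi n E \<pi> L {x,y})) \<le> card (emb VF EF n E)"
proof -
  have finL: "finite L" by (rule finite_subset[OF L]) simp
  have "(\<Sum>x\<in>L. card (Phi n E L x)) = card (\<Union>x\<in>L. Phi n E L x)"
    by (rule card_UN_disjoint[symmetric]) (use finL finite_Phi in \<open>auto simp: Phi_def\<close>)
  moreover have "(\<Sum>p\<in>B0. card (Psi n E \<pi> L {fst p, snd p})) = card (\<Union>p\<in>B0. Psi n E \<pi> L {fst p, snd p})"
  proof (rule card_UN_disjoint[symmetric])
    show "\<forall>p\<in>B0. \<forall>q\<in>B0. p \<noteq> q \<longrightarrow> Psi n E \<pi> L {fst p, snd p} \<inter> Psi n E \<pi> L {fst q, snd q} = {}"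
    proof (intro ballI impI)
      fix p q assume pq: "p \<in> B0" "q \<in> B0" "p \<noteq> q"
      have "{fst p, snd p} \<noteq> {fst q, snd q}"
      proof -
        have "fst p < snd p" "fst q < snd q" using pq B0(1) by (auto simp: case_prod_beta)
        then show ?thesis using pq(3) by (auto simp: doubleton_eq_iff prod_eq_iff)
      qed
      then show "Psi n E \<pi> L {fst p, snd p} \<inter> Psi n E \<pi> L {fst q, snd q} = {}"
        using Psi_unique by blast
    qed
  qed (use B0 finite_Psi in auto)
  moreover have "card (\<Union>x\<in>L. Phi n E L x) + card (\<Union>p\<in>B0. Psi n E \<pi> L {fst p, snd p})
     = card ((\<Union>x\<in>L. Phi n E L x) \<union> (\<Union>p\<in>B0. Psi n E \<pi> L {fst p, snd p}))"
    using finL B0(2) finite_Phi finite_Psi by (intro card_Un_disjoint[symmetric]) (auto simp: Phi_def Psi_def)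
  moreover have "\<dots> \<le> card (emb VF EF n E)"
    by (intro card_mono finite_emb finV) (auto simp: Phi_def Psi_def)
  ultimately show ?thesis by (simp add: case_prod_beta)
qed

end

section \<open>The lower bound\<close>

context critical
begin

lemma KC_color: "(u,c) \<in> KC \<Longrightarrow> w \<in> VF - {u} \<Longrightarrow> c w < r"
  using proper_coloringsD(3) by (auto simp: KC_def)

lemma monomial_mono:
  assumes "(u,c) \<in> KC" "\<And>i. i < r \<Longrightarrow> 0 \<le> \<xi> i \<and> \<xi> i \<le> \<zeta> i"
  shows "monomial u c \<xi> \<le> monomial u c \<zeta>"
  unfolding monomial_def using assms KC_color[OF assms(1)] by (intro prod_mono) auto

lemma PF_mono:
  assumes "\<And>i. i < r \<Longrightarrow> 0 \<le> \<xi> i \<and> \<xi> i \<le> \<zeta> i"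
  shows "PF r VF EF \<xi> \<le> PF r VF EF \<zeta>"
  unfolding PF_eq using aut_pos monomial_mono[OF _ assms] by (intro mult_left_mono sum_mono) auto

lemma monomial_ge:
  assumes uc: "(u,c) \<in> KC" and t: "0 \<le> t" "t \<le> 1 / real r" "\<And>i. i < r \<Longrightarrow> t \<le> \<xi> i"
  shows "t ^ (f - 1) \<le> monomial u c \<xi>"
proof -
  have "(\<Prod>w\<in>VF - {u}. t) \<le> monomial u c \<xi>"
    unfolding monomial_def using t KC_color[OF uc] by (intro prod_mono) auto
  moreover have "card (VF - {u}) = f - 1" using uc finV by (simp add: KC_def)
  ultimately show ?thesis by simp
qed

text \<open>A single term gives the bound, as \<open>KC\<close> is nonempty by the critical edge.
  Additive errors are later made relative to this positive constant.\<close>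

lemma PF_ge:
  assumes t: "0 \<le> t" "t \<le> 1 / real r" "\<And>i. i < r \<Longrightarrow> t \<le> \<xi> i"
  shows "t ^ (f - 1) / real (aut VF EF) \<le> PF r VF EF \<xi>"
proof -
  obtain u c where uc: "(u,c) \<in> KC" using N_pos unfolding N_def K_def by (metis (no_types, lifting) card.empty less_irrefl mem_Collect_eq surj_pair subsetI subset_empty case_prodD)
  have "t ^ (f - 1) \<le> (\<Sum>p\<in>{(u,c)}. monomial (fst p) (snd p) \<xi>)" using monomial_ge[OF uc t] by simp
  also have "\<dots> \<le> (\<Sum>p\<in>KC. monomial (fst p) (snd p) \<xi>)"
  proof (rule sum_mono2[OF finite_KC])
    fix p assume "p \<in> KC - {(u,c)}"
    then have "t ^ (f - 1) \<le> monomial (fst p) (snd p) \<xi>" using t by (intro monomial_ge) auto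
    then show "0 \<le> monomial (fst p) (snd p) \<xi>" using t(1) by (meson order_trans zero_le_power)
  qed (use uc in simp)
  finally show ?thesis unfolding PF_eq using aut_pos by (simp add: divide_right_mono case_prod_beta)
qed

text \<open>In use s = q/n. A vertex at which \<open>P_F\<close> reaches a0 q/n lies by itself in
  about a0 q n^(f-2) copies, so nothing beyond a0 s has to be demanded; and a \<xi> with sum below
  (r-1)/r satisfies the inequality trivially.\<close>

definition PF_dominates :: "real \<Rightarrow> bool" where
  "PF_dominates s \<longleftrightarrow> (\<forall>\<xi>. (\<forall>i<r. 0 \<le> \<xi> i \<and> \<xi> i \<le> 1 / real r) \<longrightarrow>
     a0 * min ((\<Sum>i<r. \<xi> i) - (real r - 1) / real r) s \<le> PF r VF EF \<xi>)"

end

context pgraph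
begin

text \<open>The missing degree is the size of the other parts minus the number of neighbours there,
  so the difference compares the degree of x with its degree in the complete multipartite graph on
  these parts.\<close>

lemma dB_dM:
  assumes x: "x < n"
  shows "real (dB x) - real (dM x) = (\<Sum>j<r. real (card (nb x j))) - (real n - real (card (V (\<pi> x))))"
proof -
  let ?J = "{..<r} - {\<pi> x}"
  have "mis x = (\<Union>j\<in>?J. V j - nb x j)" using pi by (auto simp: mis_def V_def nb_def)
  also have "card \<dots> = (\<Sum>j\<in>?J. card (V j - nb x j))"
    by (rule card_UN_disjoint) (auto simp: finite_V V_def)
  also have "\<dots> = (\<Sum>j\<in>?J. card (V j) - card (nb x j))"
    by (intro sum.cong refl card_Diff_subset finite_nb nb_sub)
  finally have "real (dM x) = (\<Sum>j\<in>?J. real (card (V j) - card (nb x j)))" by (simp add: dM_def)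
  also have "\<dots> = (\<Sum>j\<in>?J. real (card (V j)) - real (card (nb x j)))"
    using card_mono[OF finite_V nb_sub] by (intro sum.cong refl of_nat_diff) auto
  also have "\<dots> = (\<Sum>j\<in>?J. real (card (V j))) - (\<Sum>j\<in>?J. real (card (nb x j)))" by (rule sum_subtractf)
  finally have dM: "real (dM x) = (\<Sum>j\<in>?J. real (card (V j))) - (\<Sum>j\<in>?J. real (card (nb x j)))" .
  have 1: "(\<Sum>j<r. real (card (V j))) = real (card (V (\<pi> x))) + (\<Sum>j\<in>?J. real (card (V j)))"
    using pi by (intro sum.remove) auto
  have 2: "(\<Sum>j<r. real (card (nb x j))) = real (dB x) + (\<Sum>j\<in>?J. real (card (nb x j)))"
    unfolding dB_def using pi by (intro sum.remove) auto
  have "(\<Sum>j<r. card (V j)) = n" using card_cross_pairs(2)[of n \<pi> r] pi by (simp add: V_def)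
  then have "(\<Sum>j<r. real (card (V j))) = real n" by (simp flip: of_nat_sum)
  then show ?thesis using dM 1 2 by linarith
qed

text \<open>Each of the f - 1 factors shrinks by 1 - \<theta>, in all a loss of at most f \<theta>
  by Bernoulli. The maps lost to \<open>Rbad\<close> form an additive error f^2 \<mu>, made relative
  by the monomial being at least \<eta>^(f-1); this is why \<xi> must be at least \<eta> in every
  part.\<close>

lemma Phi_bound:
  assumes x: "x < n" "x \<in> L" and th: "0 \<le> \<theta>" "\<theta> \<le> 1"
    and Vj: "\<And>j. j < r \<Longrightarrow> real n / real r * (1 - \<theta>) \<le> real (card (V j - L))"
    and nbj: "\<And>j. j < r \<Longrightarrow> real n * \<xi> j * (1 - \<theta>) \<le> real (card (nb x j - L))"
    and xi: "\<And>j. j < r \<Longrightarrow> \<eta> \<le> \<xi> j" and eta: "0 < \<eta>" "\<eta> \<le> 1 / real r"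
    and mu: "real (card (Rbad n E \<pi>)) \<le> \<mu> * real n ^ 2" "\<mu> \<ge> 0"
    and e: "real f * \<theta> + real f ^ 2 * \<mu> / \<eta> ^ (f - 1) \<le> \<epsilon>"
  shows "(1 - \<epsilon>) * real n ^ (f - 1) * (real (aut VF EF) * PF r VF EF \<xi>) \<le> real (card (Phi n E L x))"
proof -
  have bern: "1 - real f * \<theta> \<le> (1 - \<theta>) ^ (f - 1)"
  proof -
    have "1 + real (f - 1) * (- \<theta>) \<le> (1 + (- \<theta>)) ^ (f - 1)" using th by (intro Bernoulli_inequality) auto
    moreover have "real (f - 1) * \<theta> \<le> real f * \<theta>" using th by (intro mult_right_mono) auto
    ultimately show ?thesis by simp
  qed
  have "(\<Sum>(u,c)\<in>KC. (1 - \<epsilon>) * real n ^ (f - 1) * monomial u c \<xi>) \<le> (\<Sum>(u,c)\<in>KC.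
     (\<Prod>w\<in>VF - {u}. if {u,w} \<in> EF then real (card (nb x (c w) - L)) else real (card (V (c w) - L)))
       - real f ^ 2 * \<mu> * real n ^ (f - 1))"
  proof (rule sum_mono, clarify)
    fix u c assume uc: "(u,c) \<in> KC"
    have m: "\<eta> ^ (f - 1) \<le> monomial u c \<xi>" using xi eta by (intro monomial_ge[OF uc]) auto
    have m0: "monomial u c \<xi> > 0" using m eta by (meson less_le_trans zero_less_power)
    have cW: "card (VF - {u}) = f - 1" using uc finV by (simp add: KC_def)
    have "(\<Prod>w\<in>VF - {u}. real n * (1 - \<theta>) * (if {u,w} \<in> EF then \<xi> (c w) else 1 / real r))
      \<le> (\<Prod>w\<in>VF - {u}. if {u,w} \<in> EF then real (card (nb x (c w) - L)) else real (card (V (c w) - L)))"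
    proof (rule prod_mono)
      fix w assume w: "w \<in> VF - {u}"
      have cw: "c w < r" by (rule KC_color[OF uc w])
      show "0 \<le> real n * (1 - \<theta>) * (if {u,w} \<in> EF then \<xi> (c w) else 1 / real r) \<and>
         real n * (1 - \<theta>) * (if {u,w} \<in> EF then \<xi> (c w) else 1 / real r) \<le>
         (if {u,w} \<in> EF then real (card (nb x (c w) - L)) else real (card (V (c w) - L)))"
        using Vj[OF cw] nbj[OF cw] xi[OF cw] eta th by (auto simp: mult_ac)
    qed
    moreover have "(\<Prod>w\<in>VF - {u}. real n * (1 - \<theta>) * (if {u,w} \<in> EF then \<xi> (c w) else 1 / real r))
      = real n ^ (f - 1) * (1 - \<theta>) ^ (f - 1) * monomial u c \<xi>"
      unfolding monomial_def by (simp only: prod.distrib prod_constant cW)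
    moreover have "real n ^ (f - 1) * (1 - real f * \<theta>) * monomial u c \<xi> \<le> real n ^ (f - 1) * (1 - \<theta>) ^ (f - 1) * monomial u c \<xi>"
      using bern m0 by (intro mult_right_mono mult_left_mono) auto
    moreover have "real f ^ 2 * \<mu> * real n ^ (f - 1) \<le> real n ^ (f - 1) * (real f ^ 2 * \<mu> / \<eta> ^ (f - 1)) * monomial u c \<xi>"
    proof -
      have "real f ^ 2 * \<mu> = real f ^ 2 * \<mu> / \<eta> ^ (f - 1) * \<eta> ^ (f - 1)" using eta by simp
      also have "\<dots> \<le> real f ^ 2 * \<mu> / \<eta> ^ (f - 1) * monomial u c \<xi>"
        using m mu(2) eta by (intro mult_left_mono) auto
      finally have "real n ^ (f - 1) * (real f ^ 2 * \<mu>) \<le> real n ^ (f - 1) * (real f ^ 2 * \<mu> / \<eta> ^ (f - 1) * monomial u c \<xi>)"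
        by (intro mult_left_mono) auto
      then show ?thesis by (simp add: mult_ac)
    qed
    moreover have "(1 - \<epsilon>) * real n ^ (f - 1) * monomial u c \<xi> \<le>
      (1 - real f * \<theta> - real f ^ 2 * \<mu> / \<eta> ^ (f - 1)) * real n ^ (f - 1) * monomial u c \<xi>"
      using e m0 by (intro mult_right_mono) auto
    moreover have "(1 - real f * \<theta> - real f ^ 2 * \<mu> / \<eta> ^ (f - 1)) * real n ^ (f - 1) * monomial u c \<xi> =
       real n ^ (f - 1) * (1 - real f * \<theta>) * monomial u c \<xi> - real n ^ (f - 1) * (real f ^ 2 * \<mu> / \<eta> ^ (f - 1)) * monomial u c \<xi>"
      by (simp add: algebra_simps)
    ultimately show "(1 - \<epsilon>) * real n ^ (f - 1) * monomial u c \<xi> \<le>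
      (\<Prod>w\<in>VF - {u}. if {u,w} \<in> EF then real (card (nb x (c w) - L)) else real (card (V (c w) - L)))
       - real f ^ 2 * \<mu> * real n ^ (f - 1)" by linarith
  qed
  also have "\<dots> \<le> real (card (Phi n E L x))"
    by (rule Phi_lower[where D = "\<lambda>j. nb x j - L" and S = "\<lambda>j. V j - L", OF x _ _ mu])
       (auto simp: nb_def V_def dest: E_bound)
  also have "(\<Sum>(u,c)\<in>KC. (1 - \<epsilon>) * real n ^ (f - 1) * monomial u c \<xi>) = (1 - \<epsilon>) * real n ^ (f - 1) * (\<Sum>(u,c)\<in>KC. monomial u c \<xi>)"
    by (simp add: sum_distrib_left case_prod_beta)
  also have "(\<Sum>(u,c)\<in>KC. monomial u c \<xi>) = real (aut VF EF) * PF r VF EF \<xi>" unfolding PF_eq using aut_pos by simp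
  finally show ?thesis .
qed

text \<open>The candidate sets are the parts without L, x and y and, except for the part of x and y
  itself, without the vertices missed by x or y. Small missing degrees let them keep the proportion
  1 - \<theta> of n/r.\<close>

lemma Psi_bound:
  assumes xy: "(x,y) \<in> B2" "x \<notin> L" "y \<notin> L" and th: "0 \<le> \<theta>" "\<theta> \<le> 1"
    and Vj: "\<And>j. j < r \<Longrightarrow> real n / real r * (1 - \<theta>) + real (dM x) + real (dM y) + 2 \<le> real (card (V j - L))"
    and mu: "real (card (Rbad n E \<pi>)) \<le> \<mu> * real n ^ 2" "\<mu> \<ge> 0"
    and e: "real f * \<theta> + real f ^ 2 * \<mu> * real r ^ (f - 2) \<le> \<epsilon>"
  shows "(1 - \<epsilon>) * real n ^ (f - 2) * (real (aut VF EF) * a0) \<le> real (card (Psi n E \<pi> L {x,y}))"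
proof -
  define g where "g = real n / real r * (1 - \<theta>)"
  have r0: "real r > 0" using r2 by simp
  have g0: "g \<ge> 0" using th by (simp add: g_def)
  define G where "G = (\<lambda>j. V j - L - ({x,y} \<union> (if j = \<pi> x then {} else mis x \<union> mis y)))"
  have b: "\<pi> x = \<pi> y" "{x,y} \<in> E" "x < n" "y < n" "x \<noteq> y" using xy E_bound by (auto simp: B2_def)
  have gG: "g \<le> real (card (G j))" if "j < r" for j
  proof -
    let ?R = "{x,y} \<union> (if j = \<pi> x then {} else mis x \<union> mis y)"
    have finR: "finite ?R" using finite_mis by auto
    have "card ?R \<le> card {x,y} + card (mis x \<union> mis y)"
      by (rule order_trans[OF card_Un_le]) auto
    also have "\<dots> \<le> 2 + (dM x + dM y)" unfolding dM_def using b(5) card_Un_le[of "mis x" "mis y"] by simp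
    finally have "card ?R \<le> 2 + dM x + dM y" by simp
    moreover have "card (V j - L) \<le> card (G j) + card ?R"
      unfolding G_def using diff_card_le_card_Diff[OF finR, of "V j - L"] by linarith
    ultimately have "real (card (V j - L)) \<le> real (card (G j)) + 2 + real (dM x) + real (dM y)" by linarith
    then show ?thesis using Vj[OF that] by (simp add: g_def)
  qed
  have bern: "1 - real f * \<theta> \<le> (1 - \<theta>) ^ (f - 2)"
  proof -
    have "1 + real (f - 2) * (- \<theta>) \<le> (1 + (- \<theta>)) ^ (f - 2)" using th by (intro Bernoulli_inequality) auto
    moreover have "real (f - 2) * \<theta> \<le> real f * \<theta>" using th by (intro mult_right_mono) auto
    ultimately show ?thesis by simp
  qed
  have ps: "real N * (g ^ (f - 2) - real f ^ 2 * \<mu> * real n ^ (f - 2)) \<le> real (card (Psi n E \<pi> L {x,y}))"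
  proof (rule Psi_lower[where i = "\<pi> x" and G = G])
    fix j z assume "j < r" "z \<in> G j"
    then have z: "z < n" "\<pi> z = j" "z \<notin> L" "z \<noteq> x" "z \<noteq> y" "j \<noteq> \<pi> x \<longrightarrow> z \<notin> mis x \<and> z \<notin> mis y"
      by (auto simp: G_def V_def split: if_splits)
    have "j \<noteq> \<pi> x \<longrightarrow> {x,z} \<in> E \<and> {y,z} \<in> E" using z b(1) by (auto simp: mis_def)
    then show "z < n \<and> \<pi> z = j \<and> z \<notin> L \<and> z \<noteq> x \<and> z \<noteq> y \<and> (j \<noteq> \<pi> x \<longrightarrow> {x,z} \<in> E \<and> {y,z} \<in> E)"
      using z by simp
  qed (use b xy gG g0 mu pi in auto)
  have "g ^ (f - 2) = real n ^ (f - 2) * (1 / real r) ^ (f - 2) * (1 - \<theta>) ^ (f - 2)"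
    unfolding g_def by (simp add: power_mult_distrib power_divide)
  moreover have "real n ^ (f - 2) * (1 / real r) ^ (f - 2) * (1 - real f * \<theta>) \<le> real n ^ (f - 2) * (1 / real r) ^ (f - 2) * (1 - \<theta>) ^ (f - 2)"
    using bern by (intro mult_left_mono) auto
  moreover have "real f ^ 2 * \<mu> * real n ^ (f - 2) = real n ^ (f - 2) * (1 / real r) ^ (f - 2) * (real f ^ 2 * \<mu> * real r ^ (f - 2))"
    using r0 by (simp add: power_divide)
  moreover have "real n ^ (f - 2) * (1 / real r) ^ (f - 2) * (1 - \<epsilon>) \<le>
     real n ^ (f - 2) * (1 / real r) ^ (f - 2) * (1 - real f * \<theta> - real f ^ 2 * \<mu> * real r ^ (f - 2))"
    using e by (intro mult_left_mono) auto
  moreover have "real n ^ (f - 2) * (1 / real r) ^ (f - 2) * (1 - real f * \<theta> - real f ^ 2 * \<mu> * real r ^ (f - 2)) =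
     real n ^ (f - 2) * (1 / real r) ^ (f - 2) * (1 - real f * \<theta>) - real n ^ (f - 2) * (1 / real r) ^ (f - 2) * (real f ^ 2 * \<mu> * real r ^ (f - 2))"
    by (simp only: right_diff_distrib)
  ultimately have "real n ^ (f - 2) * (1 / real r) ^ (f - 2) * (1 - \<epsilon>) \<le> g ^ (f - 2) - real f ^ 2 * \<mu> * real n ^ (f - 2)"
    by linarith
  then have "real N * (real n ^ (f - 2) * (1 / real r) ^ (f - 2) * (1 - \<epsilon>)) \<le> real (card (Psi n E \<pi> L {x,y}))"
    using ps by (meson mult_left_mono of_nat_0_le_iff order_trans)
  moreover have "real (aut VF EF) * a0 = real N * (1 / real r) ^ (f - 2)" unfolding a0_def using aut_pos by simp
  ultimately show ?thesis by (simp add: mult_ac)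
qed

text \<open>Either one vertex of L lies in enough copies by itself, or at every vertex of L the
  minimum in \<open>PF_dominates\<close> is the surplus term, and the surplus can be charged:
  \<alpha>_F n^(f-2) copies to each inner edge away from L, P_F(\<xi>) n^(f-1) to each vertex of L.
  Here \<beta> measures unequal parts, \<kappa> the size of L, \<theta> the relative loss in
  candidate sets, \<mu> the density of \<open>Rbad\<close>.\<close>

lemma emb_ge_partitioned:
  fixes \<epsilon> \<theta> \<eta> \<beta> \<kappa> \<mu> :: real
  assumes eps: "0 < \<epsilon>" "\<epsilon> < 1" and th: "0 \<le> \<theta>" "\<theta> \<le> 1"
    and eta: "0 < \<eta>" "\<eta> \<le> 1 / real r" and bl: "0 \<le> \<beta>" "0 \<le> \<kappa>"
    and c3: "real r * (\<beta> + \<kappa> + 8 * \<eta> + 2 / real n) \<le> \<theta>"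
    and c4: "\<kappa> \<le> \<theta> * \<eta>" and c5: "\<kappa> \<le> 2 * \<eta>"
    and c6: "real f * \<theta> + real f ^ 2 * \<mu> / \<eta> ^ (f - 1) \<le> \<epsilon>"
    and c7: "a0 * ((real r + 1) * \<beta> + \<kappa>) \<le> \<epsilon> * (\<eta> ^ (f - 1) / real (aut VF EF))"
    and B: "real (card B2) \<le> \<kappa> * \<eta> * real n ^ 2"
    and V: "\<And>i. i < r \<Longrightarrow> \<bar>real (card (V i)) - real n / real r\<bar> \<le> \<beta> * real n"
    and mu: "real (card (Rbad n E \<pi>)) \<le> \<mu> * real n ^ 2" "\<mu> \<ge> 0"
    and cut: "\<And>x j. j < r \<Longrightarrow> dB x \<le> card (nb x j)"
    and q: "card E \<ge> card (turan_edges r n) + q" and hyp: "PF_dominates (real q / real n)"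
  shows "(1 - \<epsilon>) * (real (aut VF EF) * (a0 * real q * real n ^ (f - 2))) \<le> (1 + \<epsilon>) * real (card (emb VF EF n E))"
proof -
  have r0: "real r > 0" and n0': "real n > 0" using r2 n0 by auto
  define L where "L = {x. x < n \<and> \<eta> * real n \<le> real (dB x)}"
  define X where "X = {x. x < n \<and> x \<notin> L \<and> (4 * \<eta>) * real n < real (dM x)}"
  define B0 where "B0 = {(x,y) \<in> B2. x \<notin> L \<and> y \<notin> L \<and> x \<notin> X \<and> y \<notin> X}"
  define B1 where "B1 = {(x,y) \<in> B0. x < y}"
  have Ls: "L \<subseteq> {..<n}" by (auto simp: L_def)
  have finL: "finite L" by (rule finite_subset[OF Ls]) simp
  have finB0: "finite B0" using finite_B2 by (auto simp: B0_def intro: finite_subset[of _ B2])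
  have finB1: "finite B1" using finB0 by (auto simp: B1_def intro: finite_subset[of _ B0])
  \<comment> \<open>Each vertex of L carries at least \<eta> n of the at most \<kappa> \<eta> n^2
    pairs in \<open>B2\<close>.\<close>
  have cL: "real (card L) \<le> \<kappa> * real n"
  proof -
    have "real (card L) * (\<eta> * real n) \<le> real (card B2)" by (rule card_B2_ge[OF Ls]) (auto simp: L_def)
    also have "\<dots> \<le> (\<kappa> * real n) * (\<eta> * real n)" using B by (simp add: power2_eq_square mult_ac)
    finally show ?thesis using eta n0' by (simp add: mult_le_cancel_right_pos)
  qed
  have LV: "real (card A) - \<kappa> * real n \<le> real (card (A - L))" if "finite A" for A
  proof -
    have "card A \<le> card (A - L) + card L" using diff_card_le_card_Diff[OF finL, of A] by linarith
    then have "real (card A) \<le> real (card (A - L)) + real (card L)" by linarith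
    then show ?thesis using cL by linarith
  qed
  have VL: "real n / real r - (\<beta> + \<kappa>) * real n \<le> real (card (V j - L))" if "j < r" for j
    using LV[OF finite_V, of j] V[OF that] by (simp add: algebra_simps)
  have c3n: "(\<beta> + \<kappa> + 8 * \<eta>) * real n + 2 \<le> real n / real r * \<theta>"
  proof -
    have "real n / real r * (real r * (\<beta> + \<kappa> + 8 * \<eta> + 2 / real n)) \<le> real n / real r * \<theta>"
      using c3 by (intro mult_left_mono) auto
    then show ?thesis using r0 n0' by (simp add: algebra_simps)
  qed
  have acct: "2 * real q \<le> 2 * (\<Sum>x\<in>L. real (dB x) - real (dM x)) + real (card L) ^ 2 + real (card B0)"
  proof (rule surplus_split[OF q L_def X_def _ _ _ B0_def])
    have "\<kappa> * real n \<le> 2 * \<eta> * real n" using c5 by (intro mult_right_mono) auto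
    then show "real (card L) \<le> 4 * \<eta> / 2 * real n" using cL by simp
  qed (use eta in auto)
  have B01: "card B0 = 2 * card B1"
  proof -
    have sym: "(b,a) \<in> B0" if "(a,b) \<in> B0" for a b using that by (auto simp: B0_def B2_def insert_commute)
    have neq: "a \<noteq> b" if "(a,b) \<in> B0" for a b using that E_bound by (auto simp: B0_def B2_def)
    have "B0 = B1 \<union> (\<lambda>(a,b). (b,a)) ` B1"
    proof
      show "B0 \<subseteq> B1 \<union> (\<lambda>(a,b). (b,a)) ` B1"
      proof (rule subrelI)
        fix a b assume ab: "(a,b) \<in> B0"
        show "(a,b) \<in> B1 \<union> (\<lambda>(a,b). (b,a)) ` B1"
        proof (cases "a < b")
          case True then show ?thesis using ab by (simp add: B1_def)
        next
          case False then have "(b,a) \<in> B1" using sym[OF ab] neq[OF ab] by (simp add: B1_def)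
          then show ?thesis by force
        qed
      qed
      show "B1 \<union> (\<lambda>(a,b). (b,a)) ` B1 \<subseteq> B0" using sym by (auto simp: B1_def)
    qed
    moreover have "card (B1 \<union> (\<lambda>(a,b). (b,a)) ` B1) = card B1 + card ((\<lambda>(a,b). (b,a)) ` B1)"
      using finB1 by (intro card_Un_disjoint) (auto simp: B1_def)
    moreover have "card ((\<lambda>(a,b). (b,a)) ` B1) = card B1" by (rule card_image) (auto simp: inj_on_def)
    ultimately show ?thesis by simp
  qed
  \<comment> \<open>Clipping at 1/r puts \<xi> into the domain of \<open>PF_dominates\<close>. As
    parts have at most n/r + \<beta> n vertices, it hides at most \<beta> n neighbours per
    part.\<close>
  define \<xi> where "\<xi> = (\<lambda>x j. min (real (card (nb x j)) / real n) (1 / real r))"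
  define P where "P = (\<lambda>x. PF r VF EF (\<xi> x))"
  have xi: "\<eta> \<le> \<xi> x j" "\<xi> x j \<le> 1 / real r" if "x \<in> L" "j < r" for x j
  proof -
    \<comment> \<open>Minimality of the partition: x has at least as many neighbours in part j as in
      its own part, where it has at least \<eta> n.\<close>
    have "\<eta> * real n \<le> real (card (nb x j))" using that cut[of j x] by (auto simp: L_def)
    then show "\<eta> \<le> \<xi> x j" using eta n0' by (simp add: \<xi>_def pos_le_divide_eq)
    show "\<xi> x j \<le> 1 / real r" by (simp add: \<xi>_def)
  qed
  have Phi: "(1 - \<epsilon>) * real n ^ (f - 1) * (real (aut VF EF) * P x) \<le> real (card (Phi n E L x))" if x: "x \<in> L" for x
    unfolding P_def
  proof (rule Phi_bound[OF _ x th _ _ _ eta mu c6])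
    show "x < n" using x Ls by auto
    show "real n / real r * (1 - \<theta>) \<le> real (card (V j - L))" if "j < r" for j
    proof -
      have "(\<beta> + \<kappa>) * real n \<le> (\<beta> + \<kappa> + 8 * \<eta>) * real n" using eta by (intro mult_right_mono) auto
      then show ?thesis using VL[OF that] c3n by (simp add: right_diff_distrib)
    qed
    show "\<eta> \<le> \<xi> x j" if "j < r" for j using xi[OF x that] by simp
    show "real n * \<xi> x j * (1 - \<theta>) \<le> real (card (nb x j - L))" if j: "j < r" for j
    proof -
      have "\<xi> x j \<le> real (card (nb x j)) / real n" by (simp add: \<xi>_def)
      then have "real n * \<xi> x j \<le> real (card (nb x j))" using n0' by (simp add: pos_le_divide_eq mult.commute)
      moreover have "\<kappa> * real n \<le> \<theta> * \<xi> x j * real n"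
        using c4 mult_left_mono[OF xi(1)[OF x j] th(1)] by (intro mult_right_mono) auto
      ultimately show ?thesis using LV[OF finite_nb, of x j] by (simp add: algebra_simps)
    qed
  qed
  have Psi: "(1 - \<epsilon>) * real n ^ (f - 2) * (real (aut VF EF) * a0) \<le> real (card (Psi n E \<pi> L {x,y}))" if xy: "(x,y) \<in> B1" for x y
  proof (rule Psi_bound[OF _ _ _ th _ mu])
    show "(x,y) \<in> B2" "x \<notin> L" "y \<notin> L" using xy by (auto simp: B1_def B0_def)
    have "x \<notin> X" "y \<notin> X" "x < n" "y < n" using xy E_bound by (auto simp: B1_def B0_def B2_def)
    then have d: "real (dM x) \<le> 4 * \<eta> * real n" "real (dM y) \<le> 4 * \<eta> * real n"
      using \<open>x \<notin> L\<close> \<open>y \<notin> L\<close> by (auto simp: X_def)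
    show "real n / real r * (1 - \<theta>) + real (dM x) + real (dM y) + 2 \<le> real (card (V j - L))" if "j < r" for j
    proof -
      have "real n / real r * (1 - \<theta>) = real n / real r - real n / real r * \<theta>" by (simp add: right_diff_distrib)
      moreover have "(\<beta> + \<kappa> + 8 * \<eta>) * real n = (\<beta> + \<kappa>) * real n + 2 * (4 * \<eta> * real n)" by (simp add: distrib_right)
      ultimately show ?thesis using VL[OF that] c3n d by linarith
    qed
    have "real r ^ (f - 2) \<le> 1 / \<eta> ^ (f - 1)"
    proof -
      have "real r ^ (f - 2) \<le> real r ^ (f - 1)" using r2 by (intro power_increasing) auto
      also have "\<dots> \<le> (1 / \<eta>) ^ (f - 1)" using eta r0 by (intro power_mono) (auto simp: field_simps)
      finally show ?thesis by (simp add: power_divide)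
    qed
    then have "real f ^ 2 * \<mu> * real r ^ (f - 2) \<le> real f ^ 2 * \<mu> * (1 / \<eta> ^ (f - 1))"
      using mu(2) by (intro mult_left_mono) auto
    then show "real f * \<theta> + real f ^ 2 * \<mu> * real r ^ (f - 2) \<le> \<epsilon>" using c6 by simp
  qed
  have embs: "(\<Sum>x\<in>L. real (card (Phi n E L x))) + (\<Sum>(x,y)\<in>B1. real (card (Psi n E \<pi> L {x,y}))) \<le> real (card (emb VF EF n E))"
  proof -
    have "real ((\<Sum>x\<in>L. card (Phi n E L x)) + (\<Sum>(x,y)\<in>B1. card (Psi n E \<pi> L {x,y}))) \<le> real (card (emb VF EF n E))"
      by (intro of_nat_mono card_emb_ge[OF Ls _ finB1]) (auto simp: B1_def)
    then show ?thesis by (simp add: case_prod_beta)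
  qed
  have autp: "real (aut VF EF) > 0" using aut_pos by simp
  have fn: "real n ^ (f - 1) = real n * real n ^ (f - 2)"
  proof -
    have "f - 1 = Suc (f - 2)" using f_ge3 by simp
    then show ?thesis by simp
  qed
  have hy: "a0 * min ((\<Sum>j<r. \<xi> x j) - (real r - 1) / real r) (real q / real n) \<le> P x" if x: "x \<in> L" for x
  proof -
    have "\<forall>i<r. 0 \<le> \<xi> x i \<and> \<xi> x i \<le> 1 / real r" using xi[OF x] eta by force
    then show ?thesis using hyp unfolding PF_dominates_def P_def by blast
  qed
  show ?thesis
  proof (cases "\<exists>x\<in>L. a0 * (real q / real n) \<le> P x")
    \<comment> \<open>One vertex settles the count, since n^(f-1) a0 q/n = a0 q n^(f-2).\<close>
    case True
    then obtain x where x: "x \<in> L" "a0 * (real q / real n) \<le> P x" by blast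
    have "real (aut VF EF) * (a0 * real q * real n ^ (f - 2)) = real n ^ (f - 1) * (real (aut VF EF) * (a0 * (real q / real n)))"
      unfolding fn using n0' by simp
    also have "\<dots> \<le> real n ^ (f - 1) * (real (aut VF EF) * P x)" using x(2) by (intro mult_left_mono) auto
    finally have "(1 - \<epsilon>) * (real (aut VF EF) * (a0 * real q * real n ^ (f - 2))) \<le> (1 - \<epsilon>) * (real n ^ (f - 1) * (real (aut VF EF) * P x))"
      using eps by (intro mult_left_mono) auto
    also have "\<dots> \<le> real (card (Phi n E L x))" using Phi[OF x(1)] by (simp add: mult.assoc)
    also have "\<dots> \<le> real (card (emb VF EF n E))"
      by (intro of_nat_mono card_mono finite_emb finV) (auto simp: Phi_def)
    also have "\<dots> \<le> (1 + \<epsilon>) * real (card (emb VF EF n E))" using eps by (simp add: mult_le_cancel_right1)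
    finally show ?thesis .
  next
    case False
    \<comment> \<open>As P x < a0 q/n, the minimum in \<open>PF_dominates\<close> must be the
      surplus. The errors (r+1) \<beta> from unequal parts and \<kappa> from pairs inside L are
      absorbed by \<epsilon> P x, through \<open>PF_ge\<close> and \<open>c7\<close>.\<close>
    have each: "a0 * (real (dB x) - real (dM x) + \<kappa> * real n / 2) \<le> (1 + \<epsilon>) * (real n * P x)" if x: "x \<in> L" for x
    proof -
      have "a0 * (real q / real n) > P x" using False x by force
      then have Px: "a0 * ((\<Sum>j<r. \<xi> x j) - (real r - 1) / real r) \<le> P x"
        using hy[OF x] by (auto simp: min_def split: if_splits)
      have nbx: "real (card (nb x j)) \<le> real n * (\<xi> x j + \<beta>)" if j: "j < r" for j
      proof -
        have "real (card (nb x j)) \<le> real (card (V j))" by (intro of_nat_mono card_mono finite_V nb_sub)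
        also have "\<dots> \<le> real n / real r + \<beta> * real n" using V[OF j] by linarith
        finally have 1: "real (card (nb x j)) \<le> real n / real r + \<beta> * real n" .
        show ?thesis
        proof (cases "real (card (nb x j)) / real n \<le> 1 / real r")
          case True
          then have "real n * \<xi> x j = real (card (nb x j))" using n0' by (simp add: \<xi>_def)
          then show ?thesis using bl n0' by (simp add: distrib_left)
        next
          case False
          then have "\<xi> x j = 1 / real r" by (simp add: \<xi>_def)
          then show ?thesis using 1 by (simp add: algebra_simps)
        qed
      qed
      have "real (dB x) - real (dM x) = (\<Sum>j<r. real (card (nb x j))) - (real n - real (card (V (\<pi> x))))"
        using x Ls by (intro dB_dM) auto
      also have "\<dots> \<le> (\<Sum>j<r. real n * (\<xi> x j + \<beta>)) - (real n - (real n / real r + \<beta> * real n))"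
        using V[OF pi, of x] nbx by (intro diff_mono sum_mono) auto
      also have "\<dots> = real n * ((\<Sum>j<r. \<xi> x j) - (real r - 1) / real r + (real r + 1) * \<beta>)"
        using r0 by (simp add: sum_distrib_left[symmetric] sum.distrib field_simps)
      finally have a: "real (dB x) - real (dM x) \<le> real n * ((\<Sum>j<r. \<xi> x j) - (real r - 1) / real r + (real r + 1) * \<beta>)" .
      have "real (dB x) - real (dM x) + \<kappa> * real n / 2 \<le>
         real n * ((\<Sum>j<r. \<xi> x j) - (real r - 1) / real r + ((real r + 1) * \<beta> + \<kappa>))"
      proof -
        have "0 \<le> \<kappa> * real n" using bl by simp
        moreover have "real n * ((\<Sum>j<r. \<xi> x j) - (real r - 1) / real r + ((real r + 1) * \<beta> + \<kappa>)) =
          real n * ((\<Sum>j<r. \<xi> x j) - (real r - 1) / real r + (real r + 1) * \<beta>) + \<kappa> * real n"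
          by (simp add: distrib_left mult.commute)
        ultimately show ?thesis using a by linarith
      qed
      then have "a0 * (real (dB x) - real (dM x) + \<kappa> * real n / 2) \<le>
         a0 * (real n * ((\<Sum>j<r. \<xi> x j) - (real r - 1) / real r + ((real r + 1) * \<beta> + \<kappa>)))"
        using a0_pos by (intro mult_left_mono) auto
      also have "\<dots> = real n * (a0 * ((\<Sum>j<r. \<xi> x j) - (real r - 1) / real r) + a0 * ((real r + 1) * \<beta> + \<kappa>))"
        by (simp only: distrib_left mult_ac)
      also have "\<dots> \<le> real n * (P x + \<epsilon> * P x)"
      proof (intro mult_left_mono add_mono Px)
        have "\<eta> ^ (f - 1) / real (aut VF EF) \<le> P x" unfolding P_def
          using xi[OF x] eta by (intro PF_ge) auto
        then have "\<epsilon> * (\<eta> ^ (f - 1) / real (aut VF EF)) \<le> \<epsilon> * P x" using eps by (intro mult_left_mono) auto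
        then show "a0 * ((real r + 1) * \<beta> + \<kappa>) \<le> \<epsilon> * P x" using c7 by linarith
      qed simp
      also have "\<dots> = (1 + \<epsilon>) * (real n * P x)" by (simp add: algebra_simps)
      finally show ?thesis .
    qed
    define S where "S = (\<Sum>x\<in>L. real n * P x)"
    \<comment> \<open>The correction |L|^2 of the balance is shared out as \<kappa> n/2 per vertex
      of L, the extra summand carried in \<open>each\<close>.\<close>
    have "real (card L) ^ 2 \<le> real (card L) * (\<kappa> * real n)" unfolding power2_eq_square
      using cL by (intro mult_left_mono) auto
    then have "real q \<le> (\<Sum>x\<in>L. real (dB x) - real (dM x)) + real (card L) * (\<kappa> * real n) / 2 + real (card B1)"
      using acct B01 by simp
    also have "\<dots> = (\<Sum>x\<in>L. real (dB x) - real (dM x) + \<kappa> * real n / 2) + real (card B1)"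
      by (simp add: sum.distrib)
    finally have "a0 * real q \<le> a0 * ((\<Sum>x\<in>L. real (dB x) - real (dM x) + \<kappa> * real n / 2) + real (card B1))"
      using a0_pos by (intro mult_left_mono) auto
    also have "\<dots> = (\<Sum>x\<in>L. a0 * (real (dB x) - real (dM x) + \<kappa> * real n / 2)) + a0 * real (card B1)"
      by (simp add: distrib_left sum_distrib_left)
    also have "\<dots> \<le> (\<Sum>x\<in>L. (1 + \<epsilon>) * (real n * P x)) + (1 + \<epsilon>) * (a0 * real (card B1))"
    proof (intro add_mono sum_mono each)
      have "0 \<le> a0 * real (card B1)" using a0_pos by simp
      then show "a0 * real (card B1) \<le> (1 + \<epsilon>) * (a0 * real (card B1))" using eps by (simp add: distrib_right)
    qed
    also have "\<dots> = (1 + \<epsilon>) * (S + a0 * real (card B1))" by (simp add: S_def sum_distrib_left distrib_left)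
    finally have qS: "a0 * real q \<le> (1 + \<epsilon>) * (S + a0 * real (card B1))" .
    have "(1 - \<epsilon>) * real (aut VF EF) * real n ^ (f - 2) * (S + a0 * real (card B1)) \<le> real (card (emb VF EF n E))"
    proof -
      have "(1 - \<epsilon>) * real (aut VF EF) * real n ^ (f - 2) * S = (\<Sum>x\<in>L. (1 - \<epsilon>) * real n ^ (f - 1) * (real (aut VF EF) * P x))"
        unfolding S_def sum_distrib_left fn by (intro sum.cong refl) (simp add: mult_ac)
      also have "\<dots> \<le> (\<Sum>x\<in>L. real (card (Phi n E L x)))" by (intro sum_mono Phi)
      finally have 1: "(1 - \<epsilon>) * real (aut VF EF) * real n ^ (f - 2) * S \<le> (\<Sum>x\<in>L. real (card (Phi n E L x)))" .
      have "(1 - \<epsilon>) * real (aut VF EF) * real n ^ (f - 2) * (a0 * real (card B1)) = (\<Sum>p\<in>B1. (1 - \<epsilon>) * real n ^ (f - 2) * (real (aut VF EF) * a0))"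
        by (simp add: mult_ac)
      also have "\<dots> \<le> (\<Sum>p\<in>B1. real (card (Psi n E \<pi> L {fst p, snd p})))"
        by (intro sum_mono Psi) auto
      finally have 2: "(1 - \<epsilon>) * real (aut VF EF) * real n ^ (f - 2) * (a0 * real (card B1)) \<le> (\<Sum>(x,y)\<in>B1. real (card (Psi n E \<pi> L {x,y})))"
        by (simp add: case_prod_beta)
      show ?thesis using 1 2 embs by (simp only: distrib_left)
    qed
    then have "(1 + \<epsilon>) * ((1 - \<epsilon>) * real (aut VF EF) * real n ^ (f - 2) * (S + a0 * real (card B1))) \<le> (1 + \<epsilon>) * real (card (emb VF EF n E))"
      using eps by (intro mult_left_mono) auto
    moreover have "(1 - \<epsilon>) * real (aut VF EF) * real n ^ (f - 2) * (a0 * real q) \<le> (1 - \<epsilon>) * real (aut VF EF) * real n ^ (f - 2) * ((1 + \<epsilon>) * (S + a0 * real (card B1)))"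
      using qS eps by (intro mult_left_mono) auto
    ultimately show ?thesis by (simp add: mult_ac)
  qed
qed

end

context critical
begin

text \<open>Argued by contradiction because stability speaks only about graphs with few copies; if
  copies abound there is nothing to show.\<close>

lemma copies_ge:
  fixes \<epsilon> :: real
  assumes eps: "0 < \<epsilon>" "\<epsilon> < 1"
  obtains \<delta> n0 where "\<delta> > 0" "\<And>n q E. n \<ge> n0 \<Longrightarrow> E \<subseteq> pairs n \<Longrightarrow> card E \<ge> card (turan_edges r n) + q \<Longrightarrow>
     real q \<le> \<delta> * real n ^ 2 \<Longrightarrow> PF_dominates (real q / real n) \<Longrightarrow>
     (1 - \<epsilon>) * (a0 * real q * real n ^ (f - 2)) \<le> real (num_copies VF EF {0..<n} E)"
proof -
  define a where "a = real (aut VF EF)"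
  define R where "R = real r"
  define F where "F = real f"
  have a1: "a > 0" using aut_pos by (simp add: a_def)
  have R2: "R \<ge> 2" using r2 by (simp add: R_def)
  have F3: "F \<ge> 3" using f_ge3 by (simp add: F_def)
  \<comment> \<open>Half of \<epsilon>, since the factor obtained is (1-e)/(1+e) and (1+e)(1-2e)
    \<le> 1-e.\<close>
  define e where "e = \<epsilon> / 2"
  have e: "0 < e" "e < 1" using eps by (auto simp: e_def)
  define \<theta> where "\<theta> = e / (2 * F)"
  have th: "0 < \<theta>" "\<theta> \<le> 1" using e F3 by (auto simp: \<theta>_def field_simps)
  define \<eta> where "\<eta> = \<theta> / (32 * R)"
  have eta: "0 < \<eta>" "\<eta> \<le> 1 / R" using th R2 by (auto simp: \<eta>_def field_simps)
  \<comment> \<open>The value of \<open>P_F\<close> guaranteed at a vertex of L; \<kappa> and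
    \<beta> are chosen so that the errors they cause cost at most e p/2 each.\<close>
  define p where "p = \<eta> ^ (f - 1) / a"
  have p: "p > 0" using eta a1 by (simp add: p_def)
  define \<kappa> where "\<kappa> = min (\<theta> * \<eta>) (e * p / (2 * a0))"
  have ka: "\<kappa> > 0" "\<kappa> \<le> \<theta> * \<eta>" "\<kappa> \<le> e * p / (2 * a0)" using th eta e p a0_pos by (auto simp: \<kappa>_def)
  define \<beta> where "\<beta> = min (\<theta> / (8 * R)) (e * p / (2 * a0 * (R + 1)))"
  have be: "\<beta> > 0" "\<beta> \<le> \<theta> / (8 * R)" "\<beta> \<le> e * p / (2 * a0 * (R + 1))" using th R2 e p a0_pos by (auto simp: \<beta>_def)
  define \<mu> where "\<mu> = e * \<eta> ^ (f - 1) / (2 * F ^ 2)"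
  have mu: "\<mu> > 0" using e eta F3 by (simp add: \<mu>_def)
  \<comment> \<open>The density of inner pairs to be asked of stability. Its bounds limit the size
    of L, half of \<open>Rbad\<close>, and half of the squared deviation of part sizes; the other
    halves are left for terms of order n.\<close>
  define \<nu> where "\<nu> = min (\<kappa> * \<eta>) (min (\<mu> / 2) (\<beta>\<^sup>2 / 2))"
  have nu: "\<nu> > 0" "\<nu> \<le> \<kappa> * \<eta>" "\<nu> \<le> \<mu> / 2" "\<nu> \<le> \<beta>\<^sup>2 / 2" using ka eta mu be by (auto simp: \<nu>_def)
  obtain \<delta>s ns where ds: "\<delta>s > 0" and stab: "\<And>n E. n \<ge> ns \<Longrightarrow> E \<subseteq> pairs n \<Longrightarrow>
     (1 - 1 / real r) * real n ^ 2 / 2 - \<delta>s * real n ^ 2 \<le> real (card E) \<Longrightarrow>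
     real (card (emb VF EF n E)) \<le> \<delta>s * real n ^ f \<Longrightarrow>
     \<exists>\<pi>. (\<forall>z. \<pi> z < r) \<and> real (card {(a,b). \<pi> a = \<pi> b \<and> {a,b} \<in> E}) \<le> \<nu> * real n ^ 2"
    using stability[OF nu(1)] by blast
  \<comment> \<open>With q \<le> \<delta> n^2, fewer than a0 q n^(f-2) copies mean at most \<delta>s
    n^f embeddings, as stability requires.\<close>
  define \<delta> where "\<delta> = \<delta>s / (a * a0)"
  have del: "\<delta> > 0" using ds a1 a0_pos by (simp add: \<delta>_def)
  define T where "T = 1 + 16 * R / \<theta> + 2 / \<mu> + 2 * (2 + R) / \<beta>\<^sup>2 + (1 + R) / \<delta>s"
  have Tpos: "16 * R / \<theta> > 0" "2 / \<mu> > 0" "2 * (2 + R) / \<beta>\<^sup>2 > 0" "(1 + R) / \<delta>s > 0"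
    using R2 th mu be ds by auto
  obtain nT :: nat where nT: "real nT > T" using reals_Archimedean2 by blast
  show ?thesis
  proof (rule that[OF del, of "max ns nT"])
    fix n q E assume n: "n \<ge> max ns nT" and E: "E \<subseteq> pairs n" and cE: "card E \<ge> card (turan_edges r n) + q"
      and q: "real q \<le> \<delta> * real n ^ 2" and hyp: "PF_dominates (real q / real n)"
    have nT': "real n > T" using n nT by linarith
    have n1: "real n > 1" and nn: "real n \<ge> 16 * R / \<theta>" "real n \<ge> 2 / \<mu>" "real n \<ge> 2 * (2 + R) / \<beta>\<^sup>2" "real n \<ge> (1 + R) / \<delta>s"
      using nT' Tpos unfolding T_def by linarith+
    have ff: "real n ^ f = real n ^ 2 * real n ^ (f - 2)"
    proof -
      have "f = 2 + (f - 2)" using f_ge3 by simp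
      then show ?thesis by (metis power_add)
    qed
    show "(1 - \<epsilon>) * (a0 * real q * real n ^ (f - 2)) \<le> real (num_copies VF EF {0..<n} E)"
    proof (rule ccontr)
      assume "\<not> ?thesis"
      then have small: "real (num_copies VF EF {0..<n} E) < (1 - \<epsilon>) * (a0 * real q * real n ^ (f - 2))" by simp
      have ce: "real (card (emb VF EF n E)) = a * real (num_copies VF EF {0..<n} E)"
        unfolding a_def using card_emb[OF graph, of n E] by simp
      have "real (card (emb VF EF n E)) \<le> \<delta>s * real n ^ f"
      proof -
        have "real (num_copies VF EF {0..<n} E) \<le> (1 - \<epsilon>) * (a0 * real q * real n ^ (f - 2))" using small by simp
        also have "\<dots> \<le> 1 * (a0 * real q * real n ^ (f - 2))" using eps a0_pos by (intro mult_right_mono) auto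
        also have "\<dots> \<le> a0 * (\<delta> * real n ^ 2) * real n ^ (f - 2)"
          using q a0_pos by (simp add: mult_right_mono mult_left_mono)
        finally have "a * real (num_copies VF EF {0..<n} E) \<le> a * (a0 * (\<delta> * real n ^ 2) * real n ^ (f - 2))"
          using a1 by (intro mult_left_mono) auto
        also have "\<dots> = \<delta>s * real n ^ f" unfolding ff \<delta>_def using a1 a0_pos by simp
        finally show ?thesis unfolding ce .
      qed
      moreover have "(1 - 1 / real r) * real n ^ 2 / 2 - \<delta>s * real n ^ 2 \<le> real (card E)"
      proof -
        have "(1 + R) \<le> \<delta>s * real n" using nn(4) ds by (simp add: pos_divide_le_eq mult.commute)
        then have "(1 + R) * real n \<le> \<delta>s * real n * real n" by (intro mult_right_mono) auto
        moreover have "real n + R / 2 \<le> (1 + R) * real n"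
        proof -
          have "R / 2 \<le> R * real n" using R2 n1 by (simp add: mult_mono)
          then show ?thesis by (simp add: distrib_right)
        qed
        moreover have "(1 - 1 / real r) * real n ^ 2 - 2 * real n - real r \<le> 2 * real (card (turan_edges r n))"
          using r2 by (intro turan_lower) auto
        moreover have "real (card (turan_edges r n)) \<le> real (card E)" using cE by linarith
        moreover have "\<delta>s * real n * real n = \<delta>s * real n ^ 2" by (simp add: power2_eq_square)
        moreover have "Y / 2 - Z \<le> c" if "w \<le> Z'" "x + R / 2 \<le> w" "Y - 2 * x - R \<le> 2 * t" "t \<le> c" "Z' = Z"
          for Y Z Z' c w x t :: real using that by linarith
        ultimately show ?thesis unfolding R_def[symmetric] by blast
      qed
      ultimately obtain \<pi>0 where pi0: "\<forall>z. \<pi>0 z < r" "real (card {(a,b). \<pi>0 a = \<pi>0 b \<and> {a,b} \<in> E}) \<le> \<nu> * real n ^ 2"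
        using stab[of n E] n E by auto
      obtain \<pi> where cutp: "\<And>z. \<pi> z < r"
        "card {(a,b). \<pi> a = \<pi> b \<and> {a,b} \<in> E} \<le> card {(a,b). \<pi>0 a = \<pi>0 b \<and> {a,b} \<in> E}"
        "\<And>x j. j < r \<Longrightarrow> card {y. \<pi> y = \<pi> x \<and> {x,y} \<in> E} \<le> card {y. \<pi> y = j \<and> {x,y} \<in> E}"
        using max_cut_exists[OF E, of \<pi>0 r] pi0(1) by blast
      interpret pgraph r VF EF n E \<pi>
        using E cutp(1) n1 by unfold_locales auto
      have B: "real (card B2) \<le> \<nu> * real n ^ 2" unfolding B2_def using cutp(2) pi0(2) by linarith
      have sz: "\<bar>real (card (V i)) - real n / real r\<bar> \<le> \<beta> * real n" if "i < r" for i
      proof (rule part_sizes[OF _ _ _ that])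
        show "card (turan_edges r n) \<le> card E" using cE by simp
        have "2 * (2 + R) \<le> real n * \<beta>\<^sup>2" using nn(3) be by (simp add: pos_divide_le_eq)
        then have "2 * (2 + R) * real n \<le> real n * \<beta>\<^sup>2 * real n" by (intro mult_right_mono) auto
        then have 1: "(2 + R) * real n \<le> \<beta>\<^sup>2 / 2 * real n ^ 2" by (simp add: power2_eq_square algebra_simps)
        have "R * 1 \<le> R * real n" using R2 n1 by (intro mult_left_mono) auto
        then have 2: "2 * real n + R \<le> (2 + R) * real n" by (simp add: distrib_right)
        have "\<nu> * real n ^ 2 \<le> \<beta>\<^sup>2 / 2 * real n ^ 2" using nu(4) by (intro mult_right_mono) auto
        moreover have "\<beta>\<^sup>2 * real n ^ 2 = \<beta>\<^sup>2 / 2 * real n ^ 2 + \<beta>\<^sup>2 / 2 * real n ^ 2" by simp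
        ultimately show "real (card B2) + 2 * real n + real r \<le> \<beta>\<^sup>2 * (real n)\<^sup>2"
          using 1 2 B unfolding R_def[symmetric] by linarith
      qed (use be in simp)
      have Rb: "real (card (Rbad n E \<pi>)) \<le> \<mu> * real n ^ 2"
      proof -
        have "card M2 \<le> card B2" using surplus[OF cE] by linarith
        then have "real (card (Rbad n E \<pi>)) \<le> real n + real (card B2)" using card_Rbad by linarith
        moreover have "2 \<le> \<mu> * real n" using nn(2) mu by (simp add: pos_divide_le_eq mult.commute)
        then have "2 * real n \<le> \<mu> * real n * real n" by (intro mult_right_mono) auto
        then have "real n \<le> \<mu> / 2 * real n ^ 2" by (simp add: power2_eq_square)
        moreover have "\<nu> * real n ^ 2 \<le> \<mu> / 2 * real n ^ 2" using nu(3) by (intro mult_right_mono) auto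
        moreover have "\<mu> * real n ^ 2 = \<mu> / 2 * real n ^ 2 + \<mu> / 2 * real n ^ 2" by simp
        ultimately show ?thesis using B by linarith
      qed
      have emb_ge_partitioned': "(1 - e) * (real (aut VF EF) * (a0 * real q * real n ^ (f - 2))) \<le> (1 + e) * real (card (emb VF EF n E))"
      proof (rule emb_ge_partitioned[where \<theta> = \<theta> and \<eta> = \<eta> and \<beta> = \<beta> and \<kappa> = \<kappa> and \<mu> = \<mu>])
        have "\<theta> * \<eta> \<le> 1 * \<eta>" using th eta by (intro mult_right_mono) auto
        then have k1: "\<kappa> \<le> \<eta>" using ka(2) by simp
        then show "\<kappa> \<le> 2 * \<eta>" using eta by simp
        have "R * \<beta> \<le> \<theta> / 8" using be(2) R2 by (simp add: field_simps)
        moreover have "R * \<eta> = \<theta> / 32" using R2 by (simp add: \<eta>_def)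
        moreover have "R * \<kappa> \<le> R * \<eta>" using k1 R2 by (intro mult_left_mono) auto
        moreover have "R * (2 / real n) \<le> \<theta> / 8"
          using nn(1) th n1 by (simp add: field_simps)
        ultimately have "R * \<beta> + R * \<kappa> + 8 * (R * \<eta>) + R * (2 / real n) \<le> \<theta>" using th by linarith
        then show "real r * (\<beta> + \<kappa> + 8 * \<eta> + 2 / real n) \<le> \<theta>"
          unfolding R_def[symmetric] by (simp add: distrib_left)
        have h1: "F * \<theta> = e / 2" using F3 by (simp add: \<theta>_def)
        have h2: "F ^ 2 * \<mu> / \<eta> ^ (f - 1) = e / 2" using F3 eta by (simp add: \<mu>_def)
        show "real f * \<theta> + real f ^ 2 * \<mu> / \<eta> ^ (f - 1) \<le> e"
          unfolding F_def[symmetric] h1 h2 by simp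
        have "a0 * ((R + 1) * \<beta>) \<le> a0 * ((R + 1) * (e * p / (2 * a0 * (R + 1))))"
          using be(3) R2 a0_pos by (intro mult_left_mono) auto
        also have "\<dots> = e * p / 2"
        proof -
          have c: "a0 * (S * (e * p / (2 * a0 * S))) = e * p / 2" if "S > 0" for S
            using that a0_pos by (simp add: field_simps)
          have "R + 1 > 0" using R2 by simp
          then show ?thesis by (rule c)
        qed
        finally have 1: "a0 * ((R + 1) * \<beta>) \<le> e * p / 2" .
        have "a0 * \<kappa> \<le> a0 * (e * p / (2 * a0))" using ka(3) a0_pos by (intro mult_left_mono) auto
        also have "\<dots> = e * p / 2" using a0_pos by simp
        finally have 2: "a0 * \<kappa> \<le> e * p / 2" .
        show "a0 * ((real r + 1) * \<beta> + \<kappa>) \<le> e * (\<eta> ^ (f - 1) / real (aut VF EF))"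
          unfolding R_def[symmetric] a_def[symmetric] p_def[symmetric] using 1 2 by (simp only: distrib_left)
        have "\<nu> * real n ^ 2 \<le> \<kappa> * \<eta> * real n ^ 2" using nu(2) by (intro mult_right_mono) auto
        then show "real (card B2) \<le> \<kappa> * \<eta> * real n ^ 2" using B by linarith
        show "dB x \<le> card (nb x j)" if "j < r" for x j
          using cutp(3)[OF that, of x] by (simp add: dB_def nb_def)
      qed (use e th eta be ka mu sz Rb cE hyp in \<open>auto simp: R_def\<close>)
      have "(1 - e) * (a * (a0 * real q * real n ^ (f - 2))) \<le> (1 + e) * (a * real (num_copies VF EF {0..<n} E))"
        using emb_ge_partitioned' unfolding ce a_def[symmetric] .
      then have "a * ((1 - e) * (a0 * real q * real n ^ (f - 2))) \<le> a * ((1 + e) * real (num_copies VF EF {0..<n} E))"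
        by (simp only: mult_ac)
      then have 1: "(1 - e) * (a0 * real q * real n ^ (f - 2)) \<le> (1 + e) * real (num_copies VF EF {0..<n} E)"
        using a1 by (simp only: mult_le_cancel_left_pos)
      have "(1 + e) * real (num_copies VF EF {0..<n} E) < (1 + e) * ((1 - \<epsilon>) * (a0 * real q * real n ^ (f - 2)))"
        using small e by (intro mult_strict_left_mono) auto
      also have "\<dots> = ((1 + e) * (1 - \<epsilon>)) * (a0 * real q * real n ^ (f - 2))" by simp
      also have "\<dots> \<le> (1 - e) * (a0 * real q * real n ^ (f - 2))"
      proof (rule mult_right_mono)
        have "(1 + e) * (1 - \<epsilon>) = 1 - e - e * \<epsilon>" by (simp add: e_def field_simps)
        then show "(1 + e) * (1 - \<epsilon>) \<le> 1 - e" using e eps by simp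
      qed (use a0_pos in simp)
      finally show False using 1 by simp
    qed
  qed
qed

section \<open>Domination of the linear bound by the polynomial\<close>

abbreviation "tdens \<equiv> (real r - 1) / real r"

lemma monomial_nonneg:
  assumes "(u,c) \<in> KC" "\<And>i. i < r \<Longrightarrow> 0 \<le> \<xi> i"
  shows "0 \<le> monomial u c \<xi>"
  unfolding monomial_def
proof (rule prod_nonneg)
  show "0 \<le> (if {u,w} \<in> EF then \<xi> (c w) else 1 / real r)" if "w \<in> VF - {u}" for w
    using assms(2)[OF KC_color[OF assms(1) that]] by simp
qed

lemma PF_nonneg:
  assumes "\<And>i. i < r \<Longrightarrow> 0 \<le> \<xi> i"
  shows "0 \<le> PF r VF EF \<xi>"
  unfolding PF_eq using monomial_nonneg[OF _ assms]
  by (intro mult_nonneg_nonneg sum_nonneg) auto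

text \<open>For (u,c) in \<open>K i\<close> the variable \<xi>_i occurs exactly once. Every other
  factor is (1/r)(1 - g w) with g w a relative deficit, and the Weierstrass product inequality
  replaces the product of the 1 - g w by one minus the sum.\<close>

lemma monomial_K_lower:
  assumes uc: "(u,c) \<in> K i" and i: "i < r" and xi: "\<And>j. j < r \<Longrightarrow> 0 \<le> \<xi> j \<and> \<xi> j \<le> 1 / real r"
    and T: "(\<Sum>w\<in>{w \<in> VF - {u, partner i u c}. {u,w} \<in> EF}. 1 / real r - \<xi> (c w)) \<le> T"
  shows "(1 / real r) ^ (f - 2) * (\<xi> i * (1 - real r * T)) \<le> monomial u c \<xi>"
proof -
  define v where "v = partner i u c"
  note kp = K_partner[OF uc, folded v_def]
  have r0: "real r > 0" using r2 by simp
  let ?W = "VF - {u,v}"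
  have uK: "(u,c) \<in> KC" using uc by (simp add: K_def)
  have cW: "card ?W = f - 2" using kp(1,3) finV by (simp add: card_Diff_subset numeral_2_eq_2)
  define g where "g = (\<lambda>w. if {u,w} \<in> EF then 1 - real r * \<xi> (c w) else 0)"
  have clt: "c w < r" if "w \<in> ?W" for w using KC_color[OF uK, of w] that by auto
  have g01: "g w \<in> {0..1}" if "w \<in> ?W" for w
  proof -
    have "0 \<le> real r * \<xi> (c w)" "real r * \<xi> (c w) \<le> 1"
      using xi[OF clt[OF that]] r0 by (auto simp: field_simps)
    then show ?thesis by (auto simp: g_def)
  qed
  have "monomial u c \<xi> = (\<Prod>w\<in>insert v ?W. if {u,w} \<in> EF then \<xi> (c w) else 1 / real r)"
    unfolding monomial_def using kp(1,3) by (intro prod.cong) auto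
  also have "\<dots> = \<xi> i * (\<Prod>w\<in>?W. if {u,w} \<in> EF then \<xi> (c w) else 1 / real r)"
    using finV kp(4,5) by (subst prod.insert) auto
  also have "(\<Prod>w\<in>?W. if {u,w} \<in> EF then \<xi> (c w) else 1 / real r) = (\<Prod>w\<in>?W. (1 / real r) * (1 - g w))"
    using r0 by (intro prod.cong refl) (auto simp: g_def)
  also have "\<dots> = (1 / real r) ^ (f - 2) * (\<Prod>w\<in>?W. 1 - g w)" by (simp only: prod.distrib prod_constant cW)
  finally have eq: "monomial u c \<xi> = (1 / real r) ^ (f - 2) * (\<xi> i * (\<Prod>w\<in>?W. 1 - g w))" by (simp add: mult_ac)
  have "(\<Sum>w\<in>?W. g w) = (\<Sum>w\<in>{w \<in> ?W. {u,w} \<in> EF}. 1 - real r * \<xi> (c w))"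
    unfolding g_def using finV by (subst sum.inter_filter) auto
  also have "\<dots> = real r * (\<Sum>w\<in>{w \<in> ?W. {u,w} \<in> EF}. 1 / real r - \<xi> (c w))"
    unfolding sum_distrib_left using r0 by (intro sum.cong refl) (simp add: right_diff_distrib)
  also have "\<dots> \<le> real r * T" using T r0 unfolding v_def by (intro mult_left_mono) auto
  finally have "1 - real r * T \<le> 1 - (\<Sum>w\<in>?W. g w)" by simp
  also have "\<dots> \<le> (\<Prod>w\<in>?W. 1 - g w)" by (rule Weierstrass_prod_ineq[OF g01])
  finally show ?thesis unfolding eq using xi[OF i] by (intro mult_left_mono) auto
qed

text \<open>Only the N terms of \<open>K i\<close> are kept; together they carry the constant a0, so
  the bound has the slope \<alpha>_F of the linear function it is compared with.\<close>

lemma PF_K_lower: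
  assumes i: "i < r" and xi: "\<And>j. j < r \<Longrightarrow> 0 \<le> \<xi> j \<and> \<xi> j \<le> 1 / real r"
    and T: "\<And>u c. (u,c) \<in> K i \<Longrightarrow> (\<Sum>w\<in>{w \<in> VF - {u, partner i u c}. {u,w} \<in> EF}. 1 / real r - \<xi> (c w)) \<le> T"
  shows "a0 * (\<xi> i * (1 - real r * T)) \<le> PF r VF EF \<xi>"
proof -
  have "real (card (K i)) * ((1 / real r) ^ (f - 2) * (\<xi> i * (1 - real r * T))) = (\<Sum>p\<in>K i. (1 / real r) ^ (f - 2) * (\<xi> i * (1 - real r * T)))"
    by simp
  also have "\<dots> \<le> (\<Sum>p\<in>K i. monomial (fst p) (snd p) \<xi>)"
  proof (rule sum_mono)
    fix p assume "p \<in> K i"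
    then have "(fst p, snd p) \<in> K i" by simp
    then show "(1 / real r) ^ (f - 2) * (\<xi> i * (1 - real r * T)) \<le> monomial (fst p) (snd p) \<xi>"
      using T by (intro monomial_K_lower[OF _ i xi]) auto
  qed
  also have "\<dots> \<le> (\<Sum>p\<in>KC. monomial (fst p) (snd p) \<xi>)"
  proof (rule sum_mono2[OF finite_KC])
    show "K i \<subseteq> KC" by (auto simp: K_def)
    fix p assume "p \<in> KC - K i"
    then have "(fst p, snd p) \<in> KC" by simp
    then show "0 \<le> monomial (fst p) (snd p) \<xi>"
      using xi by (intro monomial_nonneg) auto
  qed
  finally have "real N * ((1 / real r) ^ (f - 2) * (\<xi> i * (1 - real r * T))) \<le> (\<Sum>p\<in>KC. monomial (fst p) (snd p) \<xi>)"
    using card_K[OF i] by simp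
  then have "real N * ((1 / real r) ^ (f - 2) * (\<xi> i * (1 - real r * T))) / real (aut VF EF) \<le> (\<Sum>p\<in>KC. monomial (fst p) (snd p) \<xi>) / real (aut VF EF)"
    by (intro divide_right_mono) auto
  then show ?thesis unfolding PF_eq a0_def by (simp add: case_prod_beta mult_ac)
qed

text \<open>Singles out part i as the own part of a vertex: the surplus is \<xi>_i minus the total
  deficit of the other parts.\<close>

lemma sum_minus_tdens:
  assumes "i < r"
  shows "(\<Sum>j<r. \<xi> j) - tdens = \<xi> i - (\<Sum>j\<in>{..<r} - {i}. 1 / real r - \<xi> j)"
proof -
  have "(\<Sum>j<r. \<xi> j) = \<xi> i + (\<Sum>j\<in>{..<r} - {i}. \<xi> j)" using assms by (intro sum.remove) auto
  moreover have "(\<Sum>j\<in>{..<r} - {i}. 1 / real r - \<xi> j) = tdens - (\<Sum>j\<in>{..<r} - {i}. \<xi> j)"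
    using assms by (simp add: sum_subtractf of_nat_diff)
  ultimately show ?thesis by simp
qed

text \<open>If some \<xi>_i is at most t = 1/(r f), the terms of \<open>K i\<close> already beat the
  surplus: with A the deficit of the other parts, at most f neighbours lose at most \<xi>_i r f A
  \<le> A. Otherwise \<open>PF_ge\<close> bounds \<open>P_F\<close> below by a constant, which fixes
  s0. This covers q = 1 for large n.\<close>

lemma PF_dominates_small:
  obtains s0 where "s0 > 0" "\<And>s. s \<le> s0 \<Longrightarrow> PF_dominates s"
proof -
  define t where "t = 1 / (real r * real f)"
  have r0: "real r > 0" and f0: "real f \<ge> 3" using r2 f_ge3 by auto
  have t: "t > 0" "t \<le> 1 / real r" using r0 f0 by (auto simp: t_def field_simps)
  define s0 where "s0 = t ^ (f - 1) / real (aut VF EF) / a0"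
  have "s0 > 0" using t aut_pos a0_pos by (simp add: s0_def)
  moreover have "PF_dominates s" if s: "s \<le> s0" for s unfolding PF_dominates_def
  proof (intro allI impI)
    fix \<xi> :: "nat \<Rightarrow> real" assume xi: "\<forall>i<r. 0 \<le> \<xi> i \<and> \<xi> i \<le> 1 / real r"
    show "a0 * min ((\<Sum>i<r. \<xi> i) - tdens) s \<le> PF r VF EF \<xi>"
    proof (cases "\<exists>i<r. \<xi> i \<le> t")
      case True
      then obtain i where i: "i < r" "\<xi> i \<le> t" by blast
      define A where "A = (\<Sum>j\<in>{..<r} - {i}. 1 / real r - \<xi> j)"
      have A0: "A \<ge> 0" unfolding A_def using xi by (intro sum_nonneg) auto
      have "a0 * (\<xi> i * (1 - real r * (real f * A))) \<le> PF r VF EF \<xi>"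
      proof (rule PF_K_lower[OF i(1)])
        fix u c assume uc: "(u,c) \<in> K i"
        have uK: "(u,c) \<in> KC" using uc by (simp add: K_def)
        let ?S = "{w \<in> VF - {u, partner i u c}. {u,w} \<in> EF}"
        have "(\<Sum>w\<in>?S. 1 / real r - \<xi> (c w)) \<le> (\<Sum>w\<in>?S. A)"
        proof (rule sum_mono)
          fix w assume w: "w \<in> ?S"
          then have cw: "c w < r" using KC_color[OF uK] by auto
          have ne: "c w \<noteq> i" using K_partner(6)[OF uc, of w] w by auto
          show "1 / real r - \<xi> (c w) \<le> A" unfolding A_def
            using cw ne xi by (intro member_le_sum[of "c w" _ "\<lambda>j. 1 / real r - \<xi> j"]) auto
        qed
        also have "\<dots> = real (card ?S) * A" by simp
        also have "\<dots> \<le> real f * A" using A0 finV by (intro mult_right_mono of_nat_mono card_mono) auto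
        finally show "(\<Sum>w\<in>?S. 1 / real r - \<xi> (c w)) \<le> real f * A" .
      qed (use xi in auto)
      moreover have "\<xi> i - A \<le> \<xi> i * (1 - real r * (real f * A))"
      proof -
        have "\<xi> i * (real r * (real f * A)) \<le> t * (real r * (real f * A))" using i(2) A0 by (intro mult_right_mono) auto
        also have "\<dots> = A" using r0 f0 by (simp add: t_def)
        finally show ?thesis by (simp add: right_diff_distrib)
      qed
      then have "a0 * (\<xi> i - A) \<le> a0 * (\<xi> i * (1 - real r * (real f * A)))" using a0_pos by (intro mult_left_mono) auto
      moreover have "a0 * min ((\<Sum>i<r. \<xi> i) - tdens) s \<le> a0 * (\<xi> i - A)"
        using sum_minus_tdens[OF i(1), of \<xi>] a0_pos unfolding A_def by (intro mult_left_mono) auto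
      ultimately show ?thesis by linarith
    next
      case False
      then have "t ^ (f - 1) / real (aut VF EF) \<le> PF r VF EF \<xi>" using t by (intro PF_ge) auto
      moreover have "a0 * min ((\<Sum>i<r. \<xi> i) - tdens) s \<le> a0 * s0" using s a0_pos by (intro mult_left_mono) auto
      moreover have "a0 * s0 = t ^ (f - 1) / real (aut VF EF)" using a0_pos by (simp add: s0_def)
      ultimately show ?thesis by linarith
    qed
  qed
  ultimately show ?thesis using that by blast
qed

text \<open>Every colour occurs among the neighbours of u (\<open>KC_neighbour\<close>), so total
  degree at most r forces each to occur exactly once. Neighbours then have distinct colours, their
  deficits add up to at most A rather than f A, and \<xi>_0 \<le> 1/r suffices where a small
  coordinate was needed before.\<close>

lemma PF_dominates_low_degree:
  assumes deg: "\<not> total_degree r VF EF \<ge> r + 1"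
  shows "PF_dominates s"
  unfolding PF_dominates_def
proof (intro allI impI)
  fix \<xi> :: "nat \<Rightarrow> real" assume xi: "\<forall>i<r. 0 \<le> \<xi> i \<and> \<xi> i \<le> 1 / real r"
  have r0: "real r > 0" and i: "0 < r" using r2 by auto
  define A where "A = (\<Sum>j\<in>{..<r} - {0}. 1 / real r - \<xi> j)"
  have A0: "A \<ge> 0" unfolding A_def using xi by (intro sum_nonneg) auto
  have y1: "ycnt VF EF u c j \<le> 1" if uc: "(u,c) \<in> KC" and j: "j < r" for u c j
  proof -
    let ?S = "{\<Sum>i<r. ycnt VF EF u c i | u c. critical_vertex r VF EF u \<and> c \<in> proper_colorings r VF EF u}"
    have "?S \<subseteq> (\<lambda>(u,c). \<Sum>i<r. ycnt VF EF u c i) ` KC"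
      by (auto simp: KC_def critical_vertex_def)
    then have finS: "finite ?S" using finite_KC finite_surj by blast
    have "u \<in> VF" "c \<in> proper_colorings r VF EF u" using uc by (auto simp: KC_def)
    then have "critical_vertex r VF EF u" using critical_iff by blast
    then have "(\<Sum>i<r. ycnt VF EF u c i) \<in> ?S" using \<open>c \<in> _\<close> by blast
    then have "(\<Sum>i<r. ycnt VF EF u c i) \<le> Max ?S" using finS by (rule Max_ge[rotated])
    then have le: "(\<Sum>i<r. ycnt VF EF u c i) \<le> r" using deg by (simp add: total_degree_def)
    have ge: "1 \<le> ycnt VF EF u c i" if i: "i < r" for i
    proof -
      obtain w where "w \<in> VF - {u}" "{u,w} \<in> EF" "c w = i" by (rule KC_neighbour[OF uc i])
      then have "{v \<in> VF - {u}. {u,v} \<in> EF \<and> c v = i} \<noteq> {}" by blast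
      then show ?thesis unfolding ycnt_def using finV by (simp add: Suc_leI card_gt_0_iff)
    qed
    have "(\<Sum>i<r. ycnt VF EF u c i) = ycnt VF EF u c j + (\<Sum>i\<in>{..<r} - {j}. ycnt VF EF u c i)"
      using j by (intro sum.remove) auto
    moreover have "(\<Sum>i\<in>{..<r} - {j}. 1) \<le> (\<Sum>i\<in>{..<r} - {j}. ycnt VF EF u c i)"
      using ge by (intro sum_mono) auto
    moreover have "(\<Sum>i\<in>{..<r} - {j}. 1) = r - 1" using j by simp
    ultimately show ?thesis using le j by linarith
  qed
  have "a0 * (\<xi> 0 * (1 - real r * A)) \<le> PF r VF EF \<xi>"
  proof (rule PF_K_lower[OF i])
    fix u c assume uc: "(u,c) \<in> K 0"
    have uK: "(u,c) \<in> KC" using uc by (simp add: K_def)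
    let ?S = "{w \<in> VF - {u, partner 0 u c}. {u,w} \<in> EF}"
    have inj: "inj_on c ?S"
    proof (rule inj_onI)
      fix a b assume ab: "a \<in> ?S" "b \<in> ?S" "c a = c b"
      have "card {v \<in> VF - {u}. {u,v} \<in> EF \<and> c v = c a} \<le> 1"
        using y1[OF uK, of "c a"] KC_color[OF uK, of a] ab by (auto simp: ycnt_def)
      moreover have "finite {v \<in> VF - {u}. {u,v} \<in> EF \<and> c v = c a}" using finV by simp
      moreover have "a \<in> {v \<in> VF - {u}. {u,v} \<in> EF \<and> c v = c a}" "b \<in> {v \<in> VF - {u}. {u,v} \<in> EF \<and> c v = c a}"
        using ab by auto
      ultimately show "a = b" by (metis (no_types, lifting) One_nat_def card_le_Suc0_iff_eq)
    qed
    have sub: "c ` ?S \<subseteq> {..<r} - {0}"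
    proof (rule image_subsetI)
      fix w assume w: "w \<in> ?S"
      then have "c w < r" using KC_color[OF uK] by auto
      moreover have "c w \<noteq> 0" using K_partner(6)[OF uc, of w] w by auto
      ultimately show "c w \<in> {..<r} - {0}" by simp
    qed
    have "(\<Sum>w\<in>?S. 1 / real r - \<xi> (c w)) = (\<Sum>j\<in>c ` ?S. 1 / real r - \<xi> j)"
      using sum.reindex[OF inj, of "\<lambda>j. 1 / real r - \<xi> j"] by (simp add: o_def)
    also have "\<dots> \<le> A" unfolding A_def using sub xi by (intro sum_mono2) auto
    finally show "(\<Sum>w\<in>?S. 1 / real r - \<xi> (c w)) \<le> A" .
  qed (use xi in auto)
  moreover have "\<xi> 0 - A \<le> \<xi> 0 * (1 - real r * A)"
  proof -
    have "\<xi> 0 * (real r * A) \<le> (1 / real r) * (real r * A)" using xi i A0 by (intro mult_right_mono) auto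
    then show ?thesis using r0 by (simp add: right_diff_distrib)
  qed
  then have "a0 * (\<xi> 0 - A) \<le> a0 * (\<xi> 0 * (1 - real r * A))" using a0_pos by (intro mult_left_mono) auto
  moreover have "a0 * min ((\<Sum>i<r. \<xi> i) - tdens) s \<le> a0 * (\<xi> 0 - A)"
    using sum_minus_tdens[OF i, of \<xi>] a0_pos unfolding A_def by (intro mult_left_mono) auto
  ultimately show "a0 * min ((\<Sum>i<r. \<xi> i) - tdens) s \<le> PF r VF EF \<xi>" by linarith
qed

text \<open>\<rho>-hat concerns coordinate sums below 1, \<open>PF_dominates\<close> all \<xi>.
  Monotonicity closes the gap: \<xi> is scaled down to a sum \<sigma> in the controlled range, and
  \<open>P_F\<close> can only decrease.\<close>

lemma PF_dominates_rho_hat: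
  assumes "ereal (tdens + s) \<le> rho_hat r VF EF"
  shows "PF_dominates s"
proof (cases "total_degree r VF EF \<ge> r + 1")
  case False then show ?thesis by (rule PF_dominates_low_degree)
next
  case True
  let ?S = "{\<rho>. tdens < \<rho> \<and> \<rho> < 1 \<and> p_min r VF EF \<rho> < alpha r VF EF * (\<rho> - tdens)}"
  have rh: "rho_hat r VF EF = Inf (ereal ` ?S)" using True by (simp add: rho_hat_def)
  have big: "a0 * (\<sigma> - tdens) \<le> p_min r VF EF \<sigma>" if "tdens < \<sigma>" "\<sigma> < 1" "\<sigma> < tdens + s" for \<sigma>
  proof (rule ccontr)
    assume "\<not> ?thesis"
    then have "\<sigma> \<in> ?S" using that by (simp add: alpha_eq)
    then have "rho_hat r VF EF \<le> ereal \<sigma>" unfolding rh by (intro Inf_lower) blast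
    then have "ereal (tdens + s) \<le> ereal \<sigma>" using assms by (rule order_trans[rotated])
    then show False using that by simp
  qed
  have r0: "real r > 0" and td0: "tdens \<ge> 0" using r2 by auto
  show ?thesis unfolding PF_dominates_def
  proof (intro allI impI)
    fix \<xi> :: "nat \<Rightarrow> real" assume xi: "\<forall>i<r. 0 \<le> \<xi> i \<and> \<xi> i \<le> 1 / real r"
    define \<rho> where "\<rho> = (\<Sum>i<r. \<xi> i)"
    define m where "m = min (\<rho> - tdens) s"
    have "\<rho> \<le> (\<Sum>i<r. 1 / real r)" unfolding \<rho>_def using xi by (intro sum_mono) auto
    then have rho1: "\<rho> \<le> 1" using r0 by simp
    show "a0 * min ((\<Sum>i<r. \<xi> i) - tdens) s \<le> PF r VF EF \<xi>"
    proof (rule ccontr)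
      assume "\<not> ?thesis"
      then have lt: "PF r VF EF \<xi> < a0 * m" by (simp add: m_def \<rho>_def)
      have P0: "0 \<le> PF r VF EF \<xi>" using xi by (intro PF_nonneg) auto
      have "PF r VF EF \<xi> / a0 < m" using lt a0_pos by (simp add: pos_divide_less_eq mult.commute)
      \<comment> \<open>Strictly in between, so that \<sigma> avoids the endpoints 1 and (r-1)/r +
        s, at which \<open>big\<close> says nothing.\<close>
      then obtain t where t: "PF r VF EF \<xi> / a0 < t" "t < m" using dense by blast
      have t0: "t > 0" using t(1) P0 a0_pos by (meson divide_nonneg_pos le_less_trans)
      define \<sigma> where "\<sigma> = tdens + t"
      have s1: "tdens < \<sigma>" "\<sigma> < \<rho>" "\<sigma> < 1" "\<sigma> < tdens + s" using t0 t(2) rho1 by (auto simp: \<sigma>_def m_def)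
      have rpos: "\<rho> > 0" "\<sigma> > 0" using s1 td0 by linarith+
      define \<zeta> where "\<zeta> = (\<lambda>i. if i < r then \<sigma> / \<rho> * \<xi> i else 0)"
      have z: "0 \<le> \<zeta> i \<and> \<zeta> i \<le> \<xi> i" if "i < r" for i
      proof -
        have "\<sigma> / \<rho> \<le> 1" "0 \<le> \<sigma> / \<rho>" using s1 rpos by auto
        then have "0 \<le> \<sigma> / \<rho> * \<xi> i" "\<sigma> / \<rho> * \<xi> i \<le> \<xi> i"
          using xi that by (auto simp only: mult_left_le_one_le mult_nonneg_nonneg)
        then show ?thesis using that by (simp only: \<zeta>_def if_True)
      qed
      have "(\<Sum>i<r. \<zeta> i) = \<sigma> / \<rho> * \<rho>" unfolding \<rho>_def \<zeta>_def by (simp add: sum_distrib_left)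
      then have "(\<Sum>i<r. \<zeta> i) = \<sigma>" using rpos by simp
      then have zs: "\<zeta> \<in> Defs.simplex r \<sigma>"
        unfolding Defs.simplex_def using z xi by (auto simp: \<zeta>_def) (meson order_trans)
      have "bdd_below (PF r VF EF ` Defs.simplex r \<sigma>)"
        by (rule bdd_belowI[of _ 0]) (auto simp: Defs.simplex_def intro!: PF_nonneg)
      then have "p_min r VF EF \<sigma> \<le> PF r VF EF \<zeta>" unfolding p_min_def using zs by (intro cInf_lower) auto
      also have "\<dots> \<le> PF r VF EF \<xi>" using z by (intro PF_mono) auto
      finally have "a0 * t \<le> PF r VF EF \<xi>" using big[OF s1(1,3,4)] by (simp add: \<sigma>_def)
      then show False using t(1) a0_pos by (simp add: pos_divide_less_eq mult.commute)
    qed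
  qed
qed

end

section \<open>The extremal number and the one-vertex construction\<close>

lemma finite_pairs: "finite (pairs n)"
  by (rule finite_subset[of _ "Pow {..<n}"]) (auto simp: pairs_def)

text \<open>The new vertex \<open>r * m\<close> lies in class 0 and is joined to the r - 1 other
  classes of m vertices each. It is the vertex that the one-vertex construction attaches
  differently.\<close>

lemma card_turan_Suc:
  assumes "r > 0"
  shows "card (turan_edges r (r * m + 1)) = card (turan_edges r (r * m)) + (r - 1) * m"
proof -
  let ?x = "r * m"
  let ?S = "{y. y < r * m \<and> y mod r \<noteq> 0}"
  have "turan_edges r (r * m + 1) = turan_edges r (r * m) \<union> (\<lambda>y. {?x,y}) ` ?S"
  proof
    show "turan_edges r (r * m + 1) \<subseteq> turan_edges r (r * m) \<union> (\<lambda>y. {?x,y}) ` ?S"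
    proof
      fix e assume "e \<in> turan_edges r (r * m + 1)"
      then obtain u v where uv: "e = {u,v}" "u < r * m + 1" "v < r * m + 1" "u mod r \<noteq> v mod r"
        unfolding turan_edges_def by blast
      consider "u = ?x" | "v = ?x" | "u < ?x" "v < ?x" using uv by linarith
      then show "e \<in> turan_edges r (r * m) \<union> (\<lambda>y. {?x,y}) ` ?S"
      proof cases
        case 1
        then have "v \<in> ?S" using uv by (cases "v = ?x") auto
        then show ?thesis using uv 1 by blast
      next
        case 2
        then have "u \<in> ?S" using uv by (cases "u = ?x") auto
        then show ?thesis using uv 2 by (auto simp: insert_commute)
      next
        case 3 then show ?thesis using uv by (simp add: turan_iff)
      qed
    qed
    show "turan_edges r (r * m) \<union> (\<lambda>y. {?x,y}) ` ?S \<subseteq> turan_edges r (r * m + 1)"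
    proof
      fix e assume "e \<in> turan_edges r (r * m) \<union> (\<lambda>y. {?x,y}) ` ?S"
      then show "e \<in> turan_edges r (r * m + 1)"
      proof
        assume "e \<in> turan_edges r (r * m)"
        then show ?thesis unfolding turan_edges_def by force
      qed (auto simp: turan_iff)
    qed
  qed
  moreover have "finite (turan_edges r (r * m))" using finite_subset[OF turan_sub finite_pairs] .
  moreover have "turan_edges r (r * m) \<inter> (\<lambda>y. {?x,y}) ` ?S = {}" by (auto simp: turan_iff)
  ultimately have "card (turan_edges r (r * m + 1)) = card (turan_edges r (r * m)) + card ((\<lambda>y. {?x,y}) ` ?S)"
    by (simp add: card_Un_disjoint)
  moreover have "card ((\<lambda>y. {?x,y}) ` ?S) = card ?S"
    by (rule card_image) (auto simp: inj_on_def doubleton_eq_iff)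
  moreover have "card ?S = (r - 1) * m"
  proof -
    have "card {y. y < r * m \<and> y mod r = 0} = m"
    proof -
      have "{y. y < r * m \<and> y mod r = 0} = (\<lambda>a. r * a) ` {..<m}" using assms by auto
      then show ?thesis using assms by (simp add: card_image inj_on_def)
    qed
    moreover have "{..<r * m} = ?S \<union> {y. y < r * m \<and> y mod r = 0}" by auto
    then have "card {..<r * m} = card (?S \<union> {y. y < r * m \<and> y mod r = 0})" by simp
    then have "r * m = card ?S + card {y. y < r * m \<and> y mod r = 0}"
      by (subst (asm) card_Un_disjoint) auto
    ultimately show ?thesis using assms by (simp add: diff_mult_distrib)
  qed
  ultimately show ?thesis by simp
qed

lemma card_residue_initial:
  assumes "j < r"
  shows "card {y. y mod r = j \<and> y div r < d} = (d::nat)"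
proof -
  have "{y. y mod r = j \<and> y div r < d} = (\<lambda>a. a * r + j) ` {..<d}"
  proof
    show "{y. y mod r = j \<and> y div r < d} \<subseteq> (\<lambda>a. a * r + j) ` {..<d}"
    proof
      fix y assume y: "y \<in> {y. y mod r = j \<and> y div r < d}"
      then have "y = (y div r) * r + j" using div_mult_mod_eq[of y r] by simp
      then show "y \<in> (\<lambda>a. a * r + j) ` {..<d}" using y by blast
    qed
  qed (use assms in auto)
  then show ?thesis using assms by (simp add: card_image inj_on_def)
qed

lemma sum_card_fibers:
  assumes "finite S" "g ` S \<subseteq> {..<r}"
  shows "card S = (\<Sum>i<r. card {y \<in> S. g y = (i::nat)})"
  using sum.group[OF assms(1) finite_lessThan assms(2), of "\<lambda>_. 1::nat"] by simp

context critical
begin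

lemma turan_free: "emb VF EF n (turan_edges r n') = {}"
proof (rule ccontr)
  assume "emb VF EF n (turan_edges r n') \<noteq> {}"
  then obtain \<phi> where em: "\<phi> \<in> emb VF EF n (turan_edges r n')" by blast
  have "\<And>v. v \<in> VF \<Longrightarrow> \<phi> v mod r < r" using r2 by simp
  then obtain u v where uv: "{u,v} \<in> EF" "\<phi> u mod r = \<phi> v mod r"
    using mono_edge_exists[of "\<lambda>v. \<phi> v mod r"] by blast
  then show False using emb_D(4)[OF em uv(1)] by (simp add: turan_iff)
qed

text \<open>Simonovits' theorem for critical graphs, obtained from the lower bound at q = 1: one
  edge beyond the Turan number forces a positive number of copies once 1/n is below the threshold of
  \<open>PF_dominates_small\<close>.\<close>

lemma ex_num_eq:
  obtains n0 where "\<And>n. n \<ge> n0 \<Longrightarrow> ex_num VF EF n = card (turan_edges r n)"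
proof -
  obtain \<delta> n1 where d: "\<delta> > 0" and main: "\<And>n q E. n \<ge> n1 \<Longrightarrow> E \<subseteq> pairs n \<Longrightarrow> card E \<ge> card (turan_edges r n) + q \<Longrightarrow>
     real q \<le> \<delta> * real n ^ 2 \<Longrightarrow> PF_dominates (real q / real n) \<Longrightarrow>
     (1 - 1/2) * (a0 * real q * real n ^ (f - 2)) \<le> real (num_copies VF EF {0..<n} E)"
    using copies_ge[of "1/2"] by auto
  obtain s0 where s0: "s0 > 0" "\<And>s. s \<le> s0 \<Longrightarrow> PF_dominates s" using PF_dominates_small by blast
  obtain n2 :: nat where n2: "real n2 > 1 + 1 / \<delta> + 1 / s0" using reals_Archimedean2 by blast
  show ?thesis
  proof (rule that[of "max n1 n2"])
    fix n assume n: "n \<ge> max n1 n2"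
    have pos: "1 / \<delta> > 0" "1 / s0 > 0" using d s0 by auto
    have nn: "real n > 1" "real n > 1 / \<delta>" "real n > 1 / s0" using n n2 pos by linarith+
    let ?S = "{card E | E. E \<subseteq> pairs n \<and> num_copies VF EF {0..<n} E = 0}"
    have "?S \<subseteq> card ` Pow (pairs n)" by auto
    then have fin: "finite ?S" using finite_pairs by (meson finite_Pow_iff finite_imageI finite_subset)
    have "aut VF EF * num_copies VF EF {0..<n} (turan_edges r n) = 0"
      using card_emb[OF graph, of n "turan_edges r n"] turan_free by simp
    then have "num_copies VF EF {0..<n} (turan_edges r n) = 0" using aut_pos by simp
    then have "card (turan_edges r n) \<in> ?S" using turan_sub by blast
    moreover have "k \<le> card (turan_edges r n)" if k: "k \<in> ?S" for k
    proof (rule ccontr)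
      assume gt: "\<not> ?thesis"
      obtain E where E: "k = card E" "E \<subseteq> pairs n" "num_copies VF EF {0..<n} E = 0" using k by blast
      then have "card E \<ge> card (turan_edges r n) + 1" using gt by simp
      moreover have "1 \<le> \<delta> * real n ^ 2"
      proof -
        have "1 \<le> \<delta> * real n" using nn(2) d by (simp add: pos_divide_less_eq mult.commute)
        also have "\<dots> \<le> \<delta> * real n ^ 2" using nn(1) d by (simp add: power2_eq_square)
        finally show ?thesis .
      qed
      moreover have "PF_dominates (1 / real n)"
      proof (rule s0(2))
        show "1 / real n \<le> s0" using nn s0(1) by (simp add: field_simps)
      qed
      ultimately have "(1 - 1/2) * (a0 * real 1 * real n ^ (f - 2)) \<le> real (num_copies VF EF {0..<n} E)"
        using main[of n E 1] n E by simp
      moreover have "a0 * real n ^ (f - 2) > 0" using a0_pos nn by simp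
      ultimately show False using E(3) by simp
    qed
    ultimately show "ex_num VF EF n = card (turan_edges r n)"
      unfolding ex_num_def using fin by (intro Max_eqI) auto
  qed
qed

lemma h_num_attained:
  assumes "E0 \<subseteq> pairs n" "card E0 = ex_num VF EF n + q"
  obtains E where "E \<in> H_set VF EF n q" "num_copies VF EF {0..<n} E = h_num VF EF n q"
    "h_num VF EF n q \<le> num_copies VF EF {0..<n} E0"
proof -
  let ?S = "{num_copies VF EF {0..<n} E | E. E \<subseteq> pairs n \<and> card E = ex_num VF EF n + q}"
  have m: "num_copies VF EF {0..<n} E0 \<in> ?S" using assms by blast
  then have "?S \<noteq> {}" by blast
  then have "h_num VF EF n q \<in> ?S" unfolding h_num_def by (rule Inf_nat_def1)
  then obtain E where E: "h_num VF EF n q = num_copies VF EF {0..<n} E" "E \<subseteq> pairs n" "card E = ex_num VF EF n + q" by blast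
  have le: "h_num VF EF n q \<le> num_copies VF EF {0..<n} E0" unfolding h_num_def using m by (intro cInf_lower) auto
  have "E \<in> H_set VF EF n q" unfolding H_set_def mem_Collect_eq using E by (intro conjI) simp_all
  then show ?thesis using that E(1) le by metis
qed

text \<open>Part \<open>i\<close> is the residue class of \<open>i\<close> modulo \<open>r\<close>, and \<open>y div r\<close> is the rank of \<open>y\<close> in its part.\<close>

definition star_graph :: "nat \<Rightarrow> (nat \<Rightarrow> nat) \<Rightarrow> nat set set" where
  "star_graph m d = turan_edges r (r * m) \<union> (\<lambda>y. {r * m, y}) ` {y. y < r * m \<and> y div r < d (y mod r)}"

lemma star_iff:
  "{a,b} \<in> star_graph m d \<longleftrightarrow> (a < r * m \<and> b < r * m \<and> a mod r \<noteq> b mod r)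
     \<or> (a = r * m \<and> b < r * m \<and> b div r < d (b mod r)) \<or> (b = r * m \<and> a < r * m \<and> a div r < d (a mod r))"
  unfolding star_graph_def by (auto simp: turan_iff doubleton_eq_iff)

lemma star_sub: "star_graph m d \<subseteq> pairs (r * m + 1)"
proof
  fix e assume "e \<in> star_graph m d"
  then consider "e \<in> turan_edges r (r * m)" | y where "e = {r * m, y}" "y < r * m" unfolding star_graph_def by blast
  then show "e \<in> pairs (r * m + 1)"
  proof cases
    case 1 then show ?thesis unfolding turan_edges_def pairs_def by force
  next
    case 2 then show ?thesis by (simp add: pairs_iff)
  qed
qed

lemma card_star:
  assumes d: "\<And>i. i < r \<Longrightarrow> d i \<le> m"
  shows "card (star_graph m d) = card (turan_edges r (r * m)) + (\<Sum>i<r. d i)"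
proof -
  have r0: "r > 0" using r2 by simp
  let ?S = "{y. y < r * m \<and> y div r < d (y mod r)}"
  have "card (star_graph m d) = card (turan_edges r (r * m)) + card ((\<lambda>y. {r * m, y}) ` ?S)"
    unfolding star_graph_def
    using finite_subset[OF turan_sub finite_pairs] by (intro card_Un_disjoint) (auto simp: turan_iff)
  also have "card ((\<lambda>y. {r * m, y}) ` ?S) = card ?S"
    by (rule card_image) (auto simp: inj_on_def doubleton_eq_iff)
  also have "card ?S = (\<Sum>i<r. card {y \<in> ?S. y mod r = i})"
    using r0 by (intro sum_card_fibers) auto
  also have "\<dots> = (\<Sum>i<r. d i)"
  proof (rule sum.cong[OF refl])
    fix i assume "i \<in> {..<r}"
    then have i: "i < r" by simp
    have "{y \<in> ?S. y mod r = i} = {y. y mod r = i \<and> y div r < d i}"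
    proof -
      have "y < r * m" if "y div r < d i" for y
      proof -
        have "y div r < m" using that d[OF i] by linarith
        then show ?thesis using r0 by (simp add: div_less_iff_less_mult mult.commute)
      qed
      then show ?thesis by auto
    qed
    then show "card {y \<in> ?S. y mod r = i} = d i" using card_residue_initial[OF i] by simp
  qed
  finally show ?thesis .
qed

text \<open>Without the vertex \<open>r * m\<close> the graph is r-partite, so each embedding uses
  it. Its preimage and the residues of the other images form a pair in \<open>KC\<close>; the target
  sets have size d (c w) or m, at most r m times the factors of the monomial.\<close>

lemma emb_star_upper:
  assumes d: "\<And>i. i < r \<Longrightarrow> real (d i) \<le> real (r * m) * \<xi> i" and m: "m > 0"
  shows "real (card (emb VF EF (r * m + 1) (star_graph m d))) \<le> real (r * m) ^ (f - 1) * (real (aut VF EF) * PF r VF EF \<xi>)"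
proof -
  let ?E = "star_graph m d" and ?x = "r * m" and ?n = "r * m + 1"
  have r0: "r > 0" using r2 by simp
  define A where "A = (\<lambda>u c w. if {u,w} \<in> EF then {y. y mod r = c w \<and> y div r < d (c w)} else {y. y mod r = c w \<and> y div r < (m::nat)})"
  define Z where "Z = (\<lambda>(u,c). PiE (VF - {u}) (A u (c :: nat \<Rightarrow> nat)))"
  define U where "U = (\<lambda>\<phi>. THE u. u \<in> VF \<and> \<phi> u = ?x)"
  define C where "C = (\<lambda>\<phi>. restrict (\<lambda>w. \<phi> w mod r) (VF - {U \<phi>}))"
  let ?g = "\<lambda>\<phi>. ((U \<phi>, C \<phi>), restrict \<phi> (VF - {U \<phi>}))"
  have key: "U \<phi> \<in> VF \<and> \<phi> (U \<phi>) = ?x \<and> (U \<phi>, C \<phi>) \<in> KC \<and> restrict \<phi> (VF - {U \<phi>}) \<in> Z (U \<phi>, C \<phi>)"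
    if em: "\<phi> \<in> emb VF EF ?n ?E" for \<phi>
  proof -
    have "\<exists>u\<in>VF. \<phi> u = ?x"
    proof (rule ccontr)
      assume no: "\<not> (\<exists>u\<in>VF. \<phi> u = ?x)"
      have "\<And>v. v \<in> VF \<Longrightarrow> \<phi> v mod r < r" using r0 by simp
      then obtain u v where uv: "{u,v} \<in> EF" "\<phi> u mod r = \<phi> v mod r"
        using mono_edge_exists[of "\<lambda>v. \<phi> v mod r"] by blast
      then show False using emb_D(4)[OF em uv(1)] edge_mem[OF uv(1)] no by (auto simp: star_iff)
    qed
    then obtain u where u: "u \<in> VF" "\<phi> u = ?x" by blast
    have Uu: "U \<phi> = u" unfolding U_def using u emb_D(3)[OF em] by (intro the_equality) auto
    have lt: "\<phi> w < ?x" if "w \<in> VF - {u}" for w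
    proof -
      have "\<phi> w < ?n" using emb_D(1)[OF em, of w] that by simp
      moreover have "\<phi> w \<noteq> ?x" using emb_D(3)[OF em, of w u] that u by auto
      ultimately show ?thesis by simp
    qed
    have Cw: "C \<phi> w = \<phi> w mod r" if "w \<in> VF - {u}" for w using that by (simp add: C_def Uu)
    have "C \<phi> \<in> proper_colorings r VF EF u" unfolding proper_colorings_def mem_Collect_eq
    proof (intro conjI ballI impI)
      show "C \<phi> \<in> (VF - {u}) \<rightarrow>\<^sub>E {0..<r}" using r0 by (auto simp: C_def Uu)
      fix a b assume ab: "a \<in> VF - {u}" "b \<in> VF - {u}" "{a,b} \<in> EF"
      then have "\<phi> a mod r \<noteq> \<phi> b mod r" using emb_D(4)[OF em ab(3)] lt[of a] lt[of b] by (auto simp: star_iff)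
      then show "C \<phi> a \<noteq> C \<phi> b" using Cw ab by simp
    qed
    moreover have "restrict \<phi> (VF - {u}) \<in> Z (u, C \<phi>)"
    proof -
      have "\<phi> w \<in> A u (C \<phi>) w" if w: "w \<in> VF - {u}" for w
      proof (cases "{u,w} \<in> EF")
        case True
        then have "{?x, \<phi> w} \<in> ?E" using emb_D(4)[OF em True] u by simp
        then have "\<phi> w div r < d (\<phi> w mod r)" using lt[OF w] by (auto simp: star_iff)
        then show ?thesis using True Cw[OF w] by (simp add: A_def)
      next
        case False
        have "\<phi> w div r < m" using lt[OF w] r0 by (simp add: div_less_iff_less_mult mult.commute)
        then show ?thesis using False Cw[OF w] by (simp add: A_def)
      qed
      then show ?thesis unfolding Z_def by auto
    qed
    ultimately show ?thesis using Uu u by (simp add: KC_def)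
  qed
  have cA: "card (A u c w) = (if {u,w} \<in> EF then d (c w) else m)" if "(u,c) \<in> KC" "w \<in> VF - {u}" for u c w
    unfolding A_def using card_residue_initial[OF KC_color[OF that]] by simp
  have finA: "finite (A u c w)" if "(u,c) \<in> KC" "w \<in> VF - {u}" for u c w
  proof -
    have "finite {y. y mod r = c w \<and> y div r < k}" for k
      by (rule finite_subset[of _ "{..<k * r}"]) (use r0 in \<open>auto simp: div_less_iff_less_mult\<close>)
    then show ?thesis by (simp add: A_def)
  qed
  have finZ: "finite (Z p)" if "p \<in> KC" for p
    using that finA finV unfolding Z_def by (cases p) (auto intro!: finite_PiE)
  have "card (emb VF EF ?n ?E) \<le> card (Sigma KC Z)"
  proof (rule card_inj_on_le[where f = ?g])
    show "inj_on ?g (emb VF EF ?n ?E)"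
    proof (rule inj_onI)
      fix a b assume ab: "a \<in> emb VF EF ?n ?E" "b \<in> emb VF EF ?n ?E" "?g a = ?g b"
      have eqs: "U a = U b" using ab(3) by auto
      have rs: "restrict a (VF - {U a}) = restrict b (VF - {U a})" using ab(3) eqs by simp
      show "a = b"
      proof (rule emb_eqI[OF ab(1,2)])
        fix w assume w: "w \<in> VF"
        show "a w = b w"
        proof (cases "w = U a")
          case True then show ?thesis using key[OF ab(1)] key[OF ab(2)] eqs by simp
        next
          case False then show ?thesis using fun_cong[OF rs, of w] w by simp
        qed
      qed
    qed
    show "?g ` emb VF EF ?n ?E \<subseteq> Sigma KC Z" using key by auto
    show "finite (Sigma KC Z)" using finite_KC finZ by blast
  qed
  also have "\<dots> = (\<Sum>p\<in>KC. card (Z p))" using finite_KC finZ by (simp add: card_SigmaI)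
  finally have "real (card (emb VF EF ?n ?E)) \<le> (\<Sum>p\<in>KC. real (card (Z p)))"
    unfolding of_nat_sum[symmetric] of_nat_le_iff .
  also have "\<dots> \<le> (\<Sum>p\<in>KC. real (r * m) ^ (f - 1) * monomial (fst p) (snd p) \<xi>)"
  proof (rule sum_mono)
    fix p assume "p \<in> KC"
    obtain u c where p: "p = (u,c)" by fastforce
    then have uc: "(u,c) \<in> KC" using \<open>p \<in> KC\<close> by simp
    have cW: "card (VF - {u}) = f - 1" using uc finV by (simp add: KC_def)
    have "real (card (Z p)) = (\<Prod>w\<in>VF - {u}. real (card (A u c w)))"
      using finV by (simp add: Z_def p card_PiE)
    also have "\<dots> \<le> (\<Prod>w\<in>VF - {u}. real (r * m) * (if {u,w} \<in> EF then \<xi> (c w) else 1 / real r))"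
      using cA[OF uc] d KC_color[OF uc] r0 by (intro prod_mono) auto
    also have "\<dots> = real (r * m) ^ (f - 1) * monomial u c \<xi>"
      unfolding monomial_def by (simp only: prod.distrib prod_constant cW)
    finally show "real (card (Z p)) \<le> real (r * m) ^ (f - 1) * monomial (fst p) (snd p) \<xi>" using p by simp
  qed
  also have "\<dots> = real (r * m) ^ (f - 1) * (real (aut VF EF) * PF r VF EF \<xi>)"
    unfolding PF_eq using aut_pos by (simp add: sum_distrib_left case_prod_beta)
  finally show ?thesis .
qed

section \<open>The threshold\<close>

abbreviation cden :: "nat \<Rightarrow> real" where "cden n \<equiv> real (c_num r VF EF n) / real n ^ (f - 2)"

lemma cden_pos: "eventually (\<lambda>n. cden n > 0) sequentially"
  using order_tendstoD(1)[OF c_num_lim a0_pos] .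

definition c2_admissible :: "real \<Rightarrow> bool" where
  "c2_admissible c \<longleftrightarrow> (\<forall>\<epsilon>>0. \<exists>n0. \<forall>n\<ge>n0. \<forall>q::nat. 1 \<le> q \<and> real q \<le> c * real n \<longrightarrow>
      (\<forall>E \<in> H_set VF EF n q.
         real (num_copies VF EF {0..<n} E) / (real q * real (c_num r VF EF n)) \<ge> 1 - \<epsilon>))"

lemma c2_eq: "c2 r VF EF = Sup (ereal ` {c. c2_admissible c})"
  unfolding c2_def c2_admissible_def ..

lemma PF_dominates_antimono: "PF_dominates s \<Longrightarrow> s' \<le> s \<Longrightarrow> PF_dominates s'"
  unfolding PF_dominates_def
proof (intro allI impI)
  fix \<xi> :: "nat \<Rightarrow> real"
  assume h: "\<forall>\<xi>. (\<forall>i<r. 0 \<le> \<xi> i \<and> \<xi> i \<le> 1 / real r) \<longrightarrow> a0 * min ((\<Sum>i<r. \<xi> i) - tdens) s \<le> PF r VF EF \<xi>"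
    and s: "s' \<le> s" and xi: "\<forall>i<r. 0 \<le> \<xi> i \<and> \<xi> i \<le> 1 / real r"
  have "a0 * min ((\<Sum>i<r. \<xi> i) - tdens) s' \<le> a0 * min ((\<Sum>i<r. \<xi> i) - tdens) s"
    using a0_pos s by (intro mult_left_mono) auto
  then show "a0 * min ((\<Sum>i<r. \<xi> i) - tdens) s' \<le> PF r VF EF \<xi>" using h xi by (meson order_trans)
qed

text \<open>\<open>copies_ge\<close> measured against c(n,F) instead of a0 n^(f-2), whose quotient
  tends to 1, and against ex(n,F) instead of the Turan number.\<close>

lemma ratio_lower:
  fixes \<epsilon> :: real
  assumes eps: "\<epsilon> > 0"
  obtains \<delta> n0 where "\<delta> > 0" "\<And>n q E. n \<ge> n0 \<Longrightarrow> E \<in> H_set VF EF n q \<Longrightarrow> 1 \<le> q \<Longrightarrow>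
     real q \<le> \<delta> * real n ^ 2 \<Longrightarrow> PF_dominates (real q / real n) \<Longrightarrow>
     1 - \<epsilon> \<le> real (num_copies VF EF {0..<n} E) / (real q * real (c_num r VF EF n))"
proof -
  define e where "e = min (\<epsilon> / 2) (1 / 2)"
  have e: "0 < e" "e < 1" "e < \<epsilon>" using eps by (auto simp: e_def)
  obtain \<delta> n1 where d: "\<delta> > 0" and main: "\<And>n q E. n \<ge> n1 \<Longrightarrow> E \<subseteq> pairs n \<Longrightarrow> card E \<ge> card (turan_edges r n) + q \<Longrightarrow>
     real q \<le> \<delta> * real n ^ 2 \<Longrightarrow> PF_dominates (real q / real n) \<Longrightarrow>
     (1 - e) * (a0 * real q * real n ^ (f - 2)) \<le> real (num_copies VF EF {0..<n} E)"
    using copies_ge[OF e(1,2)] by blast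
  obtain n2 where ex: "\<And>n. n \<ge> n2 \<Longrightarrow> ex_num VF EF n = card (turan_edges r n)" using ex_num_eq by blast
  have "(\<lambda>n. (1 - e) * (a0 / cden n)) \<longlonglongrightarrow> (1 - e) * (a0 / a0)"
    using a0_pos by (intro tendsto_intros c_num_lim) auto
  then have "(\<lambda>n. (1 - e) * (a0 / cden n)) \<longlonglongrightarrow> 1 - e" using a0_pos by simp
  then have "eventually (\<lambda>n. 1 - \<epsilon> < (1 - e) * (a0 / cden n)) sequentially"
    using e by (intro order_tendstoD(1)) auto
  then have "eventually (\<lambda>n. 1 - \<epsilon> < (1 - e) * (a0 / cden n) \<and> cden n > 0) sequentially"
    using cden_pos by eventually_elim simp
  then obtain n3 where n3: "\<And>n. n \<ge> n3 \<Longrightarrow> 1 - \<epsilon> < (1 - e) * (a0 / cden n) \<and> cden n > 0"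
    unfolding eventually_sequentially by blast
  show ?thesis
  proof (rule that[OF d, of "max 1 (max n1 (max n2 n3))"])
    fix n q E assume n: "n \<ge> max 1 (max n1 (max n2 n3))" and E: "E \<in> H_set VF EF n q" and q: "1 \<le> q" "real q \<le> \<delta> * real n ^ 2"
      and hyp: "PF_dominates (real q / real n)"
    have n0: "real n > 0" using n by simp
    have Es: "E \<subseteq> pairs n" "card E = card (turan_edges r n) + q" using E ex[of n] n by (auto simp: H_set_def)
    have m: "(1 - e) * (a0 * real q * real n ^ (f - 2)) \<le> real (num_copies VF EF {0..<n} E)"
      using main[of n E q] Es q hyp n by simp
    have c: "cden n > 0" "1 - \<epsilon> < (1 - e) * (a0 / cden n)" using n3[of n] n by auto
    have np: "real n ^ (f - 2) > 0" using n0 by simp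
    have cn: "real (c_num r VF EF n) > 0" using c(1) np by (simp add: zero_less_divide_iff)
    have "1 - \<epsilon> \<le> (1 - e) * (a0 * real q * real n ^ (f - 2)) / (real q * real (c_num r VF EF n))"
      using c(2) q np cn by (simp add: mult.commute)
    also have "\<dots> \<le> real (num_copies VF EF {0..<n} E) / (real q * real (c_num r VF EF n))"
      using m by (intro divide_right_mono) auto
    finally show "1 - \<epsilon> \<le> real (num_copies VF EF {0..<n} E) / (real q * real (c_num r VF EF n))" .
  qed
qed

text \<open>A linear bound on q puts it below \<delta> n^2 for large n, so only
  \<open>PF_dominates\<close> is at stake.\<close>

lemma c2_admissible_below_rho_hat:
  assumes "ereal (tdens + c) \<le> rho_hat r VF EF"
  shows "c2_admissible c"
  unfolding c2_admissible_def
proof (intro allI impI)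
  fix \<epsilon> :: real assume eps: "\<epsilon> > 0"
  obtain \<delta> n0 where d: "\<delta> > 0" and low: "\<And>n q E. n \<ge> n0 \<Longrightarrow> E \<in> H_set VF EF n q \<Longrightarrow> 1 \<le> q \<Longrightarrow>
     real q \<le> \<delta> * real n ^ 2 \<Longrightarrow> PF_dominates (real q / real n) \<Longrightarrow>
     1 - \<epsilon> \<le> real (num_copies VF EF {0..<n} E) / (real q * real (c_num r VF EF n))"
    using ratio_lower[OF eps] by blast
  obtain n1 :: nat where n1: "real n1 > c / \<delta>" using reals_Archimedean2 by blast
  have "1 - \<epsilon> \<le> real (num_copies VF EF {0..<n} E) / (real q * real (c_num r VF EF n))"
    if n: "n \<ge> max 1 (max n0 n1)" and q: "1 \<le> q" "real q \<le> c * real n" and E: "E \<in> H_set VF EF n q" for n q E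
  proof (rule low[OF _ E q(1)])
    show "n \<ge> n0" using n by simp
    have np: "real n > 0" using n by simp
    have "real n > c / \<delta>" using n n1 by linarith
    then have "c \<le> \<delta> * real n" using d by (simp add: pos_divide_less_eq mult.commute)
    then have "c * real n \<le> \<delta> * real n * real n" by (intro mult_right_mono) auto
    then show "real q \<le> \<delta> * real n ^ 2" using q(2) by (simp add: power2_eq_square)
    have "real q / real n \<le> c" using q(2) np by (simp add: pos_divide_le_eq)
    then show "PF_dominates (real q / real n)" using PF_dominates_antimono[OF PF_dominates_rho_hat[OF assms]] by blast
  qed
  then show "\<exists>n0. \<forall>n\<ge>n0. \<forall>q. 1 \<le> q \<and> real q \<le> c * real n \<longrightarrow>
      (\<forall>E\<in>H_set VF EF n q. 1 - \<epsilon> \<le> real (num_copies VF EF {0..<n} E) / (real q * real (c_num r VF EF n)))" by blast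
qed

text \<open>If c exceeded t = \<rho> - (r-1)/r, the star graph of a \<xi> with P_F(\<xi>) < a0 t
  would have q close to t n, within the range q \<le> c n, and about P_F(\<xi>) n^(f-1) copies, a
  proportion P_F(\<xi>)/(a0 t) < 1 of q c(n,F).\<close>

lemma c2_admissible_le:
  assumes rho: "tdens < \<rho>" "\<rho> < 1" and p: "p_min r VF EF \<rho> < a0 * (\<rho> - tdens)" and c2_admissible: "c2_admissible c"
  shows "c \<le> \<rho> - tdens"
proof (rule ccontr)
  assume nc: "\<not> c \<le> \<rho> - tdens"
  define t where "t = \<rho> - tdens"
  have r0: "real r > 0" and td: "tdens \<ge> 0" using r2 by auto
  have t: "t > 0" "t \<le> 1" "c > t" using rho td nc by (auto simp: t_def)
  have "(\<lambda>i. if i < r then \<rho> / real r else 0) \<in> Defs.simplex r \<rho>"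
  proof -
    have "0 \<le> \<rho>" using rho td by linarith
    then show ?thesis unfolding Defs.simplex_def using rho r0 by (auto simp: divide_right_mono)
  qed
  then have ne: "PF r VF EF ` Defs.simplex r \<rho> \<noteq> {}" by blast
  have "Inf (PF r VF EF ` Defs.simplex r \<rho>) < a0 * t" using p by (simp add: p_min_def t_def)
  then obtain y where "y \<in> PF r VF EF ` Defs.simplex r \<rho>" "y < a0 * t" using cInf_lessD[OF ne] by blast
  then obtain \<xi> where xi: "\<xi> \<in> Defs.simplex r \<rho>" "PF r VF EF \<xi> < a0 * t" by blast
  have xi1: "0 \<le> \<xi> i" "\<xi> i \<le> 1 / real r" if "i < r" for i using xi(1) that by (auto simp: Defs.simplex_def)
  have xis: "(\<Sum>i<r. \<xi> i) = \<rho>" using xi(1) by (simp add: Defs.simplex_def)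
  define P where "P = PF r VF EF \<xi>"
  have P0: "P \<ge> 0" unfolding P_def using xi1 by (intro PF_nonneg) auto
  \<comment> \<open>The limiting ratio of the construction; \<epsilon> is half of its distance to
    1.\<close>
  define L where "L = P / t / a0"
  have L1: "L < 1" using xi(2) t a0_pos by (simp add: L_def P_def field_simps)
  define \<epsilon> where "\<epsilon> = (1 - L) / 2"
  have eps: "\<epsilon> > 0" "L < 1 - \<epsilon>" using L1 by (auto simp: \<epsilon>_def field_simps)
  obtain n0 where n0: "\<And>n q E. n \<ge> n0 \<Longrightarrow> 1 \<le> q \<Longrightarrow> real q \<le> c * real n \<Longrightarrow> E \<in> H_set VF EF n q \<Longrightarrow>
      1 - \<epsilon> \<le> real (num_copies VF EF {0..<n} E) / (real q * real (c_num r VF EF n))"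
    using c2_admissible eps(1) unfolding c2_admissible_def by blast
  \<comment> \<open>The ratio with rounding kept: the r floors lose at most r edges and passing from
    r m to n = r m + 1 loses t \<le> 1, hence q \<ge> t n - (r+1).\<close>
  define g where "g = (\<lambda>n. P / (t - (real r + 1) / real n) / cden n)"
  have lim0: "(\<lambda>n. (real r + 1) / real n) \<longlonglongrightarrow> 0" by (rule lim_const_over_n)
  have "g \<longlonglongrightarrow> P / (t - 0) / a0" unfolding g_def using t a0_pos by (intro tendsto_intros c_num_lim lim0) auto
  then have gl: "g \<longlonglongrightarrow> L" by (simp add: L_def)
  have ev1: "eventually (\<lambda>n. g n < 1 - \<epsilon>) sequentially" using order_tendstoD(2)[OF gl eps(2)] .
  have ev2: "eventually (\<lambda>n. (real r + 1) / real n < t) sequentially" using order_tendstoD(2)[OF lim0 t(1)] .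
  have "eventually (\<lambda>n. g n < 1 - \<epsilon> \<and> (real r + 1) / real n < t \<and> cden n > 0) sequentially"
    using ev1 ev2 cden_pos by eventually_elim simp
  then obtain n1 where n1: "\<And>n. n \<ge> n1 \<Longrightarrow> g n < 1 - \<epsilon> \<and> (real r + 1) / real n < t \<and> cden n > 0"
    unfolding eventually_sequentially by blast
  obtain n2 where ex: "\<And>n. n \<ge> n2 \<Longrightarrow> ex_num VF EF n = card (turan_edges r n)" using ex_num_eq by blast
  \<comment> \<open>A single large order refutes admissibility, so n may be taken of the form r m +
    1, where the graph without the special vertex is perfectly balanced.\<close>
  define m where "m = 1 + n0 + n1 + n2"
  define n where "n = r * m + 1"
  have "1 * m \<le> r * m" using r2 by (intro mult_right_mono) auto
  then have nm: "n \<ge> m" unfolding n_def by linarith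
  have nb: "n \<ge> n0" "n \<ge> n1" "n \<ge> n2" using nm by (auto simp: m_def)
  have mp: "m > 0" by (simp add: m_def)
  have np: "real n > 0" unfolding n_def of_nat_0_less_iff by simp
  have rm: "real (r * m) = real n - 1" by (simp add: n_def)
  define d where "d = (\<lambda>i. nat \<lfloor>real (r * m) * \<xi> i\<rfloor>)"
  have d1: "real (d i) \<le> real (r * m) * \<xi> i" "real (r * m) * \<xi> i - 1 \<le> real (d i)" if "i < r" for i
  proof -
    have "0 \<le> real (r * m) * \<xi> i" using xi1[OF that] by simp
    then show "real (d i) \<le> real (r * m) * \<xi> i" "real (r * m) * \<xi> i - 1 \<le> real (d i)" unfolding d_def by linarith+
  qed
  have d2: "d i \<le> m" if "i < r" for i
  proof -
    have "real (r * m) * \<xi> i \<le> real (r * m) * (1 / real r)" using xi1[OF that] by (intro mult_left_mono) auto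
    also have "\<dots> = real m" using r0 by simp
    finally show ?thesis using d1(1)[OF that] by linarith
  qed
  have up: "real (\<Sum>i<r. d i) \<le> real (r * m) * \<rho>"
    unfolding xis[symmetric] sum_distrib_left of_nat_sum using d1(1) by (intro sum_mono) auto
  have lo: "real (r * m) * \<rho> - real r \<le> real (\<Sum>i<r. d i)"
  proof -
    have "(\<Sum>i<r. real (r * m) * \<xi> i - 1) \<le> (\<Sum>i<r. real (d i))" using d1(2) by (intro sum_mono) auto
    then show ?thesis by (simp add: sum_subtractf sum_distrib_left[symmetric] xis)
  qed
  have rt: "real ((r - 1) * m) = real (r * m) * tdens" using r2 by (simp add: of_nat_diff)
  have tn: "t * real n - (real r + 1) > 0"
    using n1[OF nb(2)] np by (simp add: pos_divide_less_eq)
  have qlo: "t * real n - (real r + 1) \<le> real (\<Sum>i<r. d i) - real ((r - 1) * m)"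
  proof -
    have "real (r * m) * \<rho> - real r - real (r * m) * tdens = t * real (r * m) - real r"
      by (simp add: t_def algebra_simps)
    also have "\<dots> = t * real n - t - real r" unfolding rm by (simp add: algebra_simps)
    finally show ?thesis using lo t(2) unfolding rt by linarith
  qed
  define q where "q = (\<Sum>i<r. d i) - (r - 1) * m"
  have ge: "(r - 1) * m \<le> (\<Sum>i<r. d i)"
  proof -
    have "real ((r - 1) * m) \<le> real (\<Sum>i<r. d i)" using qlo tn by linarith
    then show ?thesis by (simp only: of_nat_le_iff)
  qed
  have q: "real q = real (\<Sum>i<r. d i) - real ((r - 1) * m)" unfolding q_def by (rule of_nat_diff[OF ge])
  have q0: "real q > 0" using q qlo tn by linarith
  then have q1: "1 \<le> q" by simp
  have "real q \<le> t * real (r * m)" using up unfolding q rt t_def by (simp add: algebra_simps)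
  also have "\<dots> \<le> t * real n" using t by (intro mult_left_mono) (auto simp: n_def)
  also have "\<dots> \<le> c * real n" using t by (intro mult_right_mono) auto
  finally have qc: "real q \<le> c * real n" .
  let ?E = "star_graph m d"
  have Es: "?E \<subseteq> pairs n" unfolding n_def by (rule star_sub)
  have "card ?E = card (turan_edges r (r * m)) + (\<Sum>i<r. d i)" by (rule card_star[OF d2])
  moreover have "card (turan_edges r n) = card (turan_edges r (r * m)) + (r - 1) * m"
    unfolding n_def using r2 by (intro card_turan_Suc) auto
  ultimately have cE: "card ?E = ex_num VF EF n + q" using ex[OF nb(3)] ge by (simp add: q_def)
  obtain E' where E': "E' \<in> H_set VF EF n q" "num_copies VF EF {0..<n} E' = h_num VF EF n q"
    "h_num VF EF n q \<le> num_copies VF EF {0..<n} ?E" by (rule h_num_attained[OF Es cE])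
  have ap: "real (aut VF EF) > 0" using aut_pos by simp
  have "real (aut VF EF) * real (num_copies VF EF {0..<n} ?E) \<le> real (aut VF EF) * (real (r * m) ^ (f - 1) * P)"
    using emb_star_upper[of d m \<xi>] d1(1) mp card_emb[OF graph, of n ?E] unfolding n_def P_def by (simp add: mult_ac)
  then have "real (num_copies VF EF {0..<n} ?E) \<le> real (r * m) ^ (f - 1) * P" using ap by (simp only: mult_le_cancel_left_pos)
  also have "\<dots> \<le> real n ^ (f - 1) * P" using P0 by (intro mult_right_mono power_mono) (auto simp: n_def)
  also have "real n ^ (f - 1) = real n * real n ^ (f - 2)"
  proof -
    have "f - 1 = Suc (f - 2)" using f_ge3 by simp
    then show ?thesis by simp
  qed
  finally have up': "real (num_copies VF EF {0..<n} E') \<le> real n * real n ^ (f - 2) * P" using E' by linarith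
  have cd: "cden n > 0" "g n < 1 - \<epsilon>" using n1[OF nb(2)] by auto
  have npf: "real n ^ (f - 2) > 0" using np by simp
  have cn: "real (c_num r VF EF n) > 0" using cd(1) npf by (simp add: zero_less_divide_iff)
  have "real (num_copies VF EF {0..<n} E') / (real q * real (c_num r VF EF n))
     \<le> (real n * real n ^ (f - 2) * P) / (real q * real (c_num r VF EF n))"
    using up' by (intro divide_right_mono) auto
  also have "\<dots> \<le> (real n * real n ^ (f - 2) * P) / ((t * real n - (real r + 1)) * real (c_num r VF EF n))"
    using qlo tn cn q0 P0 unfolding q[symmetric] by (intro divide_left_mono mult_right_mono mult_pos_pos mult_nonneg_nonneg) auto
  also have "\<dots> = g n"
  proof -
    have "t * real n - (real r + 1) = real n * (t - (real r + 1) / real n)" using np by (simp add: field_simps)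
    then show ?thesis unfolding g_def using np npf by simp
  qed
  finally have "real (num_copies VF EF {0..<n} E') / (real q * real (c_num r VF EF n)) < 1 - \<epsilon>" using cd(2) by linarith
  then show False using n0[OF nb(1) q1 qc E'(1)] by linarith
qed

text \<open>For the second inequality \<open>dense_le\<close> reduces to numbers strictly below
  \<rho>-hat - (r-1)/r; those that matter are real, so an infinite \<rho>-hat needs no separate
  argument there.\<close>

lemma c2_rho_hat: "c2 r VF EF = rho_hat r VF EF - ereal tdens"
proof (rule antisym)
  let ?S = "{\<rho>. tdens < \<rho> \<and> \<rho> < 1 \<and> p_min r VF EF \<rho> < alpha r VF EF * (\<rho> - tdens)}"
  show "c2 r VF EF \<le> rho_hat r VF EF - ereal tdens"
  proof (cases "total_degree r VF EF \<ge> r + 1")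
    case True
    have "c2 r VF EF + ereal tdens \<le> ereal \<rho>" if "\<rho> \<in> ?S" for \<rho>
    proof -
      have "c2 r VF EF \<le> ereal (\<rho> - tdens)" unfolding c2_eq
        using that c2_admissible_le[of \<rho>] by (intro Sup_least) (auto simp: alpha_eq)
      then have "c2 r VF EF + ereal tdens \<le> ereal (\<rho> - tdens) + ereal tdens" by (rule add_right_mono)
      then show ?thesis by simp
    qed
    then have "c2 r VF EF + ereal tdens \<le> rho_hat r VF EF"
      using True unfolding rho_hat_def by (auto intro!: Inf_greatest)
    then show ?thesis by (simp add: ereal_le_minus)
  next
    case False then show ?thesis by (simp add: rho_hat_def)
  qed
  show "rho_hat r VF EF - ereal tdens \<le> c2 r VF EF"
  proof (rule dense_le)
    fix x assume x: "x < rho_hat r VF EF - ereal tdens"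
    show "x \<le> c2 r VF EF"
    proof (cases x)
      case (real c)
      then have "ereal c + ereal tdens \<le> rho_hat r VF EF" using x by (simp add: ereal_less_minus less_imp_le)
      then have "ereal (tdens + c) \<le> rho_hat r VF EF" by (simp add: add.commute)
      then have "c2_admissible c" by (rule c2_admissible_below_rho_hat)
      then show ?thesis unfolding c2_eq real by (intro Sup_upper) auto
    qed (use x in auto)
  qed
qed

end

section \<open>Spreading the extra edges\<close>

text \<open>The value of h fixes a map on S; only the coordinates outside S remain free.\<close>

lemma card_determined_le:
  assumes V: "finite V" "S \<subseteq> V" and T: "T \<subseteq> V \<rightarrow>\<^sub>E {0..<n}" and P: "finite P" "h ` T \<subseteq> P"
    and det: "\<And>\<phi> \<psi> s. \<phi> \<in> T \<Longrightarrow> \<psi> \<in> T \<Longrightarrow> h \<phi> = h \<psi> \<Longrightarrow> s \<in> S \<Longrightarrow> \<phi> s = \<psi> s"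
  shows "card T \<le> card P * n ^ (card V - card S)"
proof -
  let ?g = "\<lambda>\<phi>. (h \<phi>, restrict \<phi> (V - S))"
  have "card T \<le> card (P \<times> ((V - S) \<rightarrow>\<^sub>E {0..<n}))"
  proof (rule card_inj_on_le[where f = ?g])
    show "inj_on ?g T"
    proof (rule inj_onI)
      fix a b assume ab: "a \<in> T" "b \<in> T" "?g a = ?g b"
      have rs: "restrict a (V - S) = restrict b (V - S)" and hh: "h a = h b" using ab(3) by auto
      show "a = b"
      proof (rule PiE_ext[of a V "\<lambda>_. {0..<n}" b])
        show "a \<in> V \<rightarrow>\<^sub>E {0..<n}" "b \<in> V \<rightarrow>\<^sub>E {0..<n}" using ab T by auto
        fix x assume "x \<in> V"
        then show "a x = b x" using det[OF ab(1,2) hh, of x] fun_cong[OF rs, of x] by (cases "x \<in> S") auto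
      qed
    qed
    show "?g ` T \<subseteq> P \<times> ((V - S) \<rightarrow>\<^sub>E {0..<n})"
    proof (rule image_subsetI)
      fix \<phi> assume "\<phi> \<in> T"
      then have "h \<phi> \<in> P" "\<phi> \<in> V \<rightarrow>\<^sub>E {0..<n}" using P T by auto
      then show "?g \<phi> \<in> P \<times> ((V - S) \<rightarrow>\<^sub>E {0..<n})" using PiE_mem[of \<phi> V "\<lambda>_. {0..<n}"] by auto
    qed
    show "finite (P \<times> ((V - S) \<rightarrow>\<^sub>E {0..<n}))" using P V by (intro finite_cartesian_product finite_PiE) auto
  qed
  also have "\<dots> = card P * n ^ (card V - card S)"
    using V finite_subset[OF V(2,1)] by (simp add: card_cartesian_product card_PiE card_Diff_subset)
  finally show ?thesis .
qed

text \<open>Disjoint complete bipartite graphs K_{J,J}: two rows of h vertices are cut into blocks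
  of length J and corresponding blocks are joined. The rows are \<open>r * a\<close> and
  \<open>r * (h + b)\<close>, multiples of r and hence in one part. Full blocks supply at least h J
  / 2 \<ge> q edges, any q of which are kept.\<close>

lemma sparse_graph_exists:
  assumes r: "r > 0" and J: "0 < J" "2 * J \<le> h" and q: "2 * q \<le> h * J" and n: "2 * r * h \<le> (n::nat)"
  obtains B where "\<And>e. e \<in> B \<Longrightarrow> \<exists>a b. e = {a,b} \<and> a < n \<and> b < n \<and> a \<noteq> b \<and> a mod r = b mod r"
    "card B = q" "\<And>x. card {y. {x,y} \<in> B} \<le> J"
proof -
  have blk: "{b. b div J = k} = {k * J..<k * J + J}" for k :: nat
  proof (rule set_eqI)
    fix b
    have "b div J = k \<longleftrightarrow> k * J \<le> b \<and> b < (k + 1) * J"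
      using J(1) by (metis Suc_eq_plus1 div_less_iff_less_mult less_eq_div_iff_mult_less_eq less_Suc_eq_le order_antisym order_refl)
    then show "b \<in> {b. b div J = k} \<longleftrightarrow> b \<in> {k * J..<k * J + J}" by (simp add: algebra_simps)
  qed
  have cblk: "card {b. b div J = k} = J" and fblk: "finite {b. b div J = k}" for k :: nat unfolding blk by auto
  define S where "S = {(a,b). a < h \<and> b < h \<and> a div J = b div J}"
  have finS: "finite S" by (rule finite_subset[of _ "{..<h} \<times> {..<h}"]) (auto simp: S_def)
  let ?A = "{..<h div J * J}"
  have "Sigma ?A (\<lambda>a. {b. b div J = a div J}) \<subseteq> S"
  proof (rule subrelI)
    fix a b assume "(a,b) \<in> Sigma ?A (\<lambda>a. {b. b div J = a div J})"
    then have ab: "a < h div J * J" "b div J = a div J" by auto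
    have "a div J < h div J" using ab(1) J(1) by (simp add: div_less_iff_less_mult)
    then have "b < h div J * J" using ab(2) J(1) by (simp add: div_less_iff_less_mult[symmetric])
    moreover have "h div J * J \<le> h" by simp
    ultimately have "a < h" "b < h" using ab(1) by linarith+
    then show "(a,b) \<in> S" using ab(2) unfolding S_def by simp
  qed
  then have "card (Sigma ?A (\<lambda>a. {b. b div J = a div J})) \<le> card S" using finS by (rule card_mono[rotated])
  moreover have "card (Sigma ?A (\<lambda>a. {b. b div J = a div J})) = h div J * J * J"
    using fblk by (subst card_SigmaI) (auto simp: cblk)
  \<comment> \<open>The incomplete last block has fewer than J \<le> h/2 vertices, so full blocks
    cover at least half of a row.\<close>
  moreover have "h * J \<le> 2 * (h div J * J * J)"
  proof -
    have "h div J * J + h mod J = h" by simp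
    moreover have "h mod J < J" using J(1) by simp
    ultimately have "h \<le> 2 * (h div J * J)" using J(2) by linarith
    then have "h * J \<le> 2 * (h div J * J) * J" by (rule mult_right_mono) simp
    then show ?thesis by simp
  qed
  ultimately have "q \<le> card S" using q by linarith
  then obtain S' where S': "S' \<subseteq> S" "card S' = q" "finite S'" by (rule obtain_subset_with_card_n)
  define g where "g = (\<lambda>(a,b). {r * a, r * (h + b)})"
  have inj: "inj_on g S'"
  proof (rule inj_onI)
    fix p p' assume p: "p \<in> S'" "p' \<in> S'" "g p = g p'"
    obtain a b where ab: "p = (a,b)" "a < h" "b < h" using p(1) S'(1) by (auto simp: S_def)
    obtain a' b' where ab': "p' = (a',b')" "a' < h" "b' < h" using p(2) S'(1) by (auto simp: S_def)
    have "{r * a, r * (h + b)} = {r * a', r * (h + b')}" using p(3) ab ab' by (simp add: g_def)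
    then show "p = p'" using ab ab' r by (auto simp: doubleton_eq_iff)
  qed
  show ?thesis
  proof (rule that[of "g ` S'"])
    fix e assume "e \<in> g ` S'"
    then obtain a b where e: "e = {r * a, r * (h + b)}" "a < h" "b < h" using S'(1) by (auto simp: S_def g_def)
    have "r * (h + b) < n"
    proof -
      have "r * (h + b) < r * (2 * h)" using e r by simp
      moreover have "r * (2 * h) = 2 * r * h" by simp
      ultimately show ?thesis using n by linarith
    qed
    moreover have lt: "r * a < r * (h + b)" using e r by simp
    ultimately have "r * a < n" "r * (h + b) < n" by linarith+
    then show "\<exists>a b. e = {a,b} \<and> a < n \<and> b < n \<and> a \<noteq> b \<and> a mod r = b mod r"
      using e(1) less_imp_neq[OF lt] by (intro exI[of _ "r * a"] exI[of _ "r * (h + b)"] conjI) simp_all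
  next
    show "card (g ` S') = q" using card_image[OF inj] S'(2) by simp
  next
    fix x
    show "card {y. {x,y} \<in> g ` S'} \<le> J"
    proof (cases "x < r * h")
      case True
      have "{y. {x,y} \<in> g ` S'} \<subseteq> (\<lambda>b. r * (h + b)) ` {b. b div J = (x div r) div J}"
      proof
        fix y assume "y \<in> {y. {x,y} \<in> g ` S'}"
        then obtain a b where ab: "{x,y} = {r * a, r * (h + b)}" "a div J = b div J" using S'(1) by (auto simp: S_def g_def)
        have "x \<noteq> r * (h + b)" using True r by auto
        then have "x = r * a" "y = r * (h + b)" using ab(1) by (auto simp: doubleton_eq_iff)
        then show "y \<in> (\<lambda>b. r * (h + b)) ` {b. b div J = (x div r) div J}" using ab(2) r by auto
      qed
      then have "card {y. {x,y} \<in> g ` S'} \<le> card ((\<lambda>b. r * (h + b)) ` {b. b div J = (x div r) div J})"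
        using fblk by (intro card_mono finite_imageI)
      also have "\<dots> \<le> J" using card_image_le[OF fblk, of "\<lambda>b. r * (h + b)"] cblk by simp
      finally show ?thesis .
    next
      case False
      have "{y. {x,y} \<in> g ` S'} \<subseteq> (\<lambda>a. r * a) ` {a. a div J = (x div r - h) div J}"
      proof
        fix y assume "y \<in> {y. {x,y} \<in> g ` S'}"
        then obtain a b where ab: "{x,y} = {r * a, r * (h + b)}" "a div J = b div J" "a < h" using S'(1) by (auto simp: S_def g_def)
        have "x \<noteq> r * a" using False r ab(3) by auto
        then have "y = r * a" "x = r * (h + b)" using ab(1) by (auto simp: doubleton_eq_iff)
        then show "y \<in> (\<lambda>a. r * a) ` {a. a div J = (x div r - h) div J}" using ab(2) r by auto
      qed
      then have "card {y. {x,y} \<in> g ` S'} \<le> card ((\<lambda>a. r * a) ` {a. a div J = (x div r - h) div J})"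
        using fblk by (intro card_mono finite_imageI)
      also have "\<dots> \<le> J" using card_image_le[OF fblk, of "\<lambda>a. r * a"] cblk by simp
      finally show ?thesis .
    qed
  qed
qed

context critical
begin

text \<open>Every embedding uses an edge of B; those with exactly one are counted by
  \<open>Psi_upper\<close>. If two F-edges go into B, their ends have at most (2q)^2 positions when
  the edges are disjoint and at most 2q D when they share a vertex, and the other vertices are free.
  For D = o(n) and q = o(n^2) both are negligible against q n^(f-2).\<close>

lemma emb_sparse_upper:
  assumes B: "\<And>e. e \<in> B \<Longrightarrow> \<exists>a b. e = {a,b} \<and> a < n \<and> b < n \<and> a \<noteq> b \<and> a mod r = b mod r"
    and q: "card B = q" and deg: "\<And>x. card {y. {x,y} \<in> B} \<le> D" and n: "n > 0"
  shows "real (card (emb VF EF n (turan_edges r n \<union> B))) \<le> real q * (real N * (real n / real r + 1) ^ (f - 2))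
     + real (card EF) ^ 2 * ((4 * real q ^ 2 / real n ^ 2 + 2 * real q * real D / real n) * real n ^ (f - 2))"
proof -
  let ?E = "turan_edges r n \<union> B" and ?\<pi> = "\<lambda>z. z mod r"
  have r0: "r > 0" using r2 by simp
  have Bs: "B \<subseteq> pairs n"
  proof
    fix e assume "e \<in> B"
    then obtain a b where "e = {a,b}" "a < n" "b < n" "a \<noteq> b" using B by blast
    then show "e \<in> pairs n" by (simp add: pairs_iff)
  qed
  have finB: "finite B" by (rule finite_subset[OF Bs finite_pairs])
  let ?A = "{(a,b). {a,b} \<in> B}"
  have cA: "card ?A = 2 * q" using card_arcs[OF Bs] q by simp
  have lt: "a < n \<and> b < n \<and> a \<noteq> b" if "{a,b} \<in> B" for a b using that Bs pairs_iff[of a b n] by auto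
  have finA: "finite ?A" by (rule finite_subset[of _ "{..<n} \<times> {..<n}"]) (auto dest: lt)
  have finN: "finite {y. {x,y} \<in> B}" for x by (rule finite_subset[of _ "{..<n}"]) (auto dest: lt)
  define X where "X = (\<lambda>(e1,e2). {\<phi> \<in> emb VF EF n ?E. \<phi> ` e1 \<in> B \<and> \<phi> ` e2 \<in> B})"
  let ?P = "{(e1,e2) \<in> EF \<times> EF. e1 \<noteq> e2}"
  have finP: "finite ?P" using finE by (rule_tac finite_subset[of _ "EF \<times> EF"]) auto
  let ?b = "(4 * real q ^ 2 / real n ^ 2 + 2 * real q * real D / real n) * real n ^ (f - 2)"
  have embP: "emb VF EF n ?E \<subseteq> VF \<rightarrow>\<^sub>E {0..<n}" by (auto simp: emb_def)
  have shared: "real (card (X p)) \<le> ?b" if p: "p = ({a,b},{a,c})" "{a,b} \<in> EF" "{a,c} \<in> EF" "b \<noteq> c" for p a b c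
  proof -
    let ?S = "{a,b,c}" and ?Q = "Sigma ?A (\<lambda>p. {y. {fst p,y} \<in> B})"
    have S: "?S \<subseteq> VF" "card ?S = 3" using p edge_mem edge_neq by auto
    have f3: "f - 2 = (f - 3) + 1" using f_ge3 by simp
    have "card (X p) \<le> card ?Q * n ^ (f - card ?S)"
    proof (rule card_determined_le[where h = "\<lambda>\<phi>. ((\<phi> a, \<phi> b), \<phi> c)"])
      show "X p \<subseteq> VF \<rightarrow>\<^sub>E {0..<n}" using embP by (auto simp: X_def p)
      show "(\<lambda>\<phi>. ((\<phi> a, \<phi> b), \<phi> c)) ` X p \<subseteq> ?Q" by (auto simp: X_def p)
      show "finite ?Q" using finA finN by (intro finite_SigmaI) auto
    qed (use finV S in auto)
    moreover have "card ?Q \<le> 2 * q * D"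
    proof -
      have "card ?Q = (\<Sum>p\<in>?A. card {y. {fst p,y} \<in> B})" using finA finN by (intro card_SigmaI) auto
      also have "\<dots> \<le> (\<Sum>p\<in>?A. D)" by (intro sum_mono deg)
      finally show ?thesis using cA by simp
    qed
    then have "card ?Q * n ^ (f - card ?S) \<le> 2 * q * D * n ^ (f - 3)"
      unfolding S(2) by (intro mult_right_mono) auto
    ultimately have "card (X p) \<le> 2 * q * D * n ^ (f - 3)" by linarith
    then have "real (card (X p)) \<le> real (2 * q * D * n ^ (f - 3))" by (rule of_nat_mono)
    also have "\<dots> = (2 * real q * real D / real n) * real n ^ (f - 2)" unfolding f3 using n by simp
    also have "\<dots> \<le> ?b" by (intro mult_right_mono) auto
    finally show ?thesis .
  qed
  have Xb: "real (card (X p)) \<le> ?b" if "p \<in> ?P" for p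
  proof -
    obtain e1 e2 where p: "p = (e1,e2)" "e1 \<in> EF" "e2 \<in> EF" "e1 \<noteq> e2" using \<open>p \<in> ?P\<close> by auto
    obtain a b where ab: "e1 = {a,b}" "a \<in> VF" "b \<in> VF" "a \<noteq> b" using edge_cases[OF p(2)] by blast
    obtain c d where cd: "e2 = {c,d}" "c \<in> VF" "d \<in> VF" "c \<noteq> d" using edge_cases[OF p(3)] by blast
    consider "c = a" | "d = a" | "c = b" | "d = b" | "c \<noteq> a" "d \<noteq> a" "c \<noteq> b" "d \<noteq> b" by blast
    then show ?thesis
    proof cases
      case 1
      have "b \<noteq> d" using 1 ab cd p(4) by auto
      then show ?thesis using 1 ab cd p by (intro shared[of p a b d]) auto
    next
      case 2
      have "b \<noteq> c" using 2 ab cd p(4) by auto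
      then show ?thesis using 2 ab cd p by (intro shared[of p a b c]) (auto simp: insert_commute)
    next
      case 3
      have "a \<noteq> d" using 3 ab cd p(4) by auto
      then show ?thesis using 3 ab cd p by (intro shared[of p b a d]) (auto simp: insert_commute)
    next
      case 4
      have "a \<noteq> c" using 4 ab cd p(4) by auto
      then show ?thesis using 4 ab cd p by (intro shared[of p b a c]) (auto simp: insert_commute)
    next
      case 5
      let ?S = "{a,b,c,d}"
      have S: "?S \<subseteq> VF" "card ?S = 4" using ab cd 5 by auto
      have "4 \<le> f" using card_mono[OF finV S(1)] S(2) by simp
      then have f4: "f - 2 = (f - 4) + 2" by simp
      have "card (X p) \<le> card (?A \<times> ?A) * n ^ (f - card ?S)"
      proof (rule card_determined_le[where h = "\<lambda>\<phi>. ((\<phi> a, \<phi> b), (\<phi> c, \<phi> d))"])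
        show "X p \<subseteq> VF \<rightarrow>\<^sub>E {0..<n}" using embP by (auto simp: X_def p)
        show "(\<lambda>\<phi>. ((\<phi> a, \<phi> b), (\<phi> c, \<phi> d))) ` X p \<subseteq> ?A \<times> ?A" by (auto simp: X_def p ab cd)
        show "finite (?A \<times> ?A)" using finA by blast
      qed (use finV S in auto)
      then have "card (X p) \<le> (2 * q) * (2 * q) * n ^ (f - 4)"
        unfolding S(2) card_cartesian_product cA .
      then have "real (card (X p)) \<le> real ((2 * q) * (2 * q) * n ^ (f - 4))" by (rule of_nat_mono)
      also have "\<dots> = (4 * real q ^ 2 / real n ^ 2) * real n ^ (f - 2)"
        unfolding f4 power_add using n by (simp add: power2_eq_square)
      also have "\<dots> \<le> ?b" by (intro mult_right_mono) auto
      finally show ?thesis .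
    qed
  qed
  have cov: "emb VF EF n ?E \<subseteq> (\<Union>e\<in>B. Psi n ?E ?\<pi> {} e) \<union> (\<Union>p\<in>?P. X p)"
  proof
    fix \<phi> assume em: "\<phi> \<in> emb VF EF n ?E"
    define M where "M = {e' \<in> (\<lambda>e. \<phi> ` e) ` EF. \<forall>a\<in>e'. \<forall>b\<in>e'. a mod r = b mod r}"
    have "\<And>v. v \<in> VF \<Longrightarrow> \<phi> v mod r < r" using r0 by simp
    then obtain u v where uv: "{u,v} \<in> EF" "\<phi> u mod r = \<phi> v mod r"
      using mono_edge_exists[of "\<lambda>v. \<phi> v mod r"] by blast
    have "\<phi> ` {u,v} \<in> (\<lambda>e. \<phi> ` e) ` EF" using uv(1) by (rule imageI)
    then have uM: "\<phi> ` {u,v} \<in> M" using uv(2) by (auto simp: M_def)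
    have MB: "e' \<in> B" if e': "e' \<in> M" for e'
    proof -
      obtain e where e: "e \<in> EF" "e' = \<phi> ` e" using e' unfolding M_def by blast
      obtain a b where ab: "e = {a,b}" using edge_cases[OF e(1)] by blast
      have "{\<phi> a, \<phi> b} \<in> ?E" using emb_D(4)[OF em] e(1) ab by simp
      moreover have "\<phi> a mod r = \<phi> b mod r"
      proof -
        have "\<forall>x\<in>e'. \<forall>y\<in>e'. x mod r = y mod r" using e' unfolding M_def mem_Collect_eq by (rule conjunct2)
        moreover have "\<phi> a \<in> e'" "\<phi> b \<in> e'" using e(2) ab by simp_all
        ultimately show ?thesis by blast
      qed
      ultimately show ?thesis using e(2) ab by (auto simp: turan_iff)
    qed
    show "\<phi> \<in> (\<Union>e\<in>B. Psi n ?E ?\<pi> {} e) \<union> (\<Union>p\<in>?P. X p)"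
    proof (cases "M = {\<phi> ` {u,v}}")
      case True
      then have "\<phi> \<in> Psi n ?E ?\<pi> {} (\<phi> ` {u,v})" using em unfolding Psi_def M_def by simp
      then show ?thesis using MB[OF uM] by blast
    next
      case False
      then obtain e' where e': "e' \<in> M" "e' \<noteq> \<phi> ` {u,v}" using uM by blast
      obtain e where e: "e \<in> EF" "e' = \<phi> ` e" using e'(1) unfolding M_def by blast
      have "(e,{u,v}) \<in> ?P" using e e'(2) uv(1) by auto
      moreover have "\<phi> \<in> X (e,{u,v})" unfolding X_def using em MB[OF e'(1)] MB[OF uM] e(2) by simp
      ultimately show ?thesis by blast
    qed
  qed
  have finX: "finite (X p)" for p
    unfolding X_def using finite_emb[OF finV] by (cases p) simp
  have "card (emb VF EF n ?E) \<le> card ((\<Union>e\<in>B. Psi n ?E ?\<pi> {} e) \<union> (\<Union>p\<in>?P. X p))"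
    using finB finP finite_Psi finX by (intro card_mono cov) auto
  also have "\<dots> \<le> card (\<Union>e\<in>B. Psi n ?E ?\<pi> {} e) + card (\<Union>p\<in>?P. X p)" by (rule card_Un_le)
  also have "\<dots> \<le> (\<Sum>e\<in>B. card (Psi n ?E ?\<pi> {} e)) + (\<Sum>p\<in>?P. card (X p))"
    by (intro add_mono card_UN_le finB finP)
  finally have "real (card (emb VF EF n ?E)) \<le> real ((\<Sum>e\<in>B. card (Psi n ?E ?\<pi> {} e)) + (\<Sum>p\<in>?P. card (X p)))"
    by (rule of_nat_mono)
  then have "real (card (emb VF EF n ?E)) \<le> (\<Sum>e\<in>B. real (card (Psi n ?E ?\<pi> {} e))) + (\<Sum>p\<in>?P. real (card (X p)))" by simp
  also have "\<dots> \<le> (\<Sum>e\<in>B. real N * (real n / real r + 1) ^ (f - 2)) + (\<Sum>p\<in>?P. ?b)"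
  proof (intro add_mono sum_mono Xb)
    fix e assume "e \<in> B"
    then obtain a b where e: "e = {a,b}" "a \<noteq> b" "a mod r = b mod r" using B by blast
    show "real (card (Psi n ?E ?\<pi> {} e)) \<le> real N * (real n / real r + 1) ^ (f - 2)" unfolding e(1)
      by (rule Psi_upper[where i = "a mod r"]) (use e r0 card_residue_class_real(2) in auto)
  qed
  also have "\<dots> \<le> real q * (real N * (real n / real r + 1) ^ (f - 2)) + real (card EF) ^ 2 * ?b"
  proof -
    have "card ?P \<le> card (EF \<times> EF)" using finE by (intro card_mono) auto
    then have "real (card ?P) \<le> real (card EF) ^ 2" by (simp add: card_cartesian_product power2_eq_square flip: of_nat_mult)
    then have "real (card ?P) * ?b \<le> real (card EF) ^ 2 * ?b" by (intro mult_right_mono) auto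
    then show ?thesis using q by simp
  qed
  finally show ?thesis .
qed

text \<open>An infinite \<rho>-hat makes \<open>PF_dominates\<close> true for every argument, so
  \<open>ratio_lower\<close> applies up to q = \<delta> n^2; the matching upper bound is
  \<open>emb_sparse_upper\<close>.\<close>

lemma h_num_asymp:
  fixes q :: "nat \<Rightarrow> nat"
  assumes rho: "rho_hat r VF EF = \<infinity>" and q1: "\<And>n. 1 \<le> q n" and qo: "(\<lambda>n. real (q n) / real n ^ 2) \<longlonglongrightarrow> 0"
  shows "(\<lambda>n. real (h_num VF EF n (q n)) / (real (q n) * real (c_num r VF EF n))) \<longlonglongrightarrow> 1"
proof -
  define R where "R = real r"
  have R2: "R \<ge> 2" using r2 by (simp add: R_def)
  define x where "x = (\<lambda>n. real (q n) / real n ^ 2)"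
  have x0: "x \<longlonglongrightarrow> 0" using qo by (simp add: x_def)
  have lim: "(\<lambda>n. c / real n) \<longlonglongrightarrow> 0" for c :: real by (rule lim_const_over_n)
  let ?ratio = "\<lambda>n. real (h_num VF EF n (q n)) / (real (q n) * real (c_num r VF EF n))"
  obtain n2 where ex: "\<And>n. n \<ge> n2 \<Longrightarrow> ex_num VF EF n = card (turan_edges r n)" using ex_num_eq by blast
  let ?a = "real (aut VF EF)"
  have ap: "?a > 0" using aut_pos by simp
  \<comment> \<open>The bound of \<open>emb_sparse_upper\<close> divided by \<open>aut\<close> and
    by q c(n,F), with D/n replaced by the upper estimate 8 R x + 1/n.\<close>
  define W where "W = (\<lambda>n. (real N * (1 / R + 1 / real n) ^ (f - 2)
     + real (card EF) ^ 2 * (4 * x n + 2 * (8 * R * x n + 1 / real n))) / ?a / cden n)"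
  have Wl: "W \<longlonglongrightarrow> (real N * (1 / R + 0) ^ (f - 2) + real (card EF) ^ 2 * (4 * 0 + 2 * (8 * R * 0 + 0))) / ?a / a0"
    unfolding W_def using ap a0_pos by (intro tendsto_intros lim x0 c_num_lim) auto
  have We: "(real N * (1 / R + 0) ^ (f - 2) + real (card EF) ^ 2 * (4 * 0 + 2 * (8 * R * 0 + 0))) / ?a / a0 = 1"
  proof -
    have "real N * (1 / R) ^ (f - 2) / ?a = a0" by (simp add: a0_def R_def)
    then show ?thesis using a0_pos by simp
  qed
  have W1: "W \<longlonglongrightarrow> 1" using Wl unfolding We .
  have "(\<lambda>n. 64 * R ^ 2 * x n + 8 * R / real n) \<longlonglongrightarrow> 64 * R ^ 2 * 0 + 0" by (intro tendsto_intros lim x0)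
  then have evs: "eventually (\<lambda>n. 64 * R ^ 2 * x n + 8 * R / real n < 1) sequentially"
    by (intro order_tendstoD(2)) auto
  \<comment> \<open>The existence of an extremal graph is recorded as well, because the lower bound
    speaks only about members of \<open>H_set\<close>.\<close>
  have key: "eventually (\<lambda>n. (\<exists>E\<in>H_set VF EF n (q n). num_copies VF EF {0..<n} E = h_num VF EF n (q n)) \<and> ?ratio n \<le> W n) sequentially"
    using evs cden_pos eventually_ge_at_top[of "max n2 (4 * r)"]
  proof eventually_elim
    case (elim n)
    have n: "n \<ge> 4 * r" "n \<ge> n2" using elim(3) by auto
    have n0: "n > 0" "real n > 0" using n r2 by auto
    have q0: "real (q n) > 0" using q1[of n] by simp
    define h where "h = n div (2 * r)"
    \<comment> \<open>About 2q/h, the degree needed for h J \<ge> 2q; adding 1 covers the rounding.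
      As h is of order n and q = o(n^2), J is o(n).\<close>
    define J where "J = 2 * q n div h + 1"
    have h1: "2 * r * h \<le> n" unfolding h_def by simp
    have hlow: "real n / (4 * R) \<le> real h"
    proof -
      have r0: "2 * r > 0" using r2 by simp
      have "2 * r * h + n mod (2 * r) = n" unfolding h_def by simp
      then have "n \<le> 2 * r * h + 2 * r" using mod_less_divisor[OF r0, of n] by linarith
      then have "n \<le> 4 * r * h" using n(1) by linarith
      then have "real n \<le> real (4 * r * h)" by (rule of_nat_mono)
      then show ?thesis using R2 by (simp add: R_def field_simps)
    qed
    have hp: "real h > 0" using hlow n0 R2 by (meson divide_pos_pos less_le_trans mult_pos_pos zero_less_numeral order.strict_trans2)
    have Jup: "real J \<le> 8 * R * real (q n) / real n + 1"
    proof -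
      have "2 * q n div h * h \<le> 2 * q n" by simp
      then have "real (2 * q n div h) * real h \<le> 2 * real (q n)" by (metis of_nat_le_iff of_nat_mult of_nat_numeral)
      then have "real (2 * q n div h) \<le> 2 * real (q n) / real h" using hp by (simp add: pos_le_divide_eq)
      also have "\<dots> \<le> 2 * real (q n) / (real n / (4 * R))" using hlow hp n0 R2 by (intro divide_left_mono mult_pos_pos) auto
      finally show ?thesis by (simp add: J_def mult_ac)
    qed
    \<comment> \<open>The condition in \<open>evs\<close> is made for this: it is the bound on J,
      multiplied by 8R/n, being below 1.\<close>
    have J2: "2 * J \<le> h"
    proof -
      have "8 * R * real (q n) / real n + 1 \<le> real n / (8 * R)"
      proof -
        have "(8 * R * real (q n) / real n + 1) * (8 * R / real n) = 64 * R ^ 2 * x n + 8 * R / real n"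
        proof -
          have "8 * R * real (q n) / real n * (8 * R / real n) = 64 * R ^ 2 * x n" by (simp add: x_def power2_eq_square)
          then show ?thesis by (simp only: distrib_right mult_1)
        qed
        then have "(8 * R * real (q n) / real n + 1) * (8 * R / real n) \<le> 1" using elim(1) by simp
        then show ?thesis using n0 R2 by (simp add: field_simps)
      qed
      then have "2 * real J \<le> real n / (4 * R)" using Jup by simp
      then have "2 * real J \<le> real h" using hlow by linarith
      then show ?thesis by linarith
    qed
    have qJ: "2 * q n \<le> h * J"
    proof -
      have h0: "h > 0" using hp by simp
      have "2 * q n div h * h + 2 * q n mod h = 2 * q n" by simp
      moreover have "2 * q n mod h < h" using h0 by simp
      ultimately have "2 * q n \<le> 2 * q n div h * h + h" by linarith
      then show ?thesis unfolding J_def distrib_left mult_1_right by (simp only: mult.commute[of h])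
    qed
    obtain B where B: "\<And>e. e \<in> B \<Longrightarrow> \<exists>a b. e = {a,b} \<and> a < n \<and> b < n \<and> a \<noteq> b \<and> a mod r = b mod r"
      "card B = q n" "\<And>x. card {y. {x,y} \<in> B} \<le> J"
    proof (rule sparse_graph_exists[OF _ _ J2 qJ h1])
      show "r > 0" using r2 by simp
      show "0 < J" by (simp add: J_def)
    qed blast
    let ?E = "turan_edges r n \<union> B"
    have Bs: "B \<subseteq> pairs n"
    proof
      fix e assume "e \<in> B"
      then obtain a b where "e = {a,b}" "a < n" "b < n" "a \<noteq> b" using B(1) by blast
      then show "e \<in> pairs n" by (simp add: pairs_iff)
    qed
    have Es: "?E \<subseteq> pairs n" using Bs turan_sub by blast
    have "turan_edges r n \<inter> B = {}"
    proof (rule ccontr)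
      assume "turan_edges r n \<inter> B \<noteq> {}"
      then obtain e where e: "e \<in> turan_edges r n" "e \<in> B" by blast
      then obtain a b where "e = {a,b}" "a mod r = b mod r" using B(1) by blast
      then show False using e(1) by (simp add: turan_iff)
    qed
    then have "card ?E = card (turan_edges r n) + q n"
      using finite_subset[OF turan_sub finite_pairs] finite_subset[OF Bs finite_pairs] B(2) by (simp add: card_Un_disjoint)
    then have cE: "card ?E = ex_num VF EF n + q n" using ex[OF n(2)] by simp
    obtain E' where E': "E' \<in> H_set VF EF n (q n)" "num_copies VF EF {0..<n} E' = h_num VF EF n (q n)"
      "h_num VF EF n (q n) \<le> num_copies VF EF {0..<n} ?E" by (rule h_num_attained[OF Es cE])
    have npf: "real n ^ (f - 2) > 0" using n0 by simp
    have cn: "real (c_num r VF EF n) > 0" using elim(2) npf by (simp add: zero_less_divide_iff)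
    have emb: "?a * real (num_copies VF EF {0..<n} ?E) \<le> real (q n) * (real N * (real n / R + 1) ^ (f - 2))
     + real (card EF) ^ 2 * ((4 * real (q n) ^ 2 / real n ^ 2 + 2 * real (q n) * real J / real n) * real n ^ (f - 2))"
      using emb_sparse_upper[OF B n0(1)] card_emb[OF graph, of n ?E] by (simp add: R_def)
    have p1: "(real n / R + 1) ^ (f - 2) = (1 / R + 1 / real n) ^ (f - 2) * real n ^ (f - 2)"
      using n0 by (simp add: power_mult_distrib[symmetric] distrib_right)
    have p2: "4 * real (q n) ^ 2 / real n ^ 2 + 2 * real (q n) * real J / real n = real (q n) * (4 * x n + 2 * (real J / real n))"
      by (simp add: x_def power2_eq_square algebra_simps)
    have p3: "real J / real n \<le> 8 * R * x n + 1 / real n"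
    proof -
      have "real J / real n \<le> (8 * R * real (q n) / real n + 1) / real n" using Jup by (intro divide_right_mono) auto
      also have "\<dots> = 8 * R * x n + 1 / real n" by (simp add: x_def power2_eq_square add_divide_distrib)
      finally show ?thesis .
    qed
    have "?a * real (h_num VF EF n (q n)) \<le> ?a * real (num_copies VF EF {0..<n} ?E)"
      using E'(3) by (intro mult_left_mono) auto
    also note emb
    also have "real (q n) * (real N * (real n / R + 1) ^ (f - 2))
     + real (card EF) ^ 2 * ((4 * real (q n) ^ 2 / real n ^ 2 + 2 * real (q n) * real J / real n) * real n ^ (f - 2))
     = real (q n) * real n ^ (f - 2) * (real N * (1 / R + 1 / real n) ^ (f - 2) + real (card EF) ^ 2 * (4 * x n + 2 * (real J / real n)))"
      unfolding p1 p2 by (simp only: distrib_left mult_ac)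
    also have "\<dots> \<le> real (q n) * real n ^ (f - 2) * (real N * (1 / R + 1 / real n) ^ (f - 2) + real (card EF) ^ 2 * (4 * x n + 2 * (8 * R * x n + 1 / real n)))"
      using p3 by (intro mult_left_mono add_left_mono) auto
    finally have hb: "?a * real (h_num VF EF n (q n)) \<le> real (q n) * real n ^ (f - 2) * (real N * (1 / R + 1 / real n) ^ (f - 2) + real (card EF) ^ 2 * (4 * x n + 2 * (8 * R * x n + 1 / real n)))" .
    define Y where "Y = real N * (1 / R + 1 / real n) ^ (f - 2) + real (card EF) ^ 2 * (4 * x n + 2 * (8 * R * x n + 1 / real n))"
    have "real (h_num VF EF n (q n)) \<le> real (q n) * real n ^ (f - 2) * Y / ?a"
      using hb ap unfolding Y_def[symmetric] by (simp add: pos_le_divide_eq mult.commute)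
    then have "?ratio n \<le> (real (q n) * real n ^ (f - 2) * Y / ?a) / (real (q n) * real (c_num r VF EF n))"
      by (intro divide_right_mono) auto
    also have "\<dots> = W n" unfolding W_def Y_def[symmetric] using q0 npf by (simp add: mult_ac)
    finally have "?ratio n \<le> W n" .
    then show ?case using E' by blast
  qed
  show ?thesis
  proof (rule order_tendstoI)
    fix a :: real assume a: "1 < a"
    have "eventually (\<lambda>n. W n < a) sequentially" by (rule order_tendstoD(2)[OF W1 a])
    with key show "eventually (\<lambda>n. ?ratio n < a) sequentially" by eventually_elim linarith
  next
    fix a :: real assume a: "a < 1"
    define \<epsilon> where "\<epsilon> = (1 - a) / 2"
    have eps: "\<epsilon> > 0" "a < 1 - \<epsilon>" using a by (auto simp: \<epsilon>_def field_simps)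
    obtain \<delta> n0 where d: "\<delta> > 0" and low: "\<And>n q E. n \<ge> n0 \<Longrightarrow> E \<in> H_set VF EF n q \<Longrightarrow> 1 \<le> q \<Longrightarrow>
     real q \<le> \<delta> * real n ^ 2 \<Longrightarrow> PF_dominates (real q / real n) \<Longrightarrow>
     1 - \<epsilon> \<le> real (num_copies VF EF {0..<n} E) / (real q * real (c_num r VF EF n))"
      using ratio_lower[OF eps(1)] by blast
    have "eventually (\<lambda>n. x n < \<delta>) sequentially" by (rule order_tendstoD(2)[OF x0 d])
    with key eventually_ge_at_top[of "max 1 n0"] show "eventually (\<lambda>n. a < ?ratio n) sequentially"
    proof eventually_elim
      case (elim n)
      then obtain E where E: "E \<in> H_set VF EF n (q n)" "num_copies VF EF {0..<n} E = h_num VF EF n (q n)" by blast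
      have n1: "real n > 0" "n \<ge> n0" using elim(2) by auto
      have "real (q n) \<le> \<delta> * real n ^ 2" using elim(3) n1 by (simp add: x_def pos_divide_less_eq less_imp_le)
      moreover have "PF_dominates (real (q n) / real n)" by (rule PF_dominates_rho_hat) (simp add: rho)
      ultimately have "1 - \<epsilon> \<le> ?ratio n" using low[OF n1(2) E(1) q1] E(2) by simp
      then show ?case using eps(2) by linarith
    qed
  qed
qed

end

theorem theorem8:
  fixes r :: nat and VF :: "nat set" and EF :: "nat set set"
  assumes "r \<ge> 2" and "critical_graph r VF EF"
  shows "c2 r VF EF = rho_hat r VF EF - ereal (1 - 1 / real r) \<and>
    (rho_hat r VF EF = \<infinity> \<longrightarrow>
      (\<forall>q :: nat \<Rightarrow> nat. (\<forall>n. 1 \<le> q n) \<and> (\<lambda>n. real (q n) / real n ^ 2) \<longlonglongrightarrow> 0 \<longrightarrow>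
        (\<lambda>n. real (h_num VF EF n (q n)) / (real (q n) * real (c_num r VF EF n))) \<longlonglongrightarrow> 1))"
proof -
  interpret critical r VF EF using assms by unfold_locales
  have "1 - 1 / real r = (real r - 1) / real r" using assms(1) by (simp add: diff_divide_distrib)
  then show ?thesis using c2_rho_hat h_num_asymp by simp
qed

end
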